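(* Let $p$ be a prime, $n\ge 1$ an integer, and let $F$ be a finite field of characteristic $p$ with $q=p^n$ elements. Let $U(F[C_{16}\times C_2])$ be the unit group of the group algebra $F[C_{16}\times C_2]$. (1) If $p=2$, then $$U(F[C_{16}\times C_2])\cong C_{16}^{n}\times C_{8}^{n}\times C_{4}^{2n}\times C_{2}^{20n}\times C_{2^n-1}.$$ (2) If $p\neq 2$, then $U(F[C_{16}\times C_2])$ is isomorphic to: - $C_{p^n-1}^{32}$, if $q\equiv 1\pmod{16}$; - $C_{p^n-1}^{4}\times C_{p^{2n}-1}^{14}$, if $q\equiv -1\pmod{16}$; - $C_{p^n-1}^{4}\times C_{p^{2n}-1}^{6}\times C_{p^{4n}-1}^{4}$, if $q\equiv 3$ or $-5\pmod{16}$; - $C_{p^n-1}^{8}\times C_{p^{2n}-1}^{4}\times C_{p^{4n}-1}^{4}$, if $q\equiv -3$ or $5\pmod{16}$; - $C_{p^n-1}^{4}\times C_{p^{2n}-1}^{14}$, if $q\equiv 7\pmod{16}$; - $C_{p^n-1}^{16}\times C_{p^{2n}-1}^{8}$, if $q\equiv -7\pmod{16}$.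
   Context: $C_m$ denotes the cyclic group of order $m$, and $C_m^k$ denotes the direct product of $k$ copies of $C_m$. For a group $G$ and a field $F$, $FG$ (also written $F[G]$) is the group algebra and $U(FG)$ is the multiplicative group of all its invertible elements. *)

theory Defs
  imports "HOL-Algebra.Algebra" "HOL-Number_Theory.Cong"
begin

text \<open>
  The group algebra \<open>RG\<close>: a formal sum \<open>\<Sum> f(g) g\<close> is the finitely supported coefficient
  function \<open>f\<close>, extensional on \<open>carrier G\<close> so that equal sums are equal functions.
  In the convolution product, the sum runs over the support of the left factor rather than
  all of \<open>carrier G\<close>, because \<^const>\<open>finsum\<close> is meaningful only on finite sets.
\<close>

definition group_algebra ::
    "('a, 'm) ring_scheme \<Rightarrow> ('g, 'k) monoid_scheme \<Rightarrow> ('a, 'g \<Rightarrow> 'a) module" where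
  "group_algebra R G =
    \<lparr>carrier = {f \<in> carrier G \<rightarrow>\<^sub>E carrier R. finite {g \<in> carrier G. f g \<noteq> \<zero>\<^bsub>R\<^esub>}},
     monoid.mult = (\<lambda>f h. \<lambda>g\<in>carrier G.
       \<Oplus>\<^bsub>R\<^esub>x\<in>{x \<in> carrier G. f x \<noteq> \<zero>\<^bsub>R\<^esub>}. f x \<otimes>\<^bsub>R\<^esub> h (inv\<^bsub>G\<^esub> x \<otimes>\<^bsub>G\<^esub> g)),
     one = (\<lambda>g\<in>carrier G. if g = \<one>\<^bsub>G\<^esub> then \<one>\<^bsub>R\<^esub> else \<zero>\<^bsub>R\<^esub>),
     ring.zero = (\<lambda>g\<in>carrier G. \<zero>\<^bsub>R\<^esub>),
     ring.add = (\<lambda>f h. \<lambda>g\<in>carrier G. f g \<oplus>\<^bsub>R\<^esub> h g),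
     module.smult = (\<lambda>a f. \<lambda>g\<in>carrier G. a \<otimes>\<^bsub>R\<^esub> f g)\<rparr>"

text \<open>The additive order of \<open>1\<close>; \<^const>\<open>group.ord\<close> is \<open>0\<close> for elements of infinite order.\<close>

definition ring_characteristic :: "('a, 'm) ring_scheme \<Rightarrow> nat" where
  "ring_characteristic R = group.ord (add_monoid R) \<one>\<^bsub>R\<^esub>"

text \<open>\<open>C\<^sub>m\<^sup>k\<close>\<close>

definition cyclic_power :: "nat \<Rightarrow> nat \<Rightarrow> (nat \<Rightarrow> int) monoid" where
  "cyclic_power m k = product_group {..<k} (\<lambda>_. integer_mod_group m)"

end

theory Submission
  imports Defs "HOL-Combinatorics.List_Permutation"
begin

text \<open>
  For \<open>p \<noteq> 2\<close> the \<open>q\<^sup>4\<close>-power map is the identity on \<open>FG\<close>, since it is additive, fixes \<open>F\<close> and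
  fixes \<open>G\<close> (the exponent of \<open>G\<close> is \<open>16\<close> and \<open>q\<^sup>4 \<equiv> 1\<close> modulo \<open>16\<close>). A finite commutative \<open>F\<close>-algebra with
  this property splits along idempotents into fields with \<open>q\<^sup>d\<close> elements, \<open>d\<close> dividing \<open>4\<close>. The
  multiplicities of \<open>d = 1, 2, 4\<close> are read off from the numbers of fixed points of the
  \<open>q\<^sup>e\<close>-power maps: a field with \<open>q\<^sup>d\<close> elements contributes \<open>q\<^bsup>gcd d e\<^esup>\<close> fixed points, while in \<open>FG\<close> the fixed
  points are the coefficient functions that are constant on the orbits of \<open>g \<mapsto> g\<^bsup>q^e\<^esup>\<close> on \<open>G\<close>.

  For \<open>p = 2\<close> the \<open>16\<close>-th power of every element of \<open>FG\<close> is a scalar, and scalars have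
  \<open>16\<close>-th roots in \<open>F\<close>, so the unit group is the product of \<open>F\<^sup>*\<close> and \<open>V = {x. x\<^bsup>16\<^esup> = 1}\<close>. By the basis
  theorem \<open>V\<close> is a product of cyclic \<open>2\<close>-groups, determined by the numbers of solutions of
  \<open>x\<^bsup>2^i\<^esup> = 1\<close>. These are the sizes of the kernels of the additive maps \<open>x \<mapsto> x\<^bsup>2^i\<^esup>\<close>, whose images are the functions
  supported on \<open>{g\<^bsup>2^i\<^esup> | g \<in> G}\<close>.
\<close>

section \<open>Products of cyclic groups\<close>

text \<open>Neither case exhibits the components of the group algebra; they are pinned down by
  counting alone. This avoids primitive roots of unity, characters and the construction of extension
  fields. A component for odd \<open>p\<close> is known only as a field with \<open>q ^ d\<close>
  elements, which suffices because the unit group of a finite field is cyclic of known order. A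
  factor for \<open>p = 2\<close> is known only as some cyclic group of order 2, 4, 8 or 16. Both
  kinds of count (fixed points of a power map, solutions of a power equation) are multiplicative
  over direct products. Hence their logarithms, to base \<open>q\<close> and to base 2, are linear
  in the unknown multiplicities, and each case ends with a small linear system having a unique
  solution. The other side of each equation depends only on the action of powers on the 32 group
  elements, so it can be evaluated. For odd \<open>p\<close> it depends on \<open>q\<close> only
  through the residue of \<open>q\<close> modulo 16, which explains the case distinction of the
  theorem.\<close>

lemma (in comm_group) DirProd_subgroups_iso:
  assumes A: "subgroup A G" and B: "subgroup B G" and AB: "A \<inter> B = {\<one>}"
    and gen: "\<And>x. x \<in> carrier G \<Longrightarrow> \<exists>a\<in>A. \<exists>b\<in>B. x = a \<otimes> b"
  shows "G\<lparr>carrier := A\<rparr> \<times>\<times> G\<lparr>carrier := B\<rparr> \<cong> G"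
proof -
  note Ac = subgroup.mem_carrier[OF A] and Bc = subgroup.mem_carrier[OF B]
  have "(\<lambda>(a, b). a \<otimes> b) \<in> iso (G\<lparr>carrier := A\<rparr> \<times>\<times> G\<lparr>carrier := B\<rparr>) G"
  proof (rule isoI)
    show "(\<lambda>(a, b). a \<otimes> b) \<in> hom (G\<lparr>carrier := A\<rparr> \<times>\<times> G\<lparr>carrier := B\<rparr>) G"
      by (auto simp: hom_def Ac Bc m_ac)
    have "a = a' \<and> b = b'" if *: "a \<in> A" "a' \<in> A" "b \<in> B" "b' \<in> B" "a \<otimes> b = a' \<otimes> b'" for a a' b b'
    proof -
      have "inv a' \<otimes> a = b' \<otimes> inv b"
        using * by (smt (verit) Ac Bc inv_closed inv_solve_left inv_solve_right' m_assoc m_closed)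
      moreover have "inv a' \<otimes> a \<in> A"
        using * A by (simp add: subgroup.m_closed subgroup.m_inv_closed)
      moreover have "b' \<otimes> inv b \<in> B"
        using * B by (simp add: subgroup.m_closed subgroup.m_inv_closed)
      ultimately have "inv a' \<otimes> a = \<one>" "b' \<otimes> inv b = \<one>" using AB by auto
      thus ?thesis
        using * by (metis Ac Bc inv_closed inv_equality inv_inv)
    qed
    moreover have "(\<lambda>(a, b). a \<otimes> b) ` (A \<times> B) = carrier G"
      using gen by (fastforce simp: Ac Bc)
    ultimately show "bij_betw (\<lambda>(a, b). a \<otimes> b) (carrier (G\<lparr>carrier := A\<rparr> \<times>\<times> G\<lparr>carrier := B\<rparr>)) (carrier G)"
      by (auto simp: bij_betw_def inj_on_def)
  qed
  thus ?thesis by (rule is_isoI)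
qed

lemma (in group) generate_iso_integer_mod_group:
  assumes a: "a \<in> carrier G" and "ord a \<noteq> 0"
  shows "integer_mod_group (ord a) \<cong> G\<lparr>carrier := generate G {a}\<rparr>"
proof -
  have eq: "a [^] (i mod int (ord a)) = a [^] i" for i :: int
    using a by (simp add: int_pow_eq)
  have car: "carrier (integer_mod_group (ord a)) = {0..<int (ord a)}"
    using assms by (simp add: carrier_integer_mod_group)
  have "(\<lambda>i::int. a [^] i) \<in> iso (integer_mod_group (ord a)) (G\<lparr>carrier := generate G {a}\<rparr>)"
  proof (rule isoI)
    show "(\<lambda>i::int. a [^] i) \<in> hom (integer_mod_group (ord a)) (G\<lparr>carrier := generate G {a}\<rparr>)"
      using a by (auto simp: hom_def eq int_pow_mult generate_pow)
    have "inj_on (\<lambda>i::int. a [^] i) {0..<int (ord a)}"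
      using a by (auto simp: inj_on_def int_pow_eq mod_eq_dvd_iff[symmetric])
    moreover have "a [^] i \<in> (\<lambda>i. a [^] i) ` {0..<int (ord a)}" for i :: int
      using assms by (intro image_eqI[of _ _ "i mod int (ord a)"]) (auto simp: eq)
    ultimately show "bij_betw (\<lambda>i::int. a [^] i) (carrier (integer_mod_group (ord a)))
        (carrier (G\<lparr>carrier := generate G {a}\<rparr>))"
      unfolding bij_betw_def car using a by (auto simp: generate_pow)
  qed
  thus ?thesis by (rule is_isoI)
qed

text \<open>The decompositions below produce their factors in no particular order. A list of orders
  keeps them in one object, to be sorted into powers once the multiplicities are known.\<close>

definition cyclic_product :: "nat list \<Rightarrow> (nat \<Rightarrow> int) monoid" where
  "cyclic_product ms = product_group {..<length ms} (\<lambda>i. integer_mod_group (ms ! i))"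

lemma group_cyclic_product [simp]: "group (cyclic_product ms)"
  by (simp add: cyclic_product_def)

lemma cyclic_power_eq_cyclic_product: "cyclic_power m k = cyclic_product (replicate k m)"
  unfolding cyclic_power_def cyclic_product_def product_group_def
  by (auto intro!: PiE_cong ext simp: restrict_def)

lemma cyclic_product_singleton: "cyclic_product [m] \<cong> integer_mod_group m"
proof -
  have "(\<lambda>f. f 0) \<in> iso (cyclic_product [m]) (integer_mod_group m)"
  proof (rule isoI)
    show "(\<lambda>f. f 0) \<in> hom (cyclic_product [m]) (integer_mod_group m)"
      by (auto simp: hom_def cyclic_product_def PiE_def Pi_def)
    show "bij_betw (\<lambda>f. f 0) (carrier (cyclic_product [m])) (carrier (integer_mod_group m))"
      by (rule bij_betwI[where g = "\<lambda>x. \<lambda>i\<in>{0}. x"])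
        (auto simp: cyclic_product_def lessThan_Suc PiE_def Pi_def extensional_def fun_eq_iff)
  qed
  thus ?thesis by (rule is_isoI)
qed

lemma cyclic_product_append:
  "cyclic_product xs \<times>\<times> cyclic_product ys \<cong> cyclic_product (xs @ ys)"
proof -
  define h :: "(nat \<Rightarrow> int) \<times> (nat \<Rightarrow> int) \<Rightarrow> nat \<Rightarrow> int" where
    "h = (\<lambda>(f, g). \<lambda>i\<in>{..<length (xs @ ys)}. if i < length xs then f i else g (i - length xs))"
  define h' :: "(nat \<Rightarrow> int) \<Rightarrow> (nat \<Rightarrow> int) \<times> (nat \<Rightarrow> int)" where
    "h' = (\<lambda>f. (\<lambda>i\<in>{..<length xs}. f i, \<lambda>i\<in>{..<length ys}. f (length xs + i)))"
  have "h \<in> iso (cyclic_product xs \<times>\<times> cyclic_product ys) (cyclic_product (xs @ ys))"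
  proof (rule isoI)
    show "h \<in> hom (cyclic_product xs \<times>\<times> cyclic_product ys) (cyclic_product (xs @ ys))"
    proof (rule homI)
      show "h x \<in> carrier (cyclic_product (xs @ ys))"
        if "x \<in> carrier (cyclic_product xs \<times>\<times> cyclic_product ys)" for x
        using that by (auto simp: h_def cyclic_product_def nth_append PiE_def Pi_def)
      show "h (x \<otimes>\<^bsub>cyclic_product xs \<times>\<times> cyclic_product ys\<^esub> y) = h x \<otimes>\<^bsub>cyclic_product (xs @ ys)\<^esub> h y"
        for x y
        by (cases x; cases y) (auto simp: h_def cyclic_product_def nth_append fun_eq_iff)
    qed
    show "bij_betw h (carrier (cyclic_product xs \<times>\<times> cyclic_product ys)) (carrier (cyclic_product (xs @ ys)))"
    proof (rule bij_betwI[where g = h'])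
      show "h \<in> carrier (cyclic_product xs \<times>\<times> cyclic_product ys) \<rightarrow> carrier (cyclic_product (xs @ ys))"
        by (auto simp: h_def cyclic_product_def nth_append PiE_def Pi_def)
      show "h' \<in> carrier (cyclic_product (xs @ ys)) \<rightarrow> carrier (cyclic_product xs \<times>\<times> cyclic_product ys)"
      proof
        fix f assume f: "f \<in> carrier (cyclic_product (xs @ ys))"
        have "f i \<in> carrier (integer_mod_group ((xs @ ys) ! i))" if "i < length xs + length ys" for i
          using f that by (auto simp: cyclic_product_def)
        from this this[of "length xs + _"]
        show "h' f \<in> carrier (cyclic_product xs \<times>\<times> cyclic_product ys)"
          by (auto simp: h'_def cyclic_product_def nth_append) (metis trans_less_add1)
      qed
      show "h' (h x) = x" if "x \<in> carrier (cyclic_product xs \<times>\<times> cyclic_product ys)" for x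
        using that by (cases x) (auto simp: h_def h'_def cyclic_product_def PiE_def extensional_def fun_eq_iff)
      show "h (h' x) = x" if "x \<in> carrier (cyclic_product (xs @ ys))" for x
        using that by (auto simp: h_def h'_def cyclic_product_def PiE_def extensional_def fun_eq_iff)
    qed
  qed
  thus ?thesis by (rule is_isoI)
qed

lemma cyclic_product_Cons: "integer_mod_group m \<times>\<times> cyclic_product ms \<cong> cyclic_product (m # ms)"
proof -
  have "integer_mod_group m \<times>\<times> cyclic_product ms \<cong> cyclic_product [m] \<times>\<times> cyclic_product ms"
    by (intro group.DirProd_iso_trans[OF group_integer_mod_group] iso_refl
        group.iso_sym[OF group_cyclic_product cyclic_product_singleton])
  also have "\<dots> \<cong> cyclic_product ([m] @ ms)" by (rule cyclic_product_append)
  finally show ?thesis by simp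
qed

text \<open>Permuting the indices permutes the factors. Hence a list known only through the
  multiplicity of each entry already determines the product up to isomorphism.\<close>

lemma cyclic_product_mset_cong:
  assumes "mset xs = mset ys"
  shows "cyclic_product xs \<cong> cyclic_product ys"
proof -
  obtain f where bij: "bij_betw f {..<length xs} {..<length ys}"
    and f: "\<And>i. i < length xs \<Longrightarrow> xs ! i = ys ! f i"
    using permutation_Ex_bij[OF assms] by blast
  define h :: "(nat \<Rightarrow> int) \<Rightarrow> nat \<Rightarrow> int" where "h = (\<lambda>g. \<lambda>i\<in>{..<length xs}. g (f i))"
  define k where "k = inv_into {..<length xs} f"
  have fk: "f (k i) = i" "k i < length xs" if "i < length ys" for i
    using bij that unfolding k_def bij_betw_def
    by (auto simp: f_inv_into_f) (metis inv_into_into lessThan_iff)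
  have kf: "k (f i) = i" "f i < length ys" if "i < length xs" for i
    using bij that unfolding k_def bij_betw_def by auto
  have "h \<in> iso (cyclic_product ys) (cyclic_product xs)"
  proof (rule isoI)
    have h: "h g \<in> carrier (cyclic_product xs)" if "g \<in> carrier (cyclic_product ys)" for g
      using that kf(2) f by (fastforce simp: h_def cyclic_product_def)
    show "h \<in> hom (cyclic_product ys) (cyclic_product xs)"
      by (rule homI) (use h kf(2) f in \<open>auto simp: h_def cyclic_product_def fun_eq_iff\<close>)
    show "bij_betw h (carrier (cyclic_product ys)) (carrier (cyclic_product xs))"
    proof (rule bij_betwI[where g = "\<lambda>g. \<lambda>i\<in>{..<length ys}. g (k i)"])
      show "h \<in> carrier (cyclic_product ys) \<rightarrow> carrier (cyclic_product xs)"
        using h by blast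
      have ys: "ys ! i = xs ! k i" if "i < length ys" for i
        using f[of "k i"] fk[of i] that by simp
      show "(\<lambda>g. \<lambda>i\<in>{..<length ys}. g (k i)) \<in> carrier (cyclic_product xs) \<rightarrow> carrier (cyclic_product ys)"
        using fk ys by (fastforce simp: cyclic_product_def)
      show "(\<lambda>i\<in>{..<length ys}. h g (k i)) = g" if "g \<in> carrier (cyclic_product ys)" for g
        using that fk by (auto simp: h_def cyclic_product_def PiE_def extensional_def fun_eq_iff)
      show "h (\<lambda>i\<in>{..<length ys}. g (k i)) = g" if "g \<in> carrier (cyclic_product xs)" for g
        using that kf by (auto simp: h_def cyclic_product_def PiE_def extensional_def fun_eq_iff)
    qed
  qed
  hence "cyclic_product ys \<cong> cyclic_product xs" by (rule is_isoI)
  thus ?thesis by (rule group.iso_sym[OF group_cyclic_product])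
qed

section \<open>Numbers of solutions of x^d = 1 as isomorphism invariants\<close>

definition torsion :: "('a, 'm) monoid_scheme \<Rightarrow> nat \<Rightarrow> 'a set" where
  "torsion G d = {x \<in> carrier G. x [^]\<^bsub>G\<^esub> d = \<one>\<^bsub>G\<^esub>}"

lemma card_torsion_iso:
  assumes "group G" "group H" "G \<cong> H"
  shows "card (torsion G d) = card (torsion H d)"
proof -
  interpret G: group G by fact
  interpret H: group H by fact
  obtain f where f: "f \<in> iso G H" using assms(3) by (auto simp: is_iso_def)
  interpret f: group_hom G H f
    using f by unfold_locales (auto simp: iso_def)
  have bij: "bij_betw f (carrier G) (carrier H)" using f by (simp add: iso_def)
  have iff: "f x [^]\<^bsub>H\<^esub> d = \<one>\<^bsub>H\<^esub> \<longleftrightarrow> x [^]\<^bsub>G\<^esub> d = \<one>\<^bsub>G\<^esub>" if "x \<in> carrier G" for x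
    using bij that by (metis G.nat_pow_closed G.one_closed bij_betw_imp_inj_on f.hom_nat_pow f.hom_one inj_on_eq_iff)
  have "bij_betw f (torsion G d) (torsion H d)"
  proof (rule bij_betw_subset[OF bij])
    show "f ` torsion G d = torsion H d"
    proof (intro equalityI subsetI)
      fix y assume y: "y \<in> torsion H d"
      then obtain x where "x \<in> carrier G" "y = f x"
        using bij by (auto simp: torsion_def bij_betw_def)
      thus "y \<in> f ` torsion G d" using y iff by (auto simp: torsion_def)
    qed (use iff in \<open>auto simp: torsion_def\<close>)
  qed (auto simp: torsion_def)
  thus ?thesis by (rule bij_betw_same_card)
qed

text \<open>Write \<open>m = g * a\<close> and \<open>d = g * b\<close> with \<open>a\<close>,
  \<open>b\<close> coprime. Then \<open>m\<close> divides \<open>d * x\<close> exactly when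
  \<open>a\<close> divides \<open>x\<close>, and there are \<open>g\<close> multiples of
  \<open>a\<close> below \<open>m\<close>.\<close>

lemma card_torsion_integer_mod_group:
  assumes "m > 0"
  shows "card (torsion (integer_mod_group m) d) = gcd d m"
proof -
  define g where "g = gcd d m"
  have g: "g > 0" using assms by (simp add: g_def)
  obtain a b where a: "m = g * a" and b: "d = g * b" and "coprime a b"
    using gcd_coprime_exists[of m d] g unfolding g_def by (auto simp: gcd.commute mult.commute)
  have "torsion (integer_mod_group m) d = (\<lambda>j. int a * int j) ` {..<g}"
  proof -
    have "x \<in> torsion (integer_mod_group m) d \<longleftrightarrow> 0 \<le> x \<and> x < int m \<and> int a dvd x" for x
    proof -
      have "int m dvd int d * x \<longleftrightarrow> int a dvd x"
        using g \<open>coprime a b\<close>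
        by (simp add: a b mult.assoc coprime_dvd_mult_right_iff)
      thus ?thesis using assms
        by (auto simp: torsion_def carrier_integer_mod_group dvd_eq_mod_eq_0)
    qed
    moreover have "x \<in> (\<lambda>j. int a * int j) ` {..<g} \<longleftrightarrow> 0 \<le> x \<and> x < int m \<and> int a dvd x" for x
    proof -
      have "x \<in> (\<lambda>j. int a * int j) ` {..<g}" if x: "0 \<le> x" "x < int m" "int a dvd x"
      proof -
        from x(3) obtain j where j: "x = int a * j" by blast
        have "a > 0" using assms a by (cases a) auto
        hence "j \<ge> 0" "j < int g"
          using x j a by (auto simp: zero_le_mult_iff mult.commute)
        thus ?thesis using j by (auto intro!: image_eqI[of _ _ "nat j"])
      qed
      moreover have "a > 0" using assms a by (cases a) auto
      ultimately show ?thesis by (auto simp: a mult.commute)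
    qed
    ultimately show ?thesis by blast
  qed
  moreover have "inj_on (\<lambda>j. int a * int j) {..<g}"
    using assms a by (auto simp: inj_on_def)
  ultimately show ?thesis by (simp add: card_image g_def)
qed

lemma pow_product_group:
  assumes "\<And>i. i \<in> I \<Longrightarrow> group (G i)" "x \<in> carrier (product_group I G)"
  shows "x [^]\<^bsub>product_group I G\<^esub> (d::nat) = (\<lambda>i\<in>I. x i [^]\<^bsub>G i\<^esub> d)"
proof (induction d)
  case (Suc d)
  then show ?case using assms by (auto simp: fun_eq_iff)
qed auto

lemma torsion_product_group:
  assumes "\<And>i. i \<in> I \<Longrightarrow> group (G i)"
  shows "torsion (product_group I G) d = (\<Pi>\<^sub>E i\<in>I. torsion (G i) d)"
proof (rule Set.set_eqI)
  fix x
  have restrict: "(\<lambda>i\<in>I. x i [^]\<^bsub>G i\<^esub> d) = (\<lambda>i\<in>I. \<one>\<^bsub>G i\<^esub>) \<longleftrightarrow> (\<forall>i\<in>I. x i [^]\<^bsub>G i\<^esub> d = \<one>\<^bsub>G i\<^esub>)"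
    by (auto simp: restrict_def fun_eq_iff)
  have "x \<in> torsion (product_group I G) d \<longleftrightarrow>
      x \<in> carrier (product_group I G) \<and> x [^]\<^bsub>product_group I G\<^esub> d = \<one>\<^bsub>product_group I G\<^esub>"
    by (simp add: torsion_def)
  also have "\<dots> \<longleftrightarrow> x \<in> carrier (product_group I G) \<and> (\<forall>i\<in>I. x i [^]\<^bsub>G i\<^esub> d = \<one>\<^bsub>G i\<^esub>)"
    by (rule conj_cong[OF refl]) (simp only: pow_product_group[OF assms] one_product_group restrict)
  also have "\<dots> \<longleftrightarrow> x \<in> (\<Pi>\<^sub>E i\<in>I. torsion (G i) d)"
    unfolding carrier_product_group PiE_iff torsion_def by blast
  finally show "x \<in> torsion (product_group I G) d \<longleftrightarrow> x \<in> (\<Pi>\<^sub>E i\<in>I. torsion (G i) d)" .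
qed

lemma card_torsion_cyclic_product:
  assumes "\<And>m. m \<in> set ms \<Longrightarrow> m > 0"
  shows "card (torsion (cyclic_product ms) d) = (\<Prod>m\<leftarrow>ms. gcd d m)"
proof -
  have "card (torsion (cyclic_product ms) d) = (\<Prod>i<length ms. gcd d (ms ! i))"
    unfolding cyclic_product_def using assms
    by (simp add: torsion_product_group card_PiE card_torsion_integer_mod_group)
  also have "\<dots> = (\<Prod>m\<leftarrow>ms. gcd d m)"
    by (simp add: prod.list_conv_set_nth atLeast0LessThan)
  finally show ?thesis .
qed

section \<open>Finite abelian \<open>p\<close>-groups\<close>

text \<open>The element \<open>a\<close> has the largest order that the exponent bound permits. This
  forces the \<open>A\<close>-part of a suitable p-th power to be itself a p-th power in
  \<open>A\<close>. For an element of smaller order that can fail, and a complement need not exist,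
  as with the element of order 2 in a cyclic group of order 4.\<close>

lemma (in comm_group) cyclic_complement:
  assumes fin: "finite (carrier G)" and p: "Factorial_Ring.prime p"
    and exp: "\<And>x. x \<in> carrier G \<Longrightarrow> x [^] (p ^ k) = \<one>"
    and a: "a \<in> carrier G" and ord: "ord a = p ^ k"
  shows "\<exists>H. subgroup H G \<and> generate G {a} \<inter> H = {\<one>} \<and>
    (\<forall>x\<in>carrier G. \<exists>u\<in>generate G {a}. \<exists>h\<in>H. x = u \<otimes> h)"
proof -
  define A where "A = generate G {a}"
  have A: "subgroup A G" unfolding A_def using a by (intro generate_is_subgroup) auto
  note Ac = subgroup.mem_carrier[OF A]
  define HS where "HS = {H. subgroup H G \<and> A \<inter> H = {\<one>}}"
  have "finite HS"
    by (rule finite_subset[of _ "Pow (carrier G)"]) (auto simp: HS_def fin dest: subgroup.subset)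
  moreover have "{\<one>} \<in> HS"
    using A triv_subgroup subgroup.one_closed[OF A] by (auto simp: HS_def)
  ultimately obtain H where H: "H \<in> HS" and max: "\<And>K. K \<in> HS \<Longrightarrow> H \<subseteq> K \<Longrightarrow> K = H"
    using finite_has_maximal[of HS] by (metis empty_iff)
  have sH: "subgroup H G" and AH: "A \<inter> H = {\<one>}" using H by (auto simp: HS_def)
  note Hc = subgroup.mem_carrier[OF sH]
  define M where "M = A <#> H"
  have M: "subgroup M G" unfolding M_def by (rule mult_subgroups[OF A sH])
  have M_iff: "x \<in> M \<longleftrightarrow> (\<exists>u\<in>A. \<exists>h\<in>H. x = u \<otimes> h)" for x
    by (auto simp: M_def set_mult_def)
  have AM: "u \<in> M" if "u \<in> A" for u
    using that subgroup.one_closed[OF sH] Ac[OF that] by (metis M_iff r_one)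
  have HM: "u \<in> M" if "u \<in> H" for u
    using that subgroup.one_closed[OF A] Hc[OF that] by (metis M_iff l_one)
  \<comment> \<open>otherwise some \<open>z\<close> outside \<open>AH\<close> has \<open>z\<^sup>p \<in> H\<close>, and adjoining \<open>z\<close> to \<open>H\<close> contradicts maximality\<close>
  have "M = carrier G"
  proof (rule ccontr)
    assume "M \<noteq> carrier G"
    then obtain x where x: "x \<in> carrier G" "x \<notin> M" using subgroup.subset[OF M] by auto
    have "\<exists>j. x [^] (p ^ j) \<in> M"
      using exp[OF x(1)] subgroup.one_closed[OF M] by metis
    \<comment> \<open>\<open>j\<close> is the first exponent that brings \<open>x\<close> into
      \<open>M\<close>, so the preceding power \<open>y\<close> lies outside \<open>M\<close> while
      \<open>y [^] p\<close> lies inside.\<close>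
    define j where "j = (LEAST j. x [^] (p ^ j) \<in> M)"
    have j: "x [^] (p ^ j) \<in> M" unfolding j_def by (rule LeastI_ex) fact
    have "j \<noteq> 0" using j x by (intro notI) simp
    then obtain j' where j': "j = Suc j'" by (cases j) auto
    define y where "y = x [^] (p ^ j')"
    have yc: "y \<in> carrier G" using x by (simp add: y_def)
    have yM: "y \<notin> M" unfolding y_def using not_less_Least[of j' "\<lambda>j. x [^] (p ^ j) \<in> M"] j' j_def by auto
    have "y [^] p \<in> M" using j j' x by (simp add: y_def nat_pow_pow mult.commute)
    then obtain u h where u: "u \<in> A" and h: "h \<in> H" and yp: "y [^] p = u \<otimes> h" by (auto simp: M_iff)
    obtain m :: int where m: "u = a [^] m" using u a by (auto simp: A_def generate_pow)
    have "k \<noteq> 0"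
    proof
      assume "k = 0"
      hence "y = \<one>" using exp[OF yc] yc by simp
      thus False using yM subgroup.one_closed[OF M] by simp
    qed
    then obtain k' where k': "k = Suc k'" by (cases k) auto
    \<comment> \<open>Raising \<open>y [^] p = u \<otimes> h\<close> to the power
      \<open>p ^ k'\<close> gives the identity. The resulting powers of \<open>u\<close> and
      \<open>h\<close> are therefore inverse to each other and lie in both \<open>A\<close> and
      \<open>H\<close>.\<close>
    have "u [^] (p ^ k') \<otimes> h [^] (p ^ k') = (u \<otimes> h) [^] (p ^ k')"
      using Ac[OF u] Hc[OF h] by (simp add: nat_pow_distrib)
    also have "\<dots> = y [^] (p ^ k)"
      using yc by (simp add: yp[symmetric] nat_pow_pow k')
    finally have "u [^] (p ^ k') \<otimes> h [^] (p ^ k') = \<one>" using exp[OF yc] by simp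
    hence "u [^] (p ^ k') = inv (h [^] (p ^ k'))"
      using Ac[OF u] Hc[OF h] by (simp add: inv_equality)
    moreover have "u [^] (p ^ k') \<in> A"
      using subgroup_int_pow_closed[OF A u, of "int (p ^ k')"] by (simp only: int_pow_int)
    moreover have "inv (h [^] (p ^ k')) \<in> H"
      using subgroup_int_pow_closed[OF sH h, of "int (p ^ k')"] subgroup.m_inv_closed[OF sH] by (simp only: int_pow_int)
    ultimately have "u [^] (p ^ k') = \<one>" using AH by auto
    hence "a [^] (m * int (p ^ k')) = \<one>"
      using a by (simp add: m int_pow_pow[symmetric] int_pow_int del: of_nat_power)
    \<comment> \<open>The order of \<open>a\<close> is the full \<open>p ^ k\<close>, so one factor
      \<open>p\<close> must come from \<open>m\<close>. Thus \<open>u\<close> is the p-th power of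
      \<open>a [^] m'\<close>.\<close>
    hence "int (p ^ k) dvd m * int (p ^ k')"
      using a by (simp add: int_pow_eq_id ord)
    hence "int p dvd m" using p by (simp add: k' prime_gt_0_nat)
    then obtain m' where m': "m = int p * m'" by blast
    \<comment> \<open>Dividing \<open>y\<close> by this root of \<open>u\<close> removes the
      \<open>A\<close>-part from the p-th power, leaving \<open>z [^] p = h\<close>, and keeps
      \<open>z\<close> outside \<open>M\<close>.\<close>
    define z where "z = y \<otimes> inv (a [^] m')"
    have am': "a [^] m' \<in> A" using a by (auto simp: A_def generate_pow)
    have zc: "z \<in> carrier G" using yc a by (simp add: z_def)
    have "z [^] p = y [^] p \<otimes> inv (a [^] m') [^] p"
      unfolding z_def using yc a by (simp add: nat_pow_distrib)
    also have "inv (a [^] m') [^] p = inv u"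
    proof -
      have "(a [^] m') [^] int p = u"
        using a by (simp add: m m' int_pow_pow mult.commute)
      hence "(a [^] m') [^] p = u" by (simp only: int_pow_int)
      thus ?thesis using a by (simp add: nat_pow_inv)
    qed
    also have "y [^] p \<otimes> inv u = h"
      using Ac[OF u] Hc[OF h] by (simp add: yp m_comm[of u h] m_assoc)
    finally have zp: "z [^] p = h" .
    have zM: "z \<notin> M"
    proof
      assume "z \<in> M"
      hence "z \<otimes> a [^] m' \<in> M" using AM[OF am'] M by (simp add: subgroup.m_closed)
      moreover have "z \<otimes> a [^] m' = y" using yc a by (simp add: z_def m_assoc)
      ultimately show False using yM by simp
    qed
    define K where "K = H <#> generate G {z}"
    have sZ: "subgroup (generate G {z}) G" using zc by (intro generate_is_subgroup) auto
    have sK: "subgroup K G" unfolding K_def by (rule mult_subgroups[OF sH sZ])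
    have K_iff: "w \<in> K \<longleftrightarrow> (\<exists>h\<in>H. \<exists>i::int. w = h \<otimes> z [^] i)" for w
      using zc by (auto simp: K_def set_mult_def generate_pow)
    have "H \<subseteq> K"
    proof
      fix w assume w: "w \<in> H"
      thus "w \<in> K" using Hc[OF w] unfolding K_iff by (intro bexI[of _ w] exI[of _ 0]) auto
    qed
    have "z \<in> K" using zc subgroup.one_closed[OF sH] unfolding K_iff
      by (intro bexI[of _ \<one>] exI[of _ 1]) auto
    hence "K \<noteq> H" using zM HM by auto
    moreover have "A \<inter> K = {\<one>}"
    proof -
      have "w = \<one>" if wA: "w \<in> A" and wK: "w \<in> K" for w
      proof -
        obtain h' i where h': "h' \<in> H" and w: "w = h' \<otimes> z [^] (i::int)" using wK by (auto simp: K_iff)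
        have zi: "z [^] i = inv h' \<otimes> w"
          using w Hc[OF h'] zc by (simp add: m_assoc[symmetric])
        show "w = \<one>"
        \<comment> \<open>If \<open>p\<close> divides \<open>i\<close>, then \<open>z [^] i\<close>
          is a power of \<open>h\<close> and \<open>w\<close> lies in \<open>H\<close>. Otherwise
          Bezout recovers \<open>z\<close> from \<open>z [^] p\<close> and \<open>z [^] i\<close>,
          both in \<open>M\<close>, which is impossible.\<close>
        proof (cases "int p dvd i")
          case True
          then obtain i' where "i = int p * i'" by blast
          hence "z [^] i = h [^] i'"
            using zc zp by (simp add: int_pow_pow[symmetric] int_pow_int)
          hence "w \<in> H" using w h' subgroup_int_pow_closed[OF sH h] sH by (simp add: subgroup.m_closed)
          thus ?thesis using wA AH by auto
        next
          case False
          hence "coprime (int p) i" using p by (simp add: prime_imp_coprime)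
          then obtain s t where st: "s * int p + t * i = 1"
            by (metis bezout_int coprime_iff_gcd_eq_1)
          have "z [^] i \<in> M" unfolding zi
            using AM[OF wA] HM[OF h'] M by (simp add: subgroup.m_closed subgroup.m_inv_closed)
          hence "(z [^] i) [^] t \<in> M" by (rule subgroup_int_pow_closed[OF M])
          moreover have "(z [^] int p) [^] s \<in> M"
            using HM[OF h] subgroup_int_pow_closed[OF M] by (simp add: int_pow_int zp)
          ultimately have "(z [^] int p) [^] s \<otimes> (z [^] i) [^] t \<in> M" by (intro subgroup.m_closed[OF M])
          also have "(z [^] int p) [^] s \<otimes> (z [^] i) [^] t = z [^] (s * int p + t * i)"
            using zc by (simp add: int_pow_pow int_pow_mult mult.commute)
          finally have "z \<in> M" using st zc by simp
          thus ?thesis using zM by simp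
        qed
      qed
      thus ?thesis using subgroup.one_closed[OF A] subgroup.one_closed[OF sK] by blast
    qed
    ultimately show False using max[of K] sK \<open>H \<subseteq> K\<close> by (auto simp: HS_def)
  qed
  hence "\<forall>x\<in>carrier G. \<exists>u\<in>A. \<exists>h\<in>H. x = u \<otimes> h" using M_iff by blast
  thus ?thesis using sH AH unfolding A_def by blast
qed

lemma (in group) ord_prime_power:
  assumes "finite (carrier G)" "Factorial_Ring.prime p" "a \<in> carrier G"
    "a [^] (p ^ Suc k) = \<one>" "a [^] (p ^ k) \<noteq> \<one>"
  shows "ord a = p ^ Suc k"
proof -
  have "ord a dvd p ^ Suc k" using assms by (simp add: pow_eq_id)
  then obtain i where i: "i \<le> Suc k" "ord a = p ^ i"
    using divides_primepow_nat[OF assms(2)] by blast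
  have "\<not> i \<le> k" using assms i by (auto simp: pow_eq_id le_imp_power_dvd)
  thus ?thesis using i by (simp add: le_Suc_eq)
qed

text \<open>An element of maximal order generates a direct factor, and the induction continues in a
  complement. Exponents start at 1, so the later counts of list entries concern nontrivial factors
  only.\<close>

theorem comm_p_group_iso_cyclic_product:
  fixes G :: "('a, 'm) monoid_scheme"
  assumes "comm_group G" "finite (carrier G)" "Factorial_Ring.prime p"
    and "\<And>x. x \<in> carrier G \<Longrightarrow> x [^]\<^bsub>G\<^esub> (p ^ k) = \<one>\<^bsub>G\<^esub>"
  shows "\<exists>es. set es \<subseteq> {1..k} \<and> cyclic_product (map (\<lambda>e. p ^ e) es) \<cong> G"
  using assms(1,2,4)
proof (induction "card (carrier G)" arbitrary: G k rule: less_induct)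
  case less
  note exp = less.prems(3)
  interpret comm_group G by fact
  show ?case
  proof (cases "carrier G = {\<one>\<^bsub>G\<^esub>}")
    case True
    have "(\<lambda>_. \<one>\<^bsub>G\<^esub>) \<in> iso (cyclic_product []) G"
      using True by (auto simp: iso_def hom_def bij_betw_def cyclic_product_def)
    thus ?thesis by (intro exI[of _ "[]"]) (auto simp: is_isoI)
  next
    case False
    \<comment> \<open>The given bound \<open>k\<close> need not be attained by any element. The
      least valid exponent is attained, and \<open>cyclic_complement\<close> needs an element whose
      order equals the bound.\<close>
    define k' where "k' = (LEAST k. \<forall>x\<in>carrier G. x [^]\<^bsub>G\<^esub> (p ^ k) = \<one>\<^bsub>G\<^esub>)"
    have k': "x [^]\<^bsub>G\<^esub> (p ^ k') = \<one>\<^bsub>G\<^esub>" if "x \<in> carrier G" for x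
      using LeastI[of "\<lambda>k. \<forall>x\<in>carrier G. x [^]\<^bsub>G\<^esub> (p ^ k) = \<one>\<^bsub>G\<^esub>" k] exp that unfolding k'_def by blast
    have "k' \<le> k" unfolding k'_def by (rule Least_le) (use exp in blast)
    have "k' \<noteq> 0"
    proof
      assume "k' = 0"
      hence "x = \<one>\<^bsub>G\<^esub>" if "x \<in> carrier G" for x using k'[OF that] that by simp
      thus False using False by auto
    qed
    then obtain k'' where k'': "k' = Suc k''" by (cases k') auto
    obtain a where a: "a \<in> carrier G" "a [^]\<^bsub>G\<^esub> (p ^ k'') \<noteq> \<one>\<^bsub>G\<^esub>"
      using not_less_Least[of k'' "\<lambda>k. \<forall>x\<in>carrier G. x [^]\<^bsub>G\<^esub> (p ^ k) = \<one>\<^bsub>G\<^esub>"] k'' k'_def by auto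
    have ord: "ord a = p ^ k'"
      unfolding k'' using a k'[OF a(1)] k'' less.prems assms(3) by (intro ord_prime_power) auto
    define A where "A = generate G {a}"
    have A: "subgroup A G" unfolding A_def using a by (intro generate_is_subgroup) auto
    obtain H where H: "subgroup H G" and AH: "A \<inter> H = {\<one>\<^bsub>G\<^esub>}"
      and gen: "\<And>x. x \<in> carrier G \<Longrightarrow> \<exists>u\<in>A. \<exists>h\<in>H. x = u \<otimes>\<^bsub>G\<^esub> h"
      using cyclic_complement[OF less.prems(2) assms(3) k' a(1) ord] unfolding A_def by blast
    have "a \<notin> H"
    proof
      assume "a \<in> H"
      moreover have "a \<in> A" unfolding A_def by (simp add: generate.incl)
      ultimately have "a = \<one>\<^bsub>G\<^esub>" using AH by auto
      thus False using a by simp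
    qed
    hence "card H < card (carrier G)"
      using a less.prems(2) subgroup.subset[OF H] by (intro psubset_card_mono) auto
    moreover have "comm_group (G\<lparr>carrier := H\<rparr>)" using H m_comm subgroup.mem_carrier[OF H]
      by (intro group.group_comm_groupI subgroup_imp_group) auto
    moreover have "finite H" using H less.prems(2) by (meson finite_subset subgroup.subset)
    moreover have "x [^]\<^bsub>G\<lparr>carrier := H\<rparr>\<^esub> (p ^ k') = \<one>\<^bsub>G\<^esub>" if "x \<in> H" for x
      using k' subgroup.mem_carrier[OF H that] by (simp add: nat_pow_consistent[symmetric])
    ultimately obtain es where es: "set es \<subseteq> {1..k'}"
      and iso: "cyclic_product (map (\<lambda>e. p ^ e) es) \<cong> G\<lparr>carrier := H\<rparr>"
      using less.hyps[of "G\<lparr>carrier := H\<rparr>" k'] by auto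
    have "ord a \<noteq> 0" using ord assms(3) by (simp add: prime_gt_0_nat)
    have "integer_mod_group (p ^ k') \<times>\<times> cyclic_product (map (\<lambda>e. p ^ e) es)
        \<cong> G\<lparr>carrier := A\<rparr> \<times>\<times> G\<lparr>carrier := H\<rparr>"
      using generate_iso_integer_mod_group[OF a(1) \<open>ord a \<noteq> 0\<close>] iso unfolding ord A_def[symmetric]
      by (intro group.DirProd_iso_trans) auto
    moreover have "cyclic_product (map (\<lambda>e. p ^ e) (k' # es)) \<cong>
        integer_mod_group (p ^ k') \<times>\<times> cyclic_product (map (\<lambda>e. p ^ e) es)"
      by (simp, intro group.iso_sym[OF DirProd_group cyclic_product_Cons]) auto
    moreover have "G\<lparr>carrier := A\<rparr> \<times>\<times> G\<lparr>carrier := H\<rparr> \<cong> G"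
      using DirProd_subgroups_iso[OF A H AH gen] .
    ultimately have "cyclic_product (map (\<lambda>e. p ^ e) (k' # es)) \<cong> G"
      by (meson iso_trans)
    moreover have "set (k' # es) \<subseteq> {1..k}" using es \<open>k' \<le> k\<close> \<open>k' \<noteq> 0\<close> by auto
    ultimately show ?thesis by blast
  qed
qed

section \<open>The Frobenius map\<close>

context cring begin

text \<open>Natural coefficients act through \<open>add_pow\<close>. The induction is Pascal's rule
  applied termwise, isolated in \<open>T_Suc\<close>.\<close>

lemma binomial:
  assumes x: "x \<in> carrier R" and y: "y \<in> carrier R"
  shows "(x \<oplus> y) [^] n = (\<Oplus>k\<in>{..n}. add_pow R (n choose k) (x [^] k \<otimes> y [^] (n - k)))"
proof (induction n)
  case 0
  then show ?case using x y by simp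
next
  case (Suc n)
  define T where "T n k = add_pow R (n choose k) (x [^] k \<otimes> y [^] (n - k))" for n k :: nat
  have Tc [simp]: "T n k \<in> carrier R" for n k using x y by (simp add: T_def)
  have yT: "y \<otimes> T n k = add_pow R (n choose k) (x [^] k \<otimes> y [^] Suc (n - k))" for k
    unfolding T_def using x y by (simp add: add_pow_rdistr m_ac)
  have T_Suc: "T (Suc n) (Suc k) = x \<otimes> T n k \<oplus> y \<otimes> T n (Suc k)" if "k \<le> n" for k
  proof -
    have "x \<otimes> T n k = add_pow R (n choose k) (x [^] Suc k \<otimes> y [^] (n - k))"
      unfolding T_def using x y by (simp add: add_pow_rdistr m_ac)
    moreover have "y \<otimes> T n (Suc k) = add_pow R (n choose Suc k) (x [^] Suc k \<otimes> y [^] (n - k))"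
    \<comment> \<open>For \<open>k = n\<close> truncated subtraction gives \<open>y\<close>
      different exponents on the two sides, but the coefficient \<open>n choose Suc n\<close> is
      zero.\<close>
    proof (cases "k = n")
      case True
      thus ?thesis using x y unfolding yT by (simp add: binomial_eq_0)
    next
      case False
      hence "Suc (n - Suc k) = n - k" using that by simp
      thus ?thesis unfolding yT by simp
    qed
    ultimately show ?thesis
      unfolding T_def using x y by (simp add: add.nat_pow_mult)
  qed
  have IH: "(x \<oplus> y) [^] n = (\<Oplus>k\<in>{..n}. T n k)" using Suc.IH by (simp add: T_def)
  have "(\<Oplus>k\<in>{..Suc n}. T (Suc n) k) = (\<Oplus>k\<in>{..n}. T (Suc n) (Suc k)) \<oplus> T (Suc n) 0"
    by (intro add.finprod_Suc2) simp
  also have "(\<Oplus>k\<in>{..n}. T (Suc n) (Suc k)) = (\<Oplus>k\<in>{..n}. x \<otimes> T n k \<oplus> y \<otimes> T n (Suc k))"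
    using x y by (intro add.finprod_cong') (auto simp: T_Suc)
  also have "\<dots> = (\<Oplus>k\<in>{..n}. x \<otimes> T n k) \<oplus> (\<Oplus>k\<in>{..n}. y \<otimes> T n (Suc k))"
    using x y by (intro add.finprod_multf) auto
  also have "T (Suc n) 0 = y \<otimes> T n 0"
    unfolding yT using x y by (simp add: T_def)
  also have "(\<Oplus>k\<in>{..n}. x \<otimes> T n k) \<oplus> (\<Oplus>k\<in>{..n}. y \<otimes> T n (Suc k)) \<oplus> y \<otimes> T n 0
      = (\<Oplus>k\<in>{..n}. x \<otimes> T n k) \<oplus> (\<Oplus>k\<in>{..Suc n}. y \<otimes> T n k)"
    using x y by (subst add.finprod_Suc2) (auto simp: a_assoc)
  also have "(\<Oplus>k\<in>{..Suc n}. y \<otimes> T n k) = y \<otimes> T n (Suc n) \<oplus> (\<Oplus>k\<in>{..n}. y \<otimes> T n k)"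
    using x y by (intro add.finprod_Suc) auto
  also have "y \<otimes> T n (Suc n) = \<zero>" using x y by (simp add: T_def binomial_eq_0)
  also have "(\<Oplus>k\<in>{..n}. x \<otimes> T n k) = x \<otimes> (\<Oplus>k\<in>{..n}. T n k)"
    using x by (intro finsum_rdistr[symmetric]) auto
  also have "(\<Oplus>k\<in>{..n}. y \<otimes> T n k) = y \<otimes> (\<Oplus>k\<in>{..n}. T n k)"
    using y by (intro finsum_rdistr[symmetric]) auto
  finally have "(\<Oplus>k\<in>{..Suc n}. T (Suc n) k) = (x \<oplus> y) [^] n \<otimes> (x \<oplus> y)"
    using x y by (simp add: IH[symmetric] l_distr r_distr m_comm)
  thus ?case by (simp add: T_def)
qed

lemma add_pow_eq_zero_of_dvd:
  fixes p m :: nat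
  assumes "add_pow R p \<one> = \<zero>" "p dvd m" "x \<in> carrier R"
  shows "add_pow R m x = \<zero>"
proof -
  obtain j where j: "m = j * p" using assms(2) by (metis dvd_div_mult_self)
  have "add_pow R p x = (add_pow R p \<one>) \<otimes> x"
    using add_pow_ldistr[of \<one> x p] assms(3) by simp
  hence "add_pow R p x = \<zero>" using assms by simp
  moreover have "add_pow R m x = add_pow R j (add_pow R p x)"
    unfolding j using assms by (simp add: add.nat_pow_pow mult.commute)
  ultimately show ?thesis by simp
qed

lemma frobenius:
  fixes p :: nat
  assumes p: "Factorial_Ring.prime p" and char: "add_pow R p \<one> = \<zero>"
    and x: "x \<in> carrier R" and y: "y \<in> carrier R"
  shows "(x \<oplus> y) [^] p = x [^] p \<oplus> y [^] p"
proof -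
  \<comment> \<open>With \<open>p = m + 2\<close> the terms \<open>f (Suc k)\<close> for
    \<open>k \<le> m\<close> are exactly the middle ones, whose binomial coefficients are divisible
    by \<open>p\<close>.\<close>
  define m where "m = p - 2"
  have m: "p = Suc (Suc m)" using prime_ge_2_nat[OF p] by (simp add: m_def)
  define f where "f k = add_pow R (p choose k) (x [^] k \<otimes> y [^] (p - k))" for k
  have fc [simp]: "f k \<in> carrier R" for k using x y by (simp add: f_def)
  have "f (Suc k) = \<zero>" if "k \<le> m" for k
  proof -
    have "p dvd (p choose Suc k)" using that p m by (intro dvd_choose_prime) auto
    thus ?thesis unfolding f_def using x y by (intro add_pow_eq_zero_of_dvd[OF char]) simp_all
  qed
  hence "(\<Oplus>k\<in>{..m}. f (Suc k)) = (\<Oplus>k\<in>{..m}. \<zero>)"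
    by (intro add.finprod_cong') auto
  moreover have "(x \<oplus> y) [^] p = (\<Oplus>k\<in>{..p}. f k)" unfolding f_def by (rule binomial[OF x y])
  moreover have "(\<Oplus>k\<in>{..p}. f k) = f p \<oplus> ((\<Oplus>k\<in>{..m}. f (Suc k)) \<oplus> f 0)"
    unfolding m by (subst add.finprod_Suc, simp, subst add.finprod_Suc2, auto)
  ultimately have "(x \<oplus> y) [^] p = f p \<oplus> (\<zero> \<oplus> f 0)" by simp
  thus ?thesis using x y by (simp add: f_def)
qed

lemma frobenius_power:
  fixes p :: nat
  assumes p: "Factorial_Ring.prime p" and char: "add_pow R p \<one> = \<zero>"
    and x: "x \<in> carrier R" and y: "y \<in> carrier R"
  shows "(x \<oplus> y) [^] (p ^ k) = x [^] (p ^ k) \<oplus> y [^] (p ^ k)"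
proof (induction k)
  case (Suc k)
  have "(x \<oplus> y) [^] (p ^ Suc k) = ((x \<oplus> y) [^] (p ^ k)) [^] p"
    using x y by (simp add: nat_pow_pow mult.commute)
  also have "\<dots> = (x [^] (p ^ k)) [^] p \<oplus> (y [^] (p ^ k)) [^] p"
    unfolding Suc.IH using x y by (intro frobenius[OF p char]) auto
  finally show ?case using x y by (simp add: nat_pow_pow mult.commute)
qed (use x y in auto)

lemma frobenius_finsum:
  fixes p :: nat
  assumes p: "Factorial_Ring.prime p" and char: "add_pow R p \<one> = \<zero>"
    and "finite A" "f \<in> A \<rightarrow> carrier R"
  shows "(\<Oplus>a\<in>A. f a) [^] (p ^ k) = (\<Oplus>a\<in>A. f a [^] (p ^ k))"
  using assms(3,4)
proof (induction A rule: finite_induct)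
  case empty
  then show ?case using prime_gt_0_nat[OF p] by (simp add: nat_pow_zero)
next
  case (insert a A)
  then show ?case
    by (simp add: frobenius_power[OF p char] Pi_def)
qed

end

text \<open>Euclid's algorithm on the exponents: for a \<le> b, q^b - 1 = q^(b-a) (q^a - 1) +
  (q^(b-a) - 1), so subtracting exponents preserves the gcd.\<close>

lemma gcd_power_minus_one:
  fixes q :: nat
  assumes "q > 0"
  shows "gcd (q ^ a - 1) (q ^ b - 1) = q ^ gcd a b - 1"
proof (induction "a + b" arbitrary: a b rule: less_induct)
  case less
  have step: "gcd (q ^ a - 1) (q ^ b - 1) = q ^ gcd a b - 1"
    if ab: "0 < a" "a \<le> b" and IH: "gcd (q ^ a - 1) (q ^ (b - a) - 1) = q ^ gcd a (b - a) - 1" for a b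
  proof -
    have "q ^ b = q ^ (b - a) * q ^ a" using ab by (simp add: power_add[symmetric])
    moreover have "q ^ a \<ge> 1" "q ^ (b - a) \<ge> 1" using assms by auto
    ultimately have "q ^ b - 1 = q ^ (b - a) * (q ^ a - 1) + (q ^ (b - a) - 1)"
      by (simp add: diff_mult_distrib2)
    hence "gcd (q ^ a - 1) (q ^ b - 1) = gcd (q ^ a - 1) (q ^ (b - a) - 1)"
      by (metis gcd_add_mult mult.commute add.commute)
    moreover have "gcd a (b - a) = gcd a b" using ab by (metis gcd.commute gcd_diff1_nat)
    ultimately show ?thesis using IH by simp
  qed
  show ?case
  proof (cases "a = 0 \<or> b = 0")
    case True
    then show ?thesis by auto
  next
    case False
    show ?thesis
    proof (cases "a \<le> b")
      case True
      then show ?thesis using False by (intro step[OF _ _ less]) auto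
    next
      case False2: False
      have "gcd (q ^ b - 1) (q ^ a - 1) = q ^ gcd b a - 1"
        using False False2 by (intro step[OF _ _ less]) auto
      thus ?thesis by (simp add: gcd.commute)
    qed
  qed
qed

section \<open>Finite fields\<close>

text \<open>\<open>K\<close> is a vector space over the image of \<open>F\<close>. Instead of a
  basis, a maximal subspace whose size is a power of the size of \<open>F\<close> is taken; one more
  vector would multiply that size by the size of \<open>F\<close>, so the subspace must be all of
  \<open>K\<close>.\<close>

lemma card_finite_field_extension:
  assumes "field F" "finite (carrier F)" "field K" "finite (carrier K)" and h: "h \<in> ring_hom F K"
  shows "\<exists>d. card (carrier K) = card (carrier F) ^ d"
proof -
  interpret F: field F by fact
  interpret K: field K by fact
  interpret h: ring_hom_cring F K h using h by unfold_locales
  define VS where "VS = {V. V \<subseteq> carrier K \<and> \<zero>\<^bsub>K\<^esub> \<in> V \<and> (\<forall>v\<in>V. \<forall>w\<in>V. v \<oplus>\<^bsub>K\<^esub> w \<in> V) \<and>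
    (\<forall>a\<in>carrier F. \<forall>v\<in>V. h a \<otimes>\<^bsub>K\<^esub> v \<in> V) \<and> (\<exists>d. card V = card (carrier F) ^ d)}"
  have "finite VS"
    by (rule finite_subset[of _ "Pow (carrier K)"]) (auto simp: VS_def assms)
  moreover have "{\<zero>\<^bsub>K\<^esub>} \<in> VS"
    by (auto simp: VS_def intro: exI[of _ 0])
  ultimately obtain V where V: "V \<in> VS" and max: "\<And>W. W \<in> VS \<Longrightarrow> V \<subseteq> W \<Longrightarrow> W = V"
    using finite_has_maximal[of VS] by (metis empty_iff)
  have Vc: "V \<subseteq> carrier K" and V0: "\<zero>\<^bsub>K\<^esub> \<in> V"
    and Vadd: "\<And>v w. v \<in> V \<Longrightarrow> w \<in> V \<Longrightarrow> v \<oplus>\<^bsub>K\<^esub> w \<in> V"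
    and Vmul: "\<And>a v. a \<in> carrier F \<Longrightarrow> v \<in> V \<Longrightarrow> h a \<otimes>\<^bsub>K\<^esub> v \<in> V"
    using V by (auto simp: VS_def)
  obtain d where d: "card V = card (carrier F) ^ d" using V by (auto simp: VS_def)
  have Vdiff: "v \<ominus>\<^bsub>K\<^esub> w \<in> V" if "v \<in> V" "w \<in> V" for v w
  proof -
    \<comment> \<open>Negation is multiplication by the scalar -1, so the closure conditions in
      \<open>VS\<close> already give differences.\<close>
    have "h (\<ominus>\<^bsub>F\<^esub> \<one>\<^bsub>F\<^esub>) \<otimes>\<^bsub>K\<^esub> w = \<ominus>\<^bsub>K\<^esub> w" using that Vc by (simp add: K.l_minus subsetD)
    thus ?thesis using Vadd[OF that(1) Vmul[OF _ that(2), of "\<ominus>\<^bsub>F\<^esub> \<one>\<^bsub>F\<^esub>"]]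
      by (simp add: a_minus_def)
  qed
  have "V = carrier K"
  proof (rule ccontr)
    assume "V \<noteq> carrier K"
    then obtain v where v: "v \<in> carrier K" "v \<notin> V" using Vc by auto
    \<comment> \<open>\<open>g\<close> parametrises the span of \<open>V\<close> and
      \<open>v\<close>. Its injectivity makes the span larger by exactly the factor
      \<open>card (carrier F)\<close>.\<close>
    define g where "g = (\<lambda>(w, a). w \<oplus>\<^bsub>K\<^esub> h a \<otimes>\<^bsub>K\<^esub> v)"
    have inj: "inj_on g (V \<times> carrier F)"
    proof (rule inj_onI, clarify)
      fix w a w' a'
      assume w: "w \<in> V" "w' \<in> V" and a: "a \<in> carrier F" "a' \<in> carrier F" and eq: "g (w, a) = g (w', a')"
      have wc: "w \<in> carrier K" "w' \<in> carrier K" using w Vc by auto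
      have "h (a \<ominus>\<^bsub>F\<^esub> a') \<otimes>\<^bsub>K\<^esub> v = w' \<ominus>\<^bsub>K\<^esub> w"
      proof -
        have "h (a \<ominus>\<^bsub>F\<^esub> a') \<otimes>\<^bsub>K\<^esub> v = h a \<otimes>\<^bsub>K\<^esub> v \<ominus>\<^bsub>K\<^esub> h a' \<otimes>\<^bsub>K\<^esub> v"
          using a v by (simp add: a_minus_def K.l_distr K.l_minus)
        also have "\<dots> = (w \<oplus>\<^bsub>K\<^esub> h a \<otimes>\<^bsub>K\<^esub> v) \<ominus>\<^bsub>K\<^esub> (w \<oplus>\<^bsub>K\<^esub> h a' \<otimes>\<^bsub>K\<^esub> v)"
          using a v wc by (simp add: a_minus_def K.minus_add K.a_ac K.r_neg K.r_neg1 K.r_neg2)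
        also have "\<dots> = (w' \<oplus>\<^bsub>K\<^esub> h a' \<otimes>\<^bsub>K\<^esub> v) \<ominus>\<^bsub>K\<^esub> (w \<oplus>\<^bsub>K\<^esub> h a' \<otimes>\<^bsub>K\<^esub> v)"
          using eq by (simp add: g_def)
        also have "\<dots> = w' \<ominus>\<^bsub>K\<^esub> w"
          using a v wc by (simp add: a_minus_def K.minus_add K.a_ac K.r_neg K.r_neg1 K.r_neg2)
        finally show ?thesis .
      qed
      hence in_V: "h (a \<ominus>\<^bsub>F\<^esub> a') \<otimes>\<^bsub>K\<^esub> v \<in> V" using Vdiff w by simp
      \<comment> \<open>If the coefficients differed, scaling by the inverse of their difference
        would put \<open>v\<close> into \<open>V\<close>.\<close>
      have "a = a'"
      proof (rule ccontr)
        assume "a \<noteq> a'"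
        hence u: "a \<ominus>\<^bsub>F\<^esub> a' \<in> Units F" using a by (simp add: F.field_Units)
        define c where "c = inv\<^bsub>F\<^esub> (a \<ominus>\<^bsub>F\<^esub> a')"
        have c: "c \<in> carrier F" unfolding c_def by (rule F.Units_inv_closed[OF u])
        have "h c \<otimes>\<^bsub>K\<^esub> h (a \<ominus>\<^bsub>F\<^esub> a') = h (c \<otimes>\<^bsub>F\<^esub> (a \<ominus>\<^bsub>F\<^esub> a'))"
          by (rule h.hom_mult[symmetric]) (use a c in auto)
        also have "\<dots> = \<one>\<^bsub>K\<^esub>" unfolding c_def by (simp add: F.Units_l_inv[OF u])
        finally have "h c \<otimes>\<^bsub>K\<^esub> (h (a \<ominus>\<^bsub>F\<^esub> a') \<otimes>\<^bsub>K\<^esub> v) = v"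
          using a c v by (subst K.m_assoc[symmetric]) auto
        thus False using Vmul[OF c in_V] v by simp
      qed
      moreover have "w = w'" using eq \<open>a = a'\<close> a v wc by (simp add: g_def)
      ultimately show "w = w' \<and> a = a'" by simp
    qed
    define W where "W = g ` (V \<times> carrier F)"
    have W_iff: "x \<in> W \<longleftrightarrow> (\<exists>w\<in>V. \<exists>a\<in>carrier F. x = w \<oplus>\<^bsub>K\<^esub> h a \<otimes>\<^bsub>K\<^esub> v)" for x
      by (auto simp: W_def g_def)
    have "card W = card (carrier F) ^ Suc d"
      unfolding W_def by (simp add: card_image[OF inj] card_cartesian_product d)
    moreover have VW: "V \<subseteq> W"
    proof
      fix w assume w: "w \<in> V"
      show "w \<in> W" unfolding W_iff using w v Vc by (intro bexI[of _ w] bexI[of _ "\<zero>\<^bsub>F\<^esub>"]) auto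
    qed
    moreover have "v \<in> W"
      unfolding W_iff using V0 v by (intro bexI[of _ "\<zero>\<^bsub>K\<^esub>"] bexI[of _ "\<one>\<^bsub>F\<^esub>"]) auto
    moreover have "W \<in> VS"
      unfolding VS_def
    proof (intro CollectI conjI ballI)
      show "W \<subseteq> carrier K" using Vc v by (fastforce simp: W_iff)
      show "\<zero>\<^bsub>K\<^esub> \<in> W" using V0 VW by auto
      show "\<exists>d. card W = card (carrier F) ^ d" using \<open>card W = _\<close> by blast
      show "x \<oplus>\<^bsub>K\<^esub> y \<in> W" if xy: "x \<in> W" "y \<in> W" for x y
      proof -
        from xy obtain w a w' a' where wa: "w \<in> V" "w' \<in> V" "a \<in> carrier F" "a' \<in> carrier F"
          "x = w \<oplus>\<^bsub>K\<^esub> h a \<otimes>\<^bsub>K\<^esub> v" "y = w' \<oplus>\<^bsub>K\<^esub> h a' \<otimes>\<^bsub>K\<^esub> v" by (auto simp: W_iff)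
        have wc: "w \<in> carrier K" "w' \<in> carrier K" using wa Vc by auto
        have "x \<oplus>\<^bsub>K\<^esub> y = (w \<oplus>\<^bsub>K\<^esub> w') \<oplus>\<^bsub>K\<^esub> h (a \<oplus>\<^bsub>F\<^esub> a') \<otimes>\<^bsub>K\<^esub> v"
          using wa wc v by (simp add: K.l_distr K.a_ac)
        thus ?thesis unfolding W_iff using wa Vadd by blast
      qed
      show "h b \<otimes>\<^bsub>K\<^esub> x \<in> W" if bx: "b \<in> carrier F" "x \<in> W" for b x
      proof -
        from bx obtain w a where wa: "w \<in> V" "a \<in> carrier F"
          "x = w \<oplus>\<^bsub>K\<^esub> h a \<otimes>\<^bsub>K\<^esub> v" by (auto simp: W_iff)
        have wc: "w \<in> carrier K" using wa Vc by auto
        have "h b \<otimes>\<^bsub>K\<^esub> x = (h b \<otimes>\<^bsub>K\<^esub> w) \<oplus>\<^bsub>K\<^esub> h (b \<otimes>\<^bsub>F\<^esub> a) \<otimes>\<^bsub>K\<^esub> v"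
          using wa wc v bx by (simp add: K.r_distr K.m_assoc)
        thus ?thesis unfolding W_iff using wa Vmul[of b w] bx by blast
      qed
    qed
    ultimately show False using max[of W] v by auto
  qed
  thus ?thesis using d by blast
qed

lemma (in field) finite_units_cyclic:
  assumes "finite (carrier R)"
  shows "integer_mod_group (card (carrier R) - 1) \<cong> units_of R"
proof -
  interpret U: group "units_of R" by (rule units_group)
  have fin: "finite (carrier (units_of R))"
    using assms by (rule finite_subset[rotated]) (auto simp: units_of_carrier)
  obtain a where a: "a \<in> carrier (units_of R)"
    and genR: "carrier (units_of R) = {a [^] i | i::nat. i \<in> UNIV}"
    using finite_field_mult_group_has_gen[OF assms] unfolding mult_of_is_Units by blast
  have "a [^]\<^bsub>units_of R\<^esub> (i::nat) = a [^] i" for i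
    using a by (simp add: units_of_pow units_of_carrier)
  hence gen: "carrier (units_of R) = {a [^]\<^bsub>units_of R\<^esub> i | i::nat. i \<in> UNIV}"
    using genR by simp
  have "generate (units_of R) {a} = carrier (units_of R)"
  proof
    show "generate (units_of R) {a} \<subseteq> carrier (units_of R)"
      using a by (intro U.generate_incl) auto
    show "carrier (units_of R) \<subseteq> generate (units_of R) {a}"
      unfolding gen U.generate_pow[OF a] by (auto, metis int_pow_int)
  qed
  moreover have "U.ord a = card (carrier R) - 1"
    using U.generate_pow_card[OF a] calculation
    by (simp add: units_of_carrier field_Units card_Diff_singleton)
  moreover have "U.ord a \<noteq> 0" using fin a U.ord_ge_1 by (metis not_one_le_zero)
  ultimately show ?thesis
    using U.generate_iso_integer_mod_group[OF a] by simp
qed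

text \<open>A nonzero \<open>x\<close> is fixed exactly when its power with exponent
  \<open>n - 1\<close> is one, and these units are counted in the cyclic unit group. The summand 1
  accounts for the fixed point zero.\<close>

lemma (in field) card_fixed_pow:
  assumes fin: "finite (carrier R)" and n: "n > 0"
  shows "card {x \<in> carrier R. x [^] (n::nat) = x} = gcd (n - 1) (card (carrier R) - 1) + 1"
proof -
  interpret U: group "units_of R" by (rule units_group)
  have "\<zero> [^] n = \<zero>" using n by (simp add: nat_pow_zero)
  have iff: "x [^] n = x \<longleftrightarrow> x [^] (n - 1) = \<one>" if x: "x \<in> Units R" for x
  proof -
    have xc: "x \<in> carrier R" using x by auto
    have "x [^] n = x \<otimes> x [^] (n - 1)" using n xc by (cases n) (auto simp: m_comm)
    moreover have "x \<otimes> x [^] (n - 1) = x \<longleftrightarrow> x \<otimes> x [^] (n - 1) = x \<otimes> \<one>" using xc by simp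
    moreover have "x \<otimes> x [^] (n - 1) = x \<otimes> \<one> \<longleftrightarrow> x [^] (n - 1) = \<one>"
      using x xc by (intro Units_l_cancel) auto
    ultimately show ?thesis by simp
  qed
  have "{x \<in> carrier R. x [^] n = x} = insert \<zero> (torsion (units_of R) (n - 1))"
  proof (rule Set.set_eqI)
    fix x
    show "x \<in> {x \<in> carrier R. x [^] n = x} \<longleftrightarrow> x \<in> insert \<zero> (torsion (units_of R) (n - 1))"
    proof (cases "x \<in> Units R")
      case True
      hence "x \<noteq> \<zero>" by (simp add: field_Units)
      thus ?thesis using True iff[OF True] by (auto simp: torsion_def units_of_carrier units_of_pow units_of_one)
    next
      case False
      thus ?thesis using \<open>\<zero> [^] n = \<zero>\<close> by (auto simp: torsion_def units_of_carrier field_Units)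
    qed
  qed
  moreover have "\<zero> \<notin> torsion (units_of R) (n - 1)"
    by (simp add: torsion_def units_of_carrier field_Units)
  moreover have "finite (torsion (units_of R) (n - 1))"
    using fin by (rule finite_subset[rotated]) (auto simp: torsion_def units_of_carrier)
  moreover have "card (carrier R) - 1 > 0"
  proof -
    have "card {\<zero>, \<one>} \<le> card (carrier R)" using fin by (intro card_mono) auto
    thus ?thesis by simp
  qed
  ultimately show ?thesis
    using card_torsion_iso[OF group_integer_mod_group U.is_group finite_units_cyclic[OF fin], of "n - 1"]
    by (simp add: card_torsion_integer_mod_group)
qed

text \<open>The field has \<open>q ^ d\<close> elements, and \<open>gcd_power_minus_one\<close>
  turns the fixed-point count into \<open>q ^ gcd d e\<close>. At \<open>e = N\<close> every element
  is fixed, which forces \<open>gcd d N = d\<close>.\<close>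

lemma field_algebra_units:
  assumes F: "field F" "finite (carrier F)" "card (carrier F) = q"
    and R: "field R" "finite (carrier R)" and h: "h \<in> ring_hom F R"
    and N: "N > 0" and fix_all: "\<And>x. x \<in> carrier R \<Longrightarrow> x [^]\<^bsub>R\<^esub> (q ^ N) = x"
  shows "\<exists>d. d dvd N \<and> units_of R \<cong> integer_mod_group (q ^ d - 1) \<and>
    (\<forall>e>0. card {x \<in> carrier R. x [^]\<^bsub>R\<^esub> (q ^ e) = x} = q ^ gcd d e)"
proof -
  interpret F: field F by fact
  interpret R: field R by fact
  obtain d where d: "card (carrier R) = q ^ d"
    using card_finite_field_extension[OF F(1,2) R h] F(3) by auto
  have "card {\<zero>\<^bsub>F\<^esub>, \<one>\<^bsub>F\<^esub>} \<le> card (carrier F)" using F by (intro card_mono) auto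
  hence q: "q \<ge> 2" using F by simp
  have fixed: "card {x \<in> carrier R. x [^]\<^bsub>R\<^esub> (q ^ e) = x} = q ^ gcd d e" for e
  proof -
    have "card {x \<in> carrier R. x [^]\<^bsub>R\<^esub> (q ^ e) = x} = gcd (q ^ e - 1) (q ^ d - 1) + 1"
      using R.card_fixed_pow[OF R(2), of "q ^ e"] q by (simp add: d)
    also have "\<dots> = q ^ gcd d e"
      using q gcd_power_minus_one[of q e d] by (simp add: gcd.commute)
    finally show ?thesis .
  qed
  have "{x \<in> carrier R. x [^]\<^bsub>R\<^esub> (q ^ N) = x} = carrier R" using fix_all by auto
  hence "q ^ gcd d N = q ^ d" using fixed[of N] d by simp
  hence "gcd d N = d" using q power_inject_exp[of q "gcd d N" d] by (simp only:)
  hence "d dvd N" by (metis gcd_dvd2)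
  moreover have "units_of R \<cong> integer_mod_group (q ^ d - 1)"
    using group.iso_sym[OF group_integer_mod_group R.finite_units_cyclic[OF R(2)]] by (simp add: d)
  ultimately show ?thesis using fixed by blast
qed

text \<open>For \<open>n\<close> equal to the size of the field, the count in
  \<open>card_fixed_pow\<close> is that size, so every element is fixed; then iterate.\<close>

lemma (in field) pow_card_power:
  assumes "finite (carrier R)" "a \<in> carrier R"
  shows "a [^] (card (carrier R) ^ k) = a"
proof -
  let ?q = "card (carrier R)"
  have q: "?q > 0" using assms by (auto simp: card_gt_0_iff)
  have "card {x \<in> carrier R. x [^] ?q = x} = card (carrier R)"
    using card_fixed_pow[OF assms(1), of ?q] q by simp
  hence "{x \<in> carrier R. x [^] ?q = x} = carrier R"
    using assms(1) by (intro card_subset_eq) auto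
  hence *: "x [^] ?q = x" if "x \<in> carrier R" for x using that by blast
  show ?thesis
  proof (induction k)
    case (Suc k)
    have "a [^] (?q ^ Suc k) = (a [^] (?q ^ k)) [^] ?q"
      using assms by (simp add: nat_pow_pow mult.commute)
    thus ?case using Suc * assms by simp
  qed (use assms in auto)
qed

text \<open>A \<open>p ^ k\<close>-th root of \<open>a\<close> is its power with exponent
  \<open>p ^ (n * k - k)\<close>, since the two exponents multiply to \<open>(p ^ n) ^ k\<close>,
  which fixes \<open>a\<close>.\<close>

lemma (in field) frobenius_surj:
  assumes "finite (carrier R)" "card (carrier R) = p ^ n" "n > 0"
  shows "(\<lambda>a. a [^] ((p::nat) ^ k)) ` carrier R = carrier R"
proof (intro equalityI subsetI)
  fix a assume a: "a \<in> carrier R"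
  have "k \<le> n * k" using assms(3) by simp
  hence "(a [^] (p ^ (n * k - k))) [^] (p ^ k) = a [^] ((p ^ n) ^ k)"
    using a by (simp add: nat_pow_pow power_add[symmetric] power_mult[symmetric])
  hence "a = (a [^] (p ^ (n * k - k))) [^] (p ^ k)"
    using pow_card_power[OF assms(1) a, of k] assms(2) by simp
  thus "a \<in> (\<lambda>a. a [^] (p ^ k)) ` carrier R" using a by blast
qed auto

section \<open>Splitting along idempotents\<close>

text \<open>The ideal \<open>eR\<close>, described as the elements that \<open>e\<close> fixes. It
  is a ring in its own right, with the operations of \<open>R\<close> but with identity
  \<open>e\<close>.\<close>

abbreviation corner :: "('a, 'm) ring_scheme \<Rightarrow> 'a \<Rightarrow> ('a, 'm) ring_scheme" where
  "corner R e \<equiv> R\<lparr>carrier := {x \<in> carrier R. e \<otimes>\<^bsub>R\<^esub> x = x}, one := e\<rparr>"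

text \<open>Idempotence follows by expanding \<open>e \<otimes> (e \<oplus> f)\<close>. The
  conditions are symmetric in \<open>e\<close> and \<open>f\<close>, so every fact about
  \<open>e\<close> transfers to \<open>f\<close> through \<open>swap\<close>.\<close>

locale complementary_idempotents = cring R for R (structure) +
  fixes e f
  assumes e [simp]: "e \<in> carrier R" and f [simp]: "f \<in> carrier R"
    and ef: "e \<otimes> f = \<zero>" and e_add_f: "e \<oplus> f = \<one>"
begin

lemma idem: "e \<otimes> e = e"
proof -
  have "e \<otimes> e = e \<otimes> (e \<oplus> f)" by (subst r_distr) (auto simp: ef)
  thus ?thesis by (simp add: e_add_f)
qed

lemma idem_mult: "x \<in> carrier R \<Longrightarrow> e \<otimes> (e \<otimes> x) = e \<otimes> x"
  by (simp add: m_assoc[symmetric] idem)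

lemma ef_mult: "x \<in> carrier R \<Longrightarrow> e \<otimes> (f \<otimes> x) = \<zero>"
  by (simp add: m_assoc[symmetric] ef)

lemma swap: "complementary_idempotents R f e"
  using ef e_add_f by unfold_locales (auto simp: m_comm a_comm)

lemma cring_corner: "cring (corner R e)"
proof (intro cringI abelian_groupI comm_monoidI)
  fix x assume x: "x \<in> carrier (corner R e)"
  have "e \<otimes> (\<ominus> x) = \<ominus> x" using x by (simp add: r_minus)
  thus "\<exists>y\<in>carrier (corner R e). y \<oplus>\<^bsub>corner R e\<^esub> x = \<zero>\<^bsub>corner R e\<^esub>"
    using x by (intro bexI[of _ "\<ominus> x"]) (auto simp: l_neg)
next
  fix x y assume "x \<in> carrier (corner R e)" "y \<in> carrier (corner R e)"
  thus "x \<otimes>\<^bsub>corner R e\<^esub> y \<in> carrier (corner R e)"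
    by (auto simp: m_assoc[symmetric])
qed (auto simp: idem r_distr l_distr a_ac m_ac)

lemma e_mult_ring_hom: "(\<lambda>x. e \<otimes> x) \<in> ring_hom R (corner R e)"
proof (rule ring_hom_memI)
  fix x y assume xy: "x \<in> carrier R" "y \<in> carrier R"
  have "e \<otimes> (x \<otimes> y) = (e \<otimes> e) \<otimes> (x \<otimes> y)" by (simp add: idem)
  also have "\<dots> = e \<otimes> x \<otimes> (e \<otimes> y)" using xy e by (simp add: m_ac del: idem)
  finally show "e \<otimes> (x \<otimes> y) = e \<otimes> x \<otimes>\<^bsub>corner R e\<^esub> (e \<otimes> y)" by simp
qed (auto simp: idem_mult r_distr idem)

text \<open>Positivity of the exponent matters: the zeroth power is \<open>e\<close> in the corner
  but the identity in \<open>R\<close>.\<close>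

lemma corner_pow: "n > 0 \<Longrightarrow> x \<in> carrier (corner R e) \<Longrightarrow> x [^]\<^bsub>corner R e\<^esub> (n::nat) = x [^] n"
proof (induction n)
  case (Suc n)
  thus ?case by (cases "n = 0") auto
qed auto

lemma corner_card_less:
  assumes "finite (carrier R)" "f \<noteq> \<zero>"
  shows "card (carrier (corner R e)) < card (carrier R)"
proof (rule psubset_card_mono[OF assms(1)])
  have "f \<notin> carrier (corner R e)" using ef assms by simp
  moreover have "f \<in> carrier R" "carrier (corner R e) \<subseteq> carrier R" by auto
  ultimately show "carrier (corner R e) \<subset> carrier R" by blast
qed

lemma decompose: "x \<in> carrier R \<Longrightarrow> e \<otimes> x \<oplus> f \<otimes> x = x"
  by (simp add: l_distr[symmetric] e_add_f)

lemma orthogonal: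
  assumes "a \<in> carrier (corner R e)" "b \<in> carrier (corner R f)"
  shows "e \<otimes> (a \<oplus> b) = a" "f \<otimes> (a \<oplus> b) = b" "a \<otimes> b = \<zero>"
proof -
  interpret s: complementary_idempotents R f e by (rule swap)
  have eb: "e \<otimes> b = \<zero>" and fa: "f \<otimes> a = \<zero>"
    using assms ef_mult[of b] s.ef_mult[of a] by auto
  show "e \<otimes> (a \<oplus> b) = a" "f \<otimes> (a \<oplus> b) = b"
    using assms by (auto simp: r_distr eb fa)
  have ab: "a \<in> carrier R" "b \<in> carrier R" using assms by auto
  hence "a \<otimes> (e \<otimes> b) = (e \<otimes> a) \<otimes> b" using e by (simp add: m_ac)
  thus "a \<otimes> b = \<zero>" using assms by (simp add: eb)
qed

text \<open>The Peirce decomposition; addition is the inverse map.\<close>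

lemma bij_corners:
  "bij_betw (\<lambda>x. (e \<otimes> x, f \<otimes> x)) (carrier R) (carrier (corner R e) \<times> carrier (corner R f))"
proof -
  interpret s: complementary_idempotents R f e by (rule swap)
  show ?thesis
  proof (rule bij_betwI[where g = "\<lambda>(a, b). a \<oplus> b"])
    show "(\<lambda>x. (e \<otimes> x, f \<otimes> x)) \<in> carrier R \<rightarrow> carrier (corner R e) \<times> carrier (corner R f)"
      by (simp add: idem_mult s.idem_mult)
    show "(\<lambda>(a, b). a \<oplus> b) \<in> carrier (corner R e) \<times> carrier (corner R f) \<rightarrow> carrier R"
      by auto
    show "(case (e \<otimes> x, f \<otimes> x) of (a, b) \<Rightarrow> a \<oplus> b) = x" if "x \<in> carrier R" for x
      using decompose[OF that] by simp
    show "(e \<otimes> (case z of (a, b) \<Rightarrow> a \<oplus> b), f \<otimes> (case z of (a, b) \<Rightarrow> a \<oplus> b)) = z"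
      if z: "z \<in> carrier (corner R e) \<times> carrier (corner R f)" for z
    proof -
      obtain a b where "z = (a, b)" "a \<in> carrier (corner R e)" "b \<in> carrier (corner R f)"
        using z by blast
      thus ?thesis using orthogonal[of a b] by (simp only: case_prod_conv)
    qed
  qed
qed

text \<open>Multiplication by \<open>e\<close> or \<open>f\<close> is a ring homomorphism onto the
  corner and preserves units. Conversely, the sum of inverses in the two corners is an inverse in
  \<open>R\<close>, because \<open>e \<oplus> f = \<one>\<close>.\<close>

lemma Units_iff_corners:
  assumes "x \<in> carrier R"
  shows "x \<in> Units R \<longleftrightarrow> e \<otimes> x \<in> Units (corner R e) \<and> f \<otimes> x \<in> Units (corner R f)"
proof
  interpret s: complementary_idempotents R f e by (rule swap)
  interpret Ce: cring "corner R e" by (rule cring_corner)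
  interpret Cf: cring "corner R f" by (rule s.cring_corner)
  interpret he: ring_hom_cring R "corner R e" "\<lambda>x. e \<otimes> x"
    using e_mult_ring_hom by unfold_locales
  interpret hf: ring_hom_cring R "corner R f" "\<lambda>x. f \<otimes> x"
    using s.e_mult_ring_hom by unfold_locales
  show "e \<otimes> x \<in> Units (corner R e) \<and> f \<otimes> x \<in> Units (corner R f)" if x: "x \<in> Units R"
  proof
    have "(e \<otimes> x) \<otimes>\<^bsub>corner R e\<^esub> (e \<otimes> inv x) = e \<otimes> (x \<otimes> inv x)"
      by (rule he.hom_mult[symmetric]) (use x assms in auto)
    also have "\<dots> = \<one>\<^bsub>corner R e\<^esub>" using x by simp
    finally have "(e \<otimes> x) \<otimes>\<^bsub>corner R e\<^esub> (e \<otimes> inv x) \<in> Units (corner R e)"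
      by (simp only: Ce.Units_one_closed)
    thus "e \<otimes> x \<in> Units (corner R e)"
      by (rule Ce.unit_factor) (use he.hom_closed x assms in blast)+
    have "(f \<otimes> x) \<otimes>\<^bsub>corner R f\<^esub> (f \<otimes> inv x) = f \<otimes> (x \<otimes> inv x)"
      by (rule hf.hom_mult[symmetric]) (use x assms in auto)
    also have "\<dots> = \<one>\<^bsub>corner R f\<^esub>" using x by simp
    finally have "(f \<otimes> x) \<otimes>\<^bsub>corner R f\<^esub> (f \<otimes> inv x) \<in> Units (corner R f)"
      by (simp only: Cf.Units_one_closed)
    thus "f \<otimes> x \<in> Units (corner R f)"
      by (rule Cf.unit_factor) (use hf.hom_closed x assms in blast)+
  qed
  show "x \<in> Units R" if "e \<otimes> x \<in> Units (corner R e) \<and> f \<otimes> x \<in> Units (corner R f)"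
  proof -
    define a where "a = inv\<^bsub>corner R e\<^esub> (e \<otimes> x)"
    define b where "b = inv\<^bsub>corner R f\<^esub> (f \<otimes> x)"
    have u: "e \<otimes> x \<in> Units (corner R e)" "f \<otimes> x \<in> Units (corner R f)"
      using that by blast+
    have ac: "a \<in> carrier (corner R e)" and bc: "b \<in> carrier (corner R f)"
      unfolding a_def b_def by (rule Ce.Units_inv_closed[OF u(1)], rule Cf.Units_inv_closed[OF u(2)])
    have a: "a \<otimes> (e \<otimes> x) = e" and b: "b \<otimes> (f \<otimes> x) = f"
      using Ce.Units_l_inv[OF u(1)] Cf.Units_l_inv[OF u(2)] unfolding a_def b_def by simp_all
    have abc: "a \<in> carrier R" "b \<in> carrier R" using ac bc by auto
    have "a \<otimes> x = e"
    proof -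
      have "a \<otimes> (e \<otimes> x) = (e \<otimes> a) \<otimes> x" using abc(1) assms e by (simp add: m_ac)
      thus ?thesis using a ac by simp
    qed
    moreover have "b \<otimes> x = f"
    proof -
      have "b \<otimes> (f \<otimes> x) = (f \<otimes> b) \<otimes> x" using abc(2) assms f by (simp add: m_ac)
      thus ?thesis using b bc by simp
    qed
    ultimately have "(a \<oplus> b) \<otimes> x = \<one>" using abc assms by (simp add: l_distr e_add_f)
    hence "x \<otimes> (a \<oplus> b) \<in> Units R" using abc assms by (simp add: m_comm)
    thus ?thesis by (rule unit_factor) (use abc assms in auto)
  qed
qed

lemma units_iso_corners: "units_of R \<cong> units_of (corner R e) \<times>\<times> units_of (corner R f)"
proof -
  interpret s: complementary_idempotents R f e by (rule swap)
  have bij: "bij_betw (\<lambda>x. (e \<otimes> x, f \<otimes> x)) (Units R) (Units (corner R e) \<times> Units (corner R f))"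
  proof (rule bij_betw_subset[OF bij_corners])
    show "(\<lambda>x. (e \<otimes> x, f \<otimes> x)) ` Units R = Units (corner R e) \<times> Units (corner R f)"
    proof (intro equalityI subsetI)
      fix z assume z: "z \<in> Units (corner R e) \<times> Units (corner R f)"
      hence "z \<in> carrier (corner R e) \<times> carrier (corner R f)" by (auto simp: Units_def)
      then obtain x where "x \<in> carrier R" "z = (e \<otimes> x, f \<otimes> x)"
        using bij_corners by (auto simp: bij_betw_def)
      thus "z \<in> (\<lambda>x. (e \<otimes> x, f \<otimes> x)) ` Units R" using z Units_iff_corners[of x] by auto
    next
      fix z assume "z \<in> (\<lambda>x. (e \<otimes> x, f \<otimes> x)) ` Units R"
      thus "z \<in> Units (corner R e) \<times> Units (corner R f)" using Units_iff_corners Units_closed by blast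
    qed
  qed auto
  have "(\<lambda>x. (e \<otimes> x, f \<otimes> x)) \<in> iso (units_of R) (units_of (corner R e) \<times>\<times> units_of (corner R f))"
  proof (rule isoI)
    show "(\<lambda>x. (e \<otimes> x, f \<otimes> x)) \<in> hom (units_of R) (units_of (corner R e) \<times>\<times> units_of (corner R f))"
    proof (rule homI)
      show "(e \<otimes> x, f \<otimes> x) \<in> carrier (units_of (corner R e) \<times>\<times> units_of (corner R f))"
        if "x \<in> carrier (units_of R)" for x
        using that Units_iff_corners[of x] Units_closed[of x] by (simp add: units_of_carrier)
      fix x y assume "x \<in> carrier (units_of R)" "y \<in> carrier (units_of R)"
      hence xy: "x \<in> carrier R" "y \<in> carrier R" by (auto simp: units_of_carrier)
      show "(e \<otimes> (x \<otimes>\<^bsub>units_of R\<^esub> y), f \<otimes> (x \<otimes>\<^bsub>units_of R\<^esub> y)) =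
          (e \<otimes> x, f \<otimes> x) \<otimes>\<^bsub>units_of (corner R e) \<times>\<times> units_of (corner R f)\<^esub> (e \<otimes> y, f \<otimes> y)"
        using ring_hom_mult[OF e_mult_ring_hom xy] ring_hom_mult[OF s.e_mult_ring_hom xy]
        by (simp add: units_of_mult)
    qed
    show "bij_betw (\<lambda>x. (e \<otimes> x, f \<otimes> x)) (carrier (units_of R))
        (carrier (units_of (corner R e) \<times>\<times> units_of (corner R f)))"
      using bij by (simp add: units_of_carrier)
  qed
  thus ?thesis by (rule is_isoI)
qed

text \<open>Both multiplications are ring homomorphisms, so under \<open>bij_corners\<close> the
  power map acts coordinatewise.\<close>

lemma card_fixed_corners:
  assumes "n > 0"
  shows "card {x \<in> carrier R. x [^] (n::nat) = x} =
    card {x \<in> carrier (corner R e). x [^]\<^bsub>corner R e\<^esub> n = x} *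
    card {x \<in> carrier (corner R f). x [^]\<^bsub>corner R f\<^esub> n = x}"
proof -
  interpret s: complementary_idempotents R f e by (rule swap)
  let ?A = "{x \<in> carrier (corner R e). x [^]\<^bsub>corner R e\<^esub> n = x}"
  let ?B = "{x \<in> carrier (corner R f). x [^]\<^bsub>corner R f\<^esub> n = x}"
  interpret Ce: cring "corner R e" by (rule cring_corner)
  interpret Cf: cring "corner R f" by (rule s.cring_corner)
  interpret he: ring_hom_cring R "corner R e" "\<lambda>x. e \<otimes> x"
    using e_mult_ring_hom by unfold_locales
  interpret hf: ring_hom_cring R "corner R f" "\<lambda>x. f \<otimes> x"
    using s.e_mult_ring_hom by unfold_locales
  have iff: "x [^] n = x \<longleftrightarrow> (e \<otimes> x) [^]\<^bsub>corner R e\<^esub> n = e \<otimes> x \<and> (f \<otimes> x) [^]\<^bsub>corner R f\<^esub> n = f \<otimes> x"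
    if x: "x \<in> carrier R" for x
  proof -
    have "x [^] n = x \<longleftrightarrow> (e \<otimes> x [^] n, f \<otimes> x [^] n) = (e \<otimes> x, f \<otimes> x)"
      using bij_corners x by (metis (no_types, lifting) Pair_inject decompose nat_pow_closed)
    thus ?thesis using he.hom_pow[OF x, of n] hf.hom_pow[OF x, of n] by simp
  qed
  have "bij_betw (\<lambda>x. (e \<otimes> x, f \<otimes> x)) {x \<in> carrier R. x [^] n = x} (?A \<times> ?B)"
  proof (rule bij_betw_subset[OF bij_corners])
    show "(\<lambda>x. (e \<otimes> x, f \<otimes> x)) ` {x \<in> carrier R. x [^] n = x} = ?A \<times> ?B"
    proof (intro equalityI subsetI)
      fix z assume z: "z \<in> ?A \<times> ?B"
      hence "z \<in> carrier (corner R e) \<times> carrier (corner R f)" by blast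
      then obtain x where "x \<in> carrier R" "z = (e \<otimes> x, f \<otimes> x)"
        using bij_corners by (auto simp: bij_betw_def)
      thus "z \<in> (\<lambda>x. (e \<otimes> x, f \<otimes> x)) ` {x \<in> carrier R. x [^] n = x}" using z iff[of x] by blast
    next
      fix z assume "z \<in> (\<lambda>x. (e \<otimes> x, f \<otimes> x)) ` {x \<in> carrier R. x [^] n = x}"
      then obtain x where "x \<in> carrier R" "x [^] n = x" "z = (e \<otimes> x, f \<otimes> x)" by blast
      thus "z \<in> ?A \<times> ?B" using iff[of x] he.hom_closed[of x] hf.hom_closed[of x] by blast
    qed
  qed auto
  thus ?thesis by (simp only: bij_betw_same_card card_cartesian_product)
qed

end

text \<open>The power of \<open>x\<close> with exponent \<open>n - 1\<close> is idempotent because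
  \<open>x [^] n = x\<close>. It is nonzero because it fixes \<open>x\<close>, and it differs from
  one because otherwise \<open>x [^] (n - 2)\<close> would invert \<open>x\<close>. Writing it as
  \<open>x \<otimes> x [^] (n - 2)\<close> exposes this inverse.\<close>

lemma (in cring) exists_complementary_idempotents:
  assumes n: "n \<ge> 2" and fix_all: "\<And>x. x \<in> carrier R \<Longrightarrow> x [^] (n::nat) = x"
    and x: "x \<in> carrier R" "x \<noteq> \<zero>" "x \<notin> Units R"
  shows "\<exists>e f. complementary_idempotents R e f \<and> e \<noteq> \<zero> \<and> f \<noteq> \<zero>"
proof -
  define e where "e = x \<otimes> x [^] (n - 2)"
  have e: "e \<in> carrier R" using x by (simp add: e_def)
  have "e \<otimes> x = x [^] Suc (Suc (n - 2))"
    unfolding e_def using x by (simp add: m_ac)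
  also have "Suc (Suc (n - 2)) = n" using n by simp
  also have "x [^] n = x" using fix_all x by simp
  finally have ex: "e \<otimes> x = x" .
  have "e \<otimes> (x \<otimes> x [^] (n - 2)) = (e \<otimes> x) \<otimes> x [^] (n - 2)"
    using x e by (simp add: m_assoc)
  hence ee: "e \<otimes> e = e" unfolding ex by (simp only: e_def[symmetric])
  have "e \<noteq> \<zero>" using ex x by auto
  moreover have "\<one> \<ominus> e \<noteq> \<zero>"
  proof
    assume "\<one> \<ominus> e = \<zero>"
    hence "x \<otimes> x [^] (n - 2) = \<one>" using e by (simp add: e_def)
    hence "x \<in> Units R" using x by (intro unit_factor[of x "x [^] (n - 2)"]) auto
    thus False using x by simp
  qed
  moreover have "complementary_idempotents R e (\<one> \<ominus> e)"
    using e ee by unfold_locales (auto simp: a_minus_def r_distr r_minus r_neg a_lcomm[of e \<one>])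
  ultimately show ?thesis by blast
qed

text \<open>Strong induction on the size of the ring: zero ring, field, or a proper split by
  idempotents. The homomorphism from \<open>F\<close> is carried through the induction so that each
  final field has a power of \<open>q\<close> elements. The fixed-point counts are carried because
  the fields themselves are not retained, and these counts are what later identifies their
  degrees.\<close>

theorem reduced_algebra_units:
  fixes R :: "('b, 'c) ring_scheme"
  assumes F: "field F" "finite (carrier F)" "card (carrier F) = q" and N: "N > 0"
    and "cring R" "finite (carrier R)" "h \<in> ring_hom F R"
    and "\<And>x. x \<in> carrier R \<Longrightarrow> x [^]\<^bsub>R\<^esub> (q ^ N) = x"
  shows "\<exists>ds. (\<forall>d\<in>set ds. d dvd N) \<and> units_of R \<cong> cyclic_product (map (\<lambda>d. q ^ d - 1) ds) \<and>
    (\<forall>e>0. card {x \<in> carrier R. x [^]\<^bsub>R\<^esub> (q ^ e) = x} = q ^ (\<Sum>d\<leftarrow>ds. gcd d e))"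
  using assms(5-)
proof (induction "card (carrier R)" arbitrary: R h rule: less_induct)
  case less
  note fin = less.prems(2) and h = less.prems(3) and fix_all = less.prems(4)
  interpret F: field F by fact
  interpret R: cring R by fact
  have "card {\<zero>\<^bsub>F\<^esub>, \<one>\<^bsub>F\<^esub>} \<le> card (carrier F)" using F by (intro card_mono) auto
  hence q: "q \<ge> 2" using F by simp
  consider (trivial) "\<one>\<^bsub>R\<^esub> = \<zero>\<^bsub>R\<^esub>"
    | (field) "\<one>\<^bsub>R\<^esub> \<noteq> \<zero>\<^bsub>R\<^esub>" "\<And>x. x \<in> carrier R \<Longrightarrow> x \<noteq> \<zero>\<^bsub>R\<^esub> \<Longrightarrow> x \<in> Units R"
    | (split) x where "x \<in> carrier R" "x \<noteq> \<zero>\<^bsub>R\<^esub>" "x \<notin> Units R" by blast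
  then show ?case
  proof cases
    case trivial
    hence car: "carrier R = {\<zero>\<^bsub>R\<^esub>}" using R.one_zeroD by blast
    have "Units R = {\<one>\<^bsub>R\<^esub>}" using car trivial R.Units_one_closed by (auto simp: Units_def)
    hence "(\<lambda>_. \<one>\<^bsub>cyclic_product []\<^esub>) \<in> iso (units_of R) (cyclic_product [])"
      by (auto simp: iso_def hom_def bij_betw_def cyclic_product_def units_of_carrier)
    hence "units_of R \<cong> cyclic_product (map (\<lambda>d. q ^ d - 1) [])" by (simp add: is_isoI)
    moreover have "{x \<in> carrier R. x [^]\<^bsub>R\<^esub> (q ^ e) = x} = {\<zero>\<^bsub>R\<^esub>}" for e
      using car q by (auto simp: R.nat_pow_zero)
    ultimately show ?thesis by (intro exI[of _ "[]"]) auto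
  next
    case field
    have "\<zero>\<^bsub>R\<^esub> \<notin> Units R"
    proof
      assume z: "\<zero>\<^bsub>R\<^esub> \<in> Units R"
      show False using field(1) R.Units_r_inv[OF z] R.l_null[OF R.Units_inv_closed[OF z]] by simp
    qed
    have "field R"
    proof (rule R.cring_fieldI)
      show "Units R = carrier R - {\<zero>\<^bsub>R\<^esub>}"
        using field \<open>\<zero>\<^bsub>R\<^esub> \<notin> Units R\<close> R.Units_closed by blast
    qed
    from field_algebra_units[OF F this fin h N fix_all] obtain d where d: "d dvd N"
      and iso: "units_of R \<cong> integer_mod_group (q ^ d - 1)"
      and fixed: "\<And>e. e > 0 \<Longrightarrow> card {x \<in> carrier R. x [^]\<^bsub>R\<^esub> (q ^ e) = x} = q ^ gcd d e" by blast
    have "units_of R \<cong> cyclic_product [q ^ d - 1]"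
      using iso_trans[OF iso group.iso_sym[OF group_cyclic_product cyclic_product_singleton]] .
    thus ?thesis using d fixed by (intro exI[of _ "[d]"]) auto
  next
    case split
    have "q \<le> q ^ N" using q N by (intro self_le_power) auto
    hence "q ^ N \<ge> 2" using q by simp
    then obtain e f where ef: "complementary_idempotents R e f" "e \<noteq> \<zero>\<^bsub>R\<^esub>" "f \<noteq> \<zero>\<^bsub>R\<^esub>"
      using R.exists_complementary_idempotents[OF _ fix_all split] by auto
    interpret E: complementary_idempotents R e f by (rule ef)
    interpret S: complementary_idempotents R f e by (rule E.swap)
    have qN: "q ^ N > 0" using q by simp
    obtain ds where ds: "\<forall>d\<in>set ds. d dvd N"
      and isoE: "units_of (corner R e) \<cong> cyclic_product (map (\<lambda>d. q ^ d - 1) ds)"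
      and fixE: "\<And>k. k > 0 \<Longrightarrow> card {x \<in> carrier (corner R e). x [^]\<^bsub>corner R e\<^esub> (q ^ k) = x} = q ^ (\<Sum>d\<leftarrow>ds. gcd d k)"
    proof -
      have 1: "finite (carrier (corner R e))" using fin by simp
      have 2: "x [^]\<^bsub>corner R e\<^esub> (q ^ N) = x" if "x \<in> carrier (corner R e)" for x
        using E.corner_pow[OF qN that] fix_all[of x] that by simp
      show thesis using that less.hyps[OF E.corner_card_less[OF fin ef(3)] E.cring_corner 1
        ring_hom_trans[OF h E.e_mult_ring_hom] 2] by blast
    qed
    obtain ds' where ds': "\<forall>d\<in>set ds'. d dvd N"
      and isoF: "units_of (corner R f) \<cong> cyclic_product (map (\<lambda>d. q ^ d - 1) ds')"
      and fixF: "\<And>k. k > 0 \<Longrightarrow> card {x \<in> carrier (corner R f). x [^]\<^bsub>corner R f\<^esub> (q ^ k) = x} = q ^ (\<Sum>d\<leftarrow>ds'. gcd d k)"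
    proof -
      have 1: "finite (carrier (corner R f))" using fin by simp
      have 2: "x [^]\<^bsub>corner R f\<^esub> (q ^ N) = x" if "x \<in> carrier (corner R f)" for x
        using S.corner_pow[OF qN that] fix_all[of x] that by simp
      show thesis using that less.hyps[OF S.corner_card_less[OF fin ef(2)] S.cring_corner 1
        ring_hom_trans[OF h S.e_mult_ring_hom] 2] by blast
    qed
    interpret Ce: cring "corner R e" by (rule E.cring_corner)
    have "units_of R \<cong> units_of (corner R e) \<times>\<times> units_of (corner R f)" by (rule E.units_iso_corners)
    also have "\<dots> \<cong> cyclic_product (map (\<lambda>d. q ^ d - 1) ds) \<times>\<times> cyclic_product (map (\<lambda>d. q ^ d - 1) ds')"
      by (rule group.DirProd_iso_trans[OF Ce.units_group isoE isoF])
    also have "\<dots> \<cong> cyclic_product (map (\<lambda>d. q ^ d - 1) (ds @ ds'))"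
      unfolding map_append by (rule cyclic_product_append)
    finally have "units_of R \<cong> cyclic_product (map (\<lambda>d. q ^ d - 1) (ds @ ds'))" .
    moreover have "card {x \<in> carrier R. x [^]\<^bsub>R\<^esub> (q ^ k) = x} = q ^ (\<Sum>d\<leftarrow>ds @ ds'. gcd d k)" if "k > 0" for k
      using E.card_fixed_corners[of "q ^ k"] q fixE[OF that] fixF[OF that] by (simp add: power_add)
    ultimately show ?thesis using ds ds' by (intro exI[of _ "ds @ ds'"]) auto
  qed
qed

section \<open>Group algebras of finite abelian groups\<close>

lemma (in abelian_monoid) finsum_swap:
  assumes "finite A" "finite B" "\<And>a b. a \<in> A \<Longrightarrow> b \<in> B \<Longrightarrow> f a b \<in> carrier G"
  shows "(\<Oplus>a\<in>A. \<Oplus>b\<in>B. f a b) = (\<Oplus>b\<in>B. \<Oplus>a\<in>A. f a b)"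
  using assms(1,3)
proof (induction A rule: finite_induct)
  case empty
  then show ?case by simp
next
  case (insert a A)
  have "(\<Oplus>b\<in>B. \<Oplus>a\<in>insert a A. f a b) = (\<Oplus>b\<in>B. f a b \<oplus> (\<Oplus>a\<in>A. f a b))"
    using insert by (intro finsum_cong') (auto intro!: finsum_closed finsum_insert)
  also have "\<dots> = (\<Oplus>b\<in>B. f a b) \<oplus> (\<Oplus>b\<in>B. \<Oplus>a\<in>A. f a b)"
    using insert.prems by (intro finsum_addf) (auto intro!: finsum_closed)
  finally show ?case
    using insert by (subst finsum_insert) (auto intro!: finsum_closed)
qed

locale finite_group_algebra = cring R + G: comm_group G for R (structure) and G (structure) +
  assumes finite_G: "finite (carrier G)"
begin

abbreviation A where "A \<equiv> group_algebra R G"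

text \<open>The monomial a g. For \<open>g\<close> the identity it embeds the scalars.\<close>

definition single where "single a g = (\<lambda>h\<in>carrier G. if h = g then a else \<zero>)"

lemma carrier_A: "carrier A = carrier G \<rightarrow>\<^sub>E carrier R"
  using finite_G by (auto simp: group_algebra_def)

lemma A_closed: "x \<in> carrier A \<Longrightarrow> g \<in> carrier G \<Longrightarrow> x g \<in> carrier R"
  by (auto simp: carrier_A)

lemma A_eqI:
  "x \<in> carrier A \<Longrightarrow> y \<in> carrier A \<Longrightarrow> (\<And>g. g \<in> carrier G \<Longrightarrow> x g = y g) \<Longrightarrow> x = y"
  unfolding carrier_A by (rule PiE_ext)

lemma A_add: "g \<in> carrier G \<Longrightarrow> (x \<oplus>\<^bsub>A\<^esub> y) g = x g \<oplus> y g"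
  by (simp add: group_algebra_def)

lemma A_zero: "g \<in> carrier G \<Longrightarrow> \<zero>\<^bsub>A\<^esub> g = \<zero>"
  by (simp add: group_algebra_def)

lemma A_one: "\<one>\<^bsub>A\<^esub> = single \<one> \<one>\<^bsub>G\<^esub>"
  by (simp add: group_algebra_def single_def)

lemma single_closed: "a \<in> carrier R \<Longrightarrow> single a g \<in> carrier A"
  by (auto simp: carrier_A single_def)

text \<open>Over a finite group the terms outside the support may be added, being zero. The range of
  summation then no longer depends on \<open>x\<close>, so that sums can be reindexed and
  interchanged.\<close>

lemma A_mult:
  assumes x: "x \<in> carrier A" and y: "y \<in> carrier A" and g: "g \<in> carrier G"
  shows "(x \<otimes>\<^bsub>A\<^esub> y) g = (\<Oplus>h\<in>carrier G. x h \<otimes> y (inv\<^bsub>G\<^esub> h \<otimes>\<^bsub>G\<^esub> g))"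
proof -
  have "(x \<otimes>\<^bsub>A\<^esub> y) g = (\<Oplus>h\<in>{h \<in> carrier G. x h \<noteq> \<zero>}. x h \<otimes> y (inv\<^bsub>G\<^esub> h \<otimes>\<^bsub>G\<^esub> g))"
    using g by (simp add: group_algebra_def)
  also have "\<dots> = (\<Oplus>h\<in>carrier G. x h \<otimes> y (inv\<^bsub>G\<^esub> h \<otimes>\<^bsub>G\<^esub> g))"
    using finite_G A_closed[OF x] A_closed[OF y] g
    by (intro add.finprod_mono_neutral_cong_left) auto
  finally show ?thesis .
qed

lemma A_mult_closed: "x \<in> carrier A \<Longrightarrow> y \<in> carrier A \<Longrightarrow> x \<otimes>\<^bsub>A\<^esub> y \<in> carrier A"
  using A_mult[of x y] unfolding carrier_A
  by (auto simp: PiE_iff extensional_def group_algebra_def intro!: finsum_closed)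

text \<open>Reindex the sum by h \<mapsto> h^(-1) g, an involution of \<open>G\<close> that
  exchanges the two arguments of the product.\<close>

lemma A_mult_comm:
  assumes x: "x \<in> carrier A" and y: "y \<in> carrier A"
  shows "x \<otimes>\<^bsub>A\<^esub> y = y \<otimes>\<^bsub>A\<^esub> x"
proof (rule A_eqI[OF A_mult_closed[OF x y] A_mult_closed[OF y x]])
  fix g assume g: "g \<in> carrier G"
  have inj: "inj_on (\<lambda>h. inv\<^bsub>G\<^esub> h \<otimes>\<^bsub>G\<^esub> g) (carrier G)"
    using g by (auto simp: inj_on_def)
  have im: "(\<lambda>h. inv\<^bsub>G\<^esub> h \<otimes>\<^bsub>G\<^esub> g) ` carrier G = carrier G"
  proof (intro equalityI subsetI)
    fix k assume k: "k \<in> carrier G"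
    have "k = inv\<^bsub>G\<^esub> (inv\<^bsub>G\<^esub> k \<otimes>\<^bsub>G\<^esub> g) \<otimes>\<^bsub>G\<^esub> g"
      using g k by (simp add: G.inv_mult G.m_assoc)
    thus "k \<in> (\<lambda>h. inv\<^bsub>G\<^esub> h \<otimes>\<^bsub>G\<^esub> g) ` carrier G"
      using g k by blast
  qed (use g in auto)
  have invol: "inv\<^bsub>G\<^esub> (inv\<^bsub>G\<^esub> h \<otimes>\<^bsub>G\<^esub> g) \<otimes>\<^bsub>G\<^esub> g = h" if "h \<in> carrier G" for h
    using g that by (simp add: G.inv_mult G.m_assoc)
  have "(y \<otimes>\<^bsub>A\<^esub> x) g = (\<Oplus>h\<in>(\<lambda>h. inv\<^bsub>G\<^esub> h \<otimes>\<^bsub>G\<^esub> g) ` carrier G. y h \<otimes> x (inv\<^bsub>G\<^esub> h \<otimes>\<^bsub>G\<^esub> g))"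
    unfolding im by (rule A_mult[OF y x g])
  also have "\<dots> = (\<Oplus>h\<in>carrier G. y (inv\<^bsub>G\<^esub> h \<otimes>\<^bsub>G\<^esub> g) \<otimes> x (inv\<^bsub>G\<^esub> (inv\<^bsub>G\<^esub> h \<otimes>\<^bsub>G\<^esub> g) \<otimes>\<^bsub>G\<^esub> g))"
    using A_closed[OF x] A_closed[OF y] g by (intro finsum_reindex[OF _ inj]) auto
  also have "\<dots> = (\<Oplus>h\<in>carrier G. x h \<otimes> y (inv\<^bsub>G\<^esub> h \<otimes>\<^bsub>G\<^esub> g))"
    using A_closed[OF x] A_closed[OF y] g by (intro finsum_cong') (auto simp: invol m_comm)
  also have "\<dots> = (x \<otimes>\<^bsub>A\<^esub> y) g" by (rule A_mult[OF x y g, symmetric])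
  finally show "(x \<otimes>\<^bsub>A\<^esub> y) g = (y \<otimes>\<^bsub>A\<^esub> x) g" by simp
qed

text \<open>Expand both products, interchange the sums, and translate the inner summation variable
  by \<open>k\<close>, which turns the inner sum into a value of the product of \<open>y\<close> and
  \<open>z\<close> (\<open>inner\<close>).\<close>

lemma A_mult_assoc:
  assumes x: "x \<in> carrier A" and y: "y \<in> carrier A" and z: "z \<in> carrier A"
  shows "x \<otimes>\<^bsub>A\<^esub> y \<otimes>\<^bsub>A\<^esub> z = x \<otimes>\<^bsub>A\<^esub> (y \<otimes>\<^bsub>A\<^esub> z)"
proof (rule A_eqI)
  note xc = A_closed[OF x] and yc = A_closed[OF y] and zc = A_closed[OF z]
  fix g assume g: "g \<in> carrier G"
  have inner: "(\<Oplus>h\<in>carrier G. y (inv\<^bsub>G\<^esub> k \<otimes>\<^bsub>G\<^esub> h) \<otimes> z (inv\<^bsub>G\<^esub> h \<otimes>\<^bsub>G\<^esub> g)) = (y \<otimes>\<^bsub>A\<^esub> z) (inv\<^bsub>G\<^esub> k \<otimes>\<^bsub>G\<^esub> g)"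
    if k: "k \<in> carrier G" for k
  proof -
    have inj: "inj_on (\<lambda>h. k \<otimes>\<^bsub>G\<^esub> h) (carrier G)" using k by (auto simp: inj_on_def)
    have im: "(\<lambda>h. k \<otimes>\<^bsub>G\<^esub> h) ` carrier G = carrier G"
      using k by (rule G.surj_const_mult)
    have "(\<Oplus>h\<in>(\<lambda>h. k \<otimes>\<^bsub>G\<^esub> h) ` carrier G. y (inv\<^bsub>G\<^esub> k \<otimes>\<^bsub>G\<^esub> h) \<otimes> z (inv\<^bsub>G\<^esub> h \<otimes>\<^bsub>G\<^esub> g)) =
        (\<Oplus>h\<in>carrier G. y (inv\<^bsub>G\<^esub> k \<otimes>\<^bsub>G\<^esub> (k \<otimes>\<^bsub>G\<^esub> h)) \<otimes> z (inv\<^bsub>G\<^esub> (k \<otimes>\<^bsub>G\<^esub> h) \<otimes>\<^bsub>G\<^esub> g))"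
      using k g yc zc by (intro finsum_reindex[OF _ inj]) auto
    also have "\<dots> = (\<Oplus>h\<in>carrier G. y h \<otimes> z (inv\<^bsub>G\<^esub> h \<otimes>\<^bsub>G\<^esub> (inv\<^bsub>G\<^esub> k \<otimes>\<^bsub>G\<^esub> g)))"
    proof (intro finsum_cong' refl)
      fix h assume h: "h \<in> carrier G"
      have "inv\<^bsub>G\<^esub> k \<otimes>\<^bsub>G\<^esub> (k \<otimes>\<^bsub>G\<^esub> h) = h"
        using k h by (simp add: G.m_assoc[symmetric])
      moreover have "inv\<^bsub>G\<^esub> (k \<otimes>\<^bsub>G\<^esub> h) \<otimes>\<^bsub>G\<^esub> g = inv\<^bsub>G\<^esub> h \<otimes>\<^bsub>G\<^esub> (inv\<^bsub>G\<^esub> k \<otimes>\<^bsub>G\<^esub> g)"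
        using k h g by (simp add: G.inv_mult_group G.m_assoc)
      ultimately show "y (inv\<^bsub>G\<^esub> k \<otimes>\<^bsub>G\<^esub> (k \<otimes>\<^bsub>G\<^esub> h)) \<otimes> z (inv\<^bsub>G\<^esub> (k \<otimes>\<^bsub>G\<^esub> h) \<otimes>\<^bsub>G\<^esub> g)
        = y h \<otimes> z (inv\<^bsub>G\<^esub> h \<otimes>\<^bsub>G\<^esub> (inv\<^bsub>G\<^esub> k \<otimes>\<^bsub>G\<^esub> g))" by simp
    qed (use k g yc zc in auto)
    also have "\<dots> = (y \<otimes>\<^bsub>A\<^esub> z) (inv\<^bsub>G\<^esub> k \<otimes>\<^bsub>G\<^esub> g)"
      using k g by (intro A_mult[OF y z, symmetric]) auto
    finally show ?thesis unfolding im .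
  qed
  have "(x \<otimes>\<^bsub>A\<^esub> y \<otimes>\<^bsub>A\<^esub> z) g = (\<Oplus>h\<in>carrier G. (x \<otimes>\<^bsub>A\<^esub> y) h \<otimes> z (inv\<^bsub>G\<^esub> h \<otimes>\<^bsub>G\<^esub> g))"
    by (rule A_mult[OF A_mult_closed[OF x y] z g])
  also have "\<dots> = (\<Oplus>h\<in>carrier G. \<Oplus>k\<in>carrier G. x k \<otimes> (y (inv\<^bsub>G\<^esub> k \<otimes>\<^bsub>G\<^esub> h) \<otimes> z (inv\<^bsub>G\<^esub> h \<otimes>\<^bsub>G\<^esub> g)))"
  proof (intro finsum_cong' refl)
    fix h assume h: "h \<in> carrier G"
    have "(x \<otimes>\<^bsub>A\<^esub> y) h \<otimes> z (inv\<^bsub>G\<^esub> h \<otimes>\<^bsub>G\<^esub> g)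
      = (\<Oplus>k\<in>carrier G. x k \<otimes> y (inv\<^bsub>G\<^esub> k \<otimes>\<^bsub>G\<^esub> h) \<otimes> z (inv\<^bsub>G\<^esub> h \<otimes>\<^bsub>G\<^esub> g))"
      unfolding A_mult[OF x y h] using finite_G h g xc yc zc by (intro finsum_ldistr) auto
    also have "\<dots> = (\<Oplus>k\<in>carrier G. x k \<otimes> (y (inv\<^bsub>G\<^esub> k \<otimes>\<^bsub>G\<^esub> h) \<otimes> z (inv\<^bsub>G\<^esub> h \<otimes>\<^bsub>G\<^esub> g)))"
      using h g xc yc zc by (intro finsum_cong') (auto simp: m_assoc)
    finally show "(x \<otimes>\<^bsub>A\<^esub> y) h \<otimes> z (inv\<^bsub>G\<^esub> h \<otimes>\<^bsub>G\<^esub> g) =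
      (\<Oplus>k\<in>carrier G. x k \<otimes> (y (inv\<^bsub>G\<^esub> k \<otimes>\<^bsub>G\<^esub> h) \<otimes> z (inv\<^bsub>G\<^esub> h \<otimes>\<^bsub>G\<^esub> g)))" .
  qed (use g xc yc zc in \<open>auto intro!: finsum_closed\<close>)
  also have "\<dots> = (\<Oplus>k\<in>carrier G. \<Oplus>h\<in>carrier G. x k \<otimes> (y (inv\<^bsub>G\<^esub> k \<otimes>\<^bsub>G\<^esub> h) \<otimes> z (inv\<^bsub>G\<^esub> h \<otimes>\<^bsub>G\<^esub> g)))"
    using finite_G g xc yc zc by (intro finsum_swap) auto
  also have "\<dots> = (\<Oplus>k\<in>carrier G. x k \<otimes> (y \<otimes>\<^bsub>A\<^esub> z) (inv\<^bsub>G\<^esub> k \<otimes>\<^bsub>G\<^esub> g))"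
  proof (intro finsum_cong' refl)
    fix k assume k: "k \<in> carrier G"
    show "(\<Oplus>h\<in>carrier G. x k \<otimes> (y (inv\<^bsub>G\<^esub> k \<otimes>\<^bsub>G\<^esub> h) \<otimes> z (inv\<^bsub>G\<^esub> h \<otimes>\<^bsub>G\<^esub> g))) =
      x k \<otimes> (y \<otimes>\<^bsub>A\<^esub> z) (inv\<^bsub>G\<^esub> k \<otimes>\<^bsub>G\<^esub> g)"
      unfolding inner[OF k, symmetric] using finite_G k g xc yc zc
      by (intro finsum_rdistr[symmetric]) auto
  qed (use g xc A_closed[OF A_mult_closed[OF y z]] in auto)
  also have "\<dots> = (x \<otimes>\<^bsub>A\<^esub> (y \<otimes>\<^bsub>A\<^esub> z)) g"
    by (rule A_mult[OF x A_mult_closed[OF y z] g, symmetric])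
  finally show "(x \<otimes>\<^bsub>A\<^esub> y \<otimes>\<^bsub>A\<^esub> z) g = (x \<otimes>\<^bsub>A\<^esub> (y \<otimes>\<^bsub>A\<^esub> z)) g" .
qed (intro A_mult_closed x y z)+

lemma single_mult_apply:
  assumes "a \<in> carrier R" "g \<in> carrier G" and y: "y \<in> carrier A" and k: "k \<in> carrier G"
  shows "(single a g \<otimes>\<^bsub>A\<^esub> y) k = a \<otimes> y (inv\<^bsub>G\<^esub> g \<otimes>\<^bsub>G\<^esub> k)"
proof -
  have "(single a g \<otimes>\<^bsub>A\<^esub> y) k = (\<Oplus>h\<in>carrier G. single a g h \<otimes> y (inv\<^bsub>G\<^esub> h \<otimes>\<^bsub>G\<^esub> k))"
    using assms by (intro A_mult single_closed)
  also have "\<dots> = (\<Oplus>h\<in>carrier G. if g = h then a \<otimes> y (inv\<^bsub>G\<^esub> h \<otimes>\<^bsub>G\<^esub> k) else \<zero>)"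
    using assms A_closed[OF y] by (intro finsum_cong') (auto simp: single_def)
  also have "\<dots> = a \<otimes> y (inv\<^bsub>G\<^esub> g \<otimes>\<^bsub>G\<^esub> k)"
    using assms A_closed[OF y] finite_G by (intro finsum_singleton) auto
  finally show ?thesis .
qed

lemma cring_A: "cring A"
proof (intro cringI abelian_groupI comm_monoidI)
  show add_closed: "x \<oplus>\<^bsub>A\<^esub> y \<in> carrier A" if "x \<in> carrier A" "y \<in> carrier A" for x y
    using that unfolding carrier_A by (auto simp: group_algebra_def)
  show zero_closed: "\<zero>\<^bsub>A\<^esub> \<in> carrier A" by (auto simp: carrier_A group_algebra_def)
  show "x \<oplus>\<^bsub>A\<^esub> y \<oplus>\<^bsub>A\<^esub> z = x \<oplus>\<^bsub>A\<^esub> (y \<oplus>\<^bsub>A\<^esub> z)"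
    if "x \<in> carrier A" "y \<in> carrier A" "z \<in> carrier A" for x y z
    using that by (intro A_eqI add_closed) (auto simp: A_add A_closed a_assoc)
  show "x \<oplus>\<^bsub>A\<^esub> y = y \<oplus>\<^bsub>A\<^esub> x" if "x \<in> carrier A" "y \<in> carrier A" for x y
    using that by (intro A_eqI add_closed) (auto simp: A_add A_closed a_comm)
  show "\<zero>\<^bsub>A\<^esub> \<oplus>\<^bsub>A\<^esub> x = x" if "x \<in> carrier A" for x
    using that by (intro A_eqI add_closed zero_closed) (auto simp: A_add A_zero A_closed)
  show "\<exists>y\<in>carrier A. y \<oplus>\<^bsub>A\<^esub> x = \<zero>\<^bsub>A\<^esub>" if x: "x \<in> carrier A" for x
  proof
    show c: "(\<lambda>g\<in>carrier G. \<ominus> x g) \<in> carrier A" using x by (auto simp: carrier_A)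
    show "(\<lambda>g\<in>carrier G. \<ominus> x g) \<oplus>\<^bsub>A\<^esub> x = \<zero>\<^bsub>A\<^esub>"
      using x by (intro A_eqI add_closed zero_closed c) (auto simp: A_add A_zero A_closed l_neg)
  qed
  show one_closed: "\<one>\<^bsub>A\<^esub> \<in> carrier A" unfolding A_one by (rule single_closed) simp
  show "x \<otimes>\<^bsub>A\<^esub> y \<in> carrier A" if "x \<in> carrier A" "y \<in> carrier A" for x y
    using that by (rule A_mult_closed)
  show "x \<otimes>\<^bsub>A\<^esub> y \<otimes>\<^bsub>A\<^esub> z = x \<otimes>\<^bsub>A\<^esub> (y \<otimes>\<^bsub>A\<^esub> z)"
    if "x \<in> carrier A" "y \<in> carrier A" "z \<in> carrier A" for x y z
    using that by (rule A_mult_assoc)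
  show "x \<otimes>\<^bsub>A\<^esub> y = y \<otimes>\<^bsub>A\<^esub> x" if "x \<in> carrier A" "y \<in> carrier A" for x y
    using that by (rule A_mult_comm)
  show "\<one>\<^bsub>A\<^esub> \<otimes>\<^bsub>A\<^esub> x = x" if x: "x \<in> carrier A" for x
    using x by (intro A_eqI A_mult_closed one_closed) (auto simp: A_one single_mult_apply A_closed)
  show "(x \<oplus>\<^bsub>A\<^esub> y) \<otimes>\<^bsub>A\<^esub> z = x \<otimes>\<^bsub>A\<^esub> z \<oplus>\<^bsub>A\<^esub> y \<otimes>\<^bsub>A\<^esub> z"
    if x: "x \<in> carrier A" and y: "y \<in> carrier A" and z: "z \<in> carrier A" for x y z
  proof (intro A_eqI add_closed A_mult_closed x y z)
    fix g assume g: "g \<in> carrier G"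
    note xc = A_closed[OF x] and yc = A_closed[OF y] and zc = A_closed[OF z]
    have "((x \<oplus>\<^bsub>A\<^esub> y) \<otimes>\<^bsub>A\<^esub> z) g =
        (\<Oplus>h\<in>carrier G. x h \<otimes> z (inv\<^bsub>G\<^esub> h \<otimes>\<^bsub>G\<^esub> g) \<oplus> y h \<otimes> z (inv\<^bsub>G\<^esub> h \<otimes>\<^bsub>G\<^esub> g))"
      unfolding A_mult[OF add_closed[OF x y] z g]
      using g xc yc zc by (intro finsum_cong') (auto simp: A_add l_distr)
    also have "\<dots> = (x \<otimes>\<^bsub>A\<^esub> z \<oplus>\<^bsub>A\<^esub> y \<otimes>\<^bsub>A\<^esub> z) g"
      unfolding A_add[OF g] A_mult[OF x z g] A_mult[OF y z g]
      using g xc yc zc by (intro finsum_addf) auto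
    finally show "((x \<oplus>\<^bsub>A\<^esub> y) \<otimes>\<^bsub>A\<^esub> z) g = (x \<otimes>\<^bsub>A\<^esub> z \<oplus>\<^bsub>A\<^esub> y \<otimes>\<^bsub>A\<^esub> z) g" .
  qed
qed

sublocale A: cring A by (rule cring_A)

lemma single_mult:
  assumes "a \<in> carrier R" "b \<in> carrier R" "g \<in> carrier G" "h \<in> carrier G"
  shows "single a g \<otimes>\<^bsub>A\<^esub> single b h = single (a \<otimes> b) (g \<otimes>\<^bsub>G\<^esub> h)"
proof (rule A_eqI)
  fix k assume k: "k \<in> carrier G"
  have "inv\<^bsub>G\<^esub> g \<otimes>\<^bsub>G\<^esub> k = h \<longleftrightarrow> k = g \<otimes>\<^bsub>G\<^esub> h"
    using assms k by (metis G.inv_solve_left G.inv_closed G.m_closed)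
  thus "(single a g \<otimes>\<^bsub>A\<^esub> single b h) k = single (a \<otimes> b) (g \<otimes>\<^bsub>G\<^esub> h) k"
    using assms k by (simp add: single_mult_apply single_closed) (auto simp: single_def)
qed (use assms in \<open>auto intro!: single_closed\<close>)

lemma single_pow:
  assumes "a \<in> carrier R" "g \<in> carrier G"
  shows "single a g [^]\<^bsub>A\<^esub> (n::nat) = single (a [^] n) (g [^]\<^bsub>G\<^esub> n)"
  by (induction n) (use assms in \<open>auto simp: A_one single_mult\<close>)

lemma single_zero: "single \<zero> g = \<zero>\<^bsub>A\<^esub>"
  by (auto simp: single_def group_algebra_def)

text \<open>The structure map of the algebra, needed to apply \<open>reduced_algebra_units\<close>
  and to embed the scalar units.\<close>

lemma single_ring_hom: "(\<lambda>a. single a \<one>\<^bsub>G\<^esub>) \<in> ring_hom R A"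
  by (intro ring_hom_memI)
    (auto simp: single_closed single_mult A_one intro!: A_eqI, auto simp: A_add single_def)

lemma finsum_A_apply:
  assumes "finite I" "f \<in> I \<rightarrow> carrier A" "g \<in> carrier G"
  shows "(\<Oplus>\<^bsub>A\<^esub>i\<in>I. f i) g = (\<Oplus>i\<in>I. f i g)"
  using assms(1,2)
proof (induction I rule: finite_induct)
  case empty
  then show ?case using assms(3) by (simp add: A_zero)
next
  case (insert i I)
  hence "(\<Oplus>\<^bsub>A\<^esub>i\<in>insert i I. f i) g = f i g \<oplus> (\<Oplus>\<^bsub>A\<^esub>i\<in>I. f i) g"
    using assms(3) by (subst A.finsum_insert) (auto simp: A_add)
  also have "\<dots> = (\<Oplus>i\<in>insert i I. f i g)"
    using insert assms(3) by (subst finsum_insert) (auto intro: A_closed)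
  finally show ?case .
qed

lemma A_expand:
  assumes x: "x \<in> carrier A" and S: "S \<subseteq> carrier G" and supp: "\<And>g. g \<in> carrier G - S \<Longrightarrow> x g = \<zero>"
  shows "x = (\<Oplus>\<^bsub>A\<^esub>g\<in>S. single (x g) g)"
proof (rule A_eqI[OF x])
  have finS: "finite S" using S finite_G by (rule finite_subset)
  have xc: "single (x g) g \<in> carrier A" if "g \<in> S" for g
    using that S x by (auto intro!: single_closed A_closed)
  show "(\<Oplus>\<^bsub>A\<^esub>g\<in>S. single (x g) g) \<in> carrier A" using xc by (intro A.finsum_closed) auto
  fix h assume h: "h \<in> carrier G"
  have "(\<Oplus>\<^bsub>A\<^esub>g\<in>S. single (x g) g) h = (\<Oplus>g\<in>S. single (x g) g h)"
    using finS xc h by (intro finsum_A_apply) auto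
  also have "\<dots> = (\<Oplus>g\<in>S. if h = g then x g else \<zero>)"
    using h S A_closed[OF x] by (intro finsum_cong') (auto simp: single_def)
  also have "\<dots> = x h"
  proof (cases "h \<in> S")
    case True
    thus ?thesis using finS S A_closed[OF x] by (intro finsum_singleton) auto
  next
    case False
    hence "(\<Oplus>g\<in>S. if h = g then x g else \<zero>) = (\<Oplus>g\<in>S. \<zero>)"
      by (intro finsum_cong') auto
    thus ?thesis using False supp h by simp
  qed
  finally show "x h = (\<Oplus>\<^bsub>A\<^esub>g\<in>S. single (x g) g) h" by simp
qed

lemma A_char:
  assumes "add_pow R (p::nat) \<one> = \<zero>"
  shows "add_pow A p \<one>\<^bsub>A\<^esub> = \<zero>\<^bsub>A\<^esub>"
proof -
  have "add_pow A n \<one>\<^bsub>A\<^esub> = single (add_pow R n \<one>) \<one>\<^bsub>G\<^esub>" for n :: nat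
  proof (induction n)
    case 0
    then show ?case by (simp add: single_zero)
  next
    case (Suc n)
    have "single (add_pow R n \<one>) \<one>\<^bsub>G\<^esub> \<oplus>\<^bsub>A\<^esub> single \<one> \<one>\<^bsub>G\<^esub> = single (add_pow R (Suc n) \<one>) \<one>\<^bsub>G\<^esub>"
      using ring_hom_add[OF single_ring_hom, of "add_pow R n \<one>" \<one>] by simp
    thus ?case using Suc by (simp add: A_one[symmetric])
  qed
  thus ?thesis using assms by (simp add: single_zero)
qed

section \<open>Powers with exponent p^k in the group algebra\<close>

context
  fixes p k :: nat
  assumes p: "Factorial_Ring.prime p" and char: "add_pow R p \<one> = \<zero>"
begin

text \<open>The power map is additive in characteristic \<open>p\<close>, so it may be applied to
  each monomial of an expansion separately.\<close>

lemma A_frobenius: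
  assumes x: "x \<in> carrier A" and S: "S \<subseteq> carrier G" and supp: "\<And>g. g \<in> carrier G - S \<Longrightarrow> x g = \<zero>"
  shows "x [^]\<^bsub>A\<^esub> (p ^ k) = (\<Oplus>\<^bsub>A\<^esub>g\<in>S. single (x g [^] (p ^ k)) (g [^]\<^bsub>G\<^esub> (p ^ k)))"
proof -
  have xc: "single (x g) g \<in> carrier A" if "g \<in> S" for g
    using that S x by (auto intro!: single_closed A_closed)
  have "x [^]\<^bsub>A\<^esub> (p ^ k) = (\<Oplus>\<^bsub>A\<^esub>g\<in>S. single (x g) g) [^]\<^bsub>A\<^esub> (p ^ k)"
    by (rule arg_cong[where f = "\<lambda>z. z [^]\<^bsub>A\<^esub> (p ^ k)", OF A_expand[OF assms]])
  also have "\<dots> = (\<Oplus>\<^bsub>A\<^esub>g\<in>S. single (x g) g [^]\<^bsub>A\<^esub> (p ^ k))"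
    using S finite_G xc by (intro A.frobenius_finsum[OF p A_char[OF char]]) (auto intro: finite_subset)
  also have "\<dots> = (\<Oplus>\<^bsub>A\<^esub>g\<in>S. single (x g [^] (p ^ k)) (g [^]\<^bsub>G\<^esub> (p ^ k)))"
    using S A_closed[OF x] by (intro A.finsum_cong') (auto simp: single_pow intro!: single_closed)
  finally show ?thesis .
qed

lemma A_frobenius_apply:
  assumes x: "x \<in> carrier A" and h: "h \<in> carrier G"
  shows "(x [^]\<^bsub>A\<^esub> (p ^ k)) h =
    (\<Oplus>g\<in>carrier G. if h = g [^]\<^bsub>G\<^esub> (p ^ k) then x g [^] (p ^ k) else \<zero>)"
proof -
  have "(x [^]\<^bsub>A\<^esub> (p ^ k)) h = (\<Oplus>g\<in>carrier G. single (x g [^] (p ^ k)) (g [^]\<^bsub>G\<^esub> (p ^ k)) h)"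
    unfolding A_frobenius[OF x order_refl, simplified]
    using finite_G A_closed[OF x] h by (intro finsum_A_apply) (auto intro!: single_closed)
  also have "\<dots> = (\<Oplus>g\<in>carrier G. if h = g [^]\<^bsub>G\<^esub> (p ^ k) then x g [^] (p ^ k) else \<zero>)"
    using A_closed[OF x] h by (intro finsum_cong') (auto simp: single_def)
  finally show ?thesis .
qed

text \<open>When taking powers is injective on \<open>G\<close>, a single term of
  \<open>A_frobenius_apply\<close> survives: coefficients are raised to the power and moved along
  \<open>G\<close>, never added together.\<close>

lemma A_frobenius_inj:
  assumes x: "x \<in> carrier A" and g: "g \<in> carrier G"
    and inj: "inj_on (\<lambda>g. g [^]\<^bsub>G\<^esub> (p ^ k)) (carrier G)"
  shows "(x [^]\<^bsub>A\<^esub> (p ^ k)) (g [^]\<^bsub>G\<^esub> (p ^ k)) = x g [^] (p ^ k)"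
proof -
  have "(x [^]\<^bsub>A\<^esub> (p ^ k)) (g [^]\<^bsub>G\<^esub> (p ^ k)) =
      (\<Oplus>h\<in>carrier G. if g [^]\<^bsub>G\<^esub> (p ^ k) = h [^]\<^bsub>G\<^esub> (p ^ k) then x h [^] (p ^ k) else \<zero>)"
    using g by (intro A_frobenius_apply[OF x]) auto
  also have "\<dots> = (\<Oplus>h\<in>carrier G. if g = h then x h [^] (p ^ k) else \<zero>)"
    using inj g A_closed[OF x] by (intro finsum_cong') (auto dest: inj_onD)
  also have "\<dots> = x g [^] (p ^ k)"
    using g A_closed[OF x] finite_G by (intro finsum_singleton) auto
  finally show ?thesis .
qed

lemma A_frobenius_fixed_iff:
  assumes x: "x \<in> carrier A" and fixR: "\<And>a. a \<in> carrier R \<Longrightarrow> a [^] (p ^ k) = a"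
    and inj: "inj_on (\<lambda>g. g [^]\<^bsub>G\<^esub> (p ^ k)) (carrier G)"
  shows "x [^]\<^bsub>A\<^esub> (p ^ k) = x \<longleftrightarrow> (\<forall>g\<in>carrier G. x (g [^]\<^bsub>G\<^esub> (p ^ k)) = x g)"
proof
  assume "x [^]\<^bsub>A\<^esub> (p ^ k) = x"
  thus "\<forall>g\<in>carrier G. x (g [^]\<^bsub>G\<^esub> (p ^ k)) = x g"
    using A_frobenius_inj[OF x _ inj] fixR A_closed[OF x] by simp
next
  assume inv: "\<forall>g\<in>carrier G. x (g [^]\<^bsub>G\<^esub> (p ^ k)) = x g"
  \<comment> \<open>\<open>A_frobenius_inj\<close> describes coefficients only at powers. On a
    finite group injectivity makes every element a power, so all coefficients are covered.\<close>
  have "(\<lambda>g. g [^]\<^bsub>G\<^esub> (p ^ k)) ` carrier G = carrier G"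
    using finite_G inj by (intro endo_inj_surj) auto
  hence surj: "\<exists>g\<in>carrier G. h = g [^]\<^bsub>G\<^esub> (p ^ k)" if "h \<in> carrier G" for h
    using that by blast
  show "x [^]\<^bsub>A\<^esub> (p ^ k) = x"
  proof (rule A_eqI)
    fix h assume "h \<in> carrier G"
    then obtain g where "g \<in> carrier G" "h = g [^]\<^bsub>G\<^esub> (p ^ k)" using surj by blast
    thus "(x [^]\<^bsub>A\<^esub> (p ^ k)) h = x h"
      using A_frobenius_inj[OF x _ inj] fixR A_closed[OF x] inv by simp
  qed (use x in auto)
qed

text \<open>Outside the powers in \<open>G\<close> the coefficient sum has only zero terms.
  Conversely, a preimage is assembled from one root in \<open>G\<close> and one root in
  \<open>R\<close> for each element of the support.\<close>

lemma A_frobenius_image: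
  assumes perfect: "(\<lambda>a. a [^] (p ^ k)) ` carrier R = carrier R"
  shows "(\<lambda>x. x [^]\<^bsub>A\<^esub> (p ^ k)) ` carrier A =
    {x \<in> carrier A. \<forall>g \<in> carrier G - (\<lambda>g. g [^]\<^bsub>G\<^esub> (p ^ k)) ` carrier G. x g = \<zero>}"
proof (intro equalityI subsetI)
  fix y assume "y \<in> (\<lambda>x. x [^]\<^bsub>A\<^esub> (p ^ k)) ` carrier A"
  then obtain x where x: "x \<in> carrier A" "y = x [^]\<^bsub>A\<^esub> (p ^ k)" by blast
  have "y h = \<zero>" if "h \<in> carrier G - (\<lambda>g. g [^]\<^bsub>G\<^esub> (p ^ k)) ` carrier G" for h
  proof -
    have "y h = (\<Oplus>g\<in>carrier G. \<zero>)"
      unfolding x(2) A_frobenius_apply[OF x(1) DiffD1[OF that]]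
      by (intro finsum_cong') (use that in auto)
    thus ?thesis by simp
  qed
  thus "y \<in> {x \<in> carrier A. \<forall>g \<in> carrier G - (\<lambda>g. g [^]\<^bsub>G\<^esub> (p ^ k)) ` carrier G. x g = \<zero>}"
    using x by auto
next
  define S where "S = (\<lambda>g. g [^]\<^bsub>G\<^esub> (p ^ k)) ` carrier G"
  define s where "s = inv_into (carrier G) (\<lambda>g. g [^]\<^bsub>G\<^esub> (p ^ k))"
  define r where "r = inv_into (carrier R) (\<lambda>a. a [^] (p ^ k))"
  fix y assume "y \<in> {x \<in> carrier A. \<forall>g \<in> carrier G - (\<lambda>g. g [^]\<^bsub>G\<^esub> (p ^ k)) ` carrier G. x g = \<zero>}"
  hence y: "y \<in> carrier A" and supp: "\<And>g. g \<in> carrier G - S \<Longrightarrow> y g = \<zero>" by (auto simp: S_def)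
  have SG: "S \<subseteq> carrier G" by (auto simp: S_def)
  have s: "s h \<in> carrier G" "s h [^]\<^bsub>G\<^esub> (p ^ k) = h" if "h \<in> S" for h
    using that unfolding S_def s_def by (auto intro: inv_into_into f_inv_into_f)
  have r: "r a \<in> carrier R" "r a [^] (p ^ k) = a" if "a \<in> carrier R" for a
    using that perfect unfolding r_def by (metis inv_into_into, metis f_inv_into_f)
  have c: "single (r (y h)) (s h) \<in> carrier A" if "h \<in> S" for h
    using that SG A_closed[OF y] r by (intro single_closed) auto
  have "(\<Oplus>\<^bsub>A\<^esub>h\<in>S. single (r (y h)) (s h)) [^]\<^bsub>A\<^esub> (p ^ k) = (\<Oplus>\<^bsub>A\<^esub>h\<in>S. single (r (y h)) (s h) [^]\<^bsub>A\<^esub> (p ^ k))"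
    using SG finite_G c by (intro A.frobenius_finsum[OF p A_char[OF char]]) (auto intro: finite_subset)
  also have "\<dots> = (\<Oplus>\<^bsub>A\<^esub>h\<in>S. single (y h) h)"
    using SG A_closed[OF y] r s by (intro A.finsum_cong') (auto simp: single_pow subsetD intro!: single_closed)
  also have "\<dots> = y" by (rule A_expand[OF y SG supp, symmetric])
  finally show "y \<in> (\<lambda>x. x [^]\<^bsub>A\<^esub> (p ^ k)) ` carrier A"
    using c by (intro image_eqI[of _ _ "\<Oplus>\<^bsub>A\<^esub>h\<in>S. single (r (y h)) (s h)"]) (auto intro!: A.finsum_closed)
qed

end

end

section \<open>Unit groups over a finite field: modular and semisimple case\<close>

locale finite_group_algebra_over_finite_field = finite_group_algebra R G + field R
  for R (structure) and G (structure) +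
  fixes p n :: nat
  assumes prime_p: "Factorial_Ring.prime p" and char_p: "add_pow R p \<one> = \<zero>"
    and finite_R: "finite (carrier R)" and card_R: "card (carrier R) = p ^ n" and n_pos: "n > 0"
begin

lemma p_gt_1: "p > 1" using prime_p by (rule prime_gt_1_nat)

lemma finite_A: "finite (carrier A)"
  unfolding carrier_A using finite_G finite_R by (intro finite_PiE) auto

lemma card_A_support:
  assumes "S \<subseteq> carrier G"
  shows "card {x \<in> carrier A. \<forall>g\<in>carrier G - S. x g = \<zero>} = (p ^ n) ^ card S"
proof -
  have "{x \<in> carrier A. \<forall>g\<in>carrier G - S. x g = \<zero>} =
      (\<Pi>\<^sub>E g\<in>carrier G. if g \<in> S then carrier R else {\<zero>})"
  proof (rule Set.set_eqI)
    fix x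
    have "x g \<in> (if g \<in> S then carrier R else {\<zero>}) \<longleftrightarrow> x g \<in> carrier R \<and> (g \<notin> S \<longrightarrow> x g = \<zero>)" for g
      by auto
    thus "x \<in> {x \<in> carrier A. \<forall>g\<in>carrier G - S. x g = \<zero>} \<longleftrightarrow>
        x \<in> (\<Pi>\<^sub>E g\<in>carrier G. if g \<in> S then carrier R else {\<zero>})"
      unfolding carrier_A by (simp only: PiE_iff mem_Collect_eq) blast
  qed
  hence "card {x \<in> carrier A. \<forall>g\<in>carrier G - S. x g = \<zero>} =
      (\<Prod>g\<in>carrier G. if g \<in> S then p ^ n else 1)"
    using finite_G by (simp add: card_PiE card_R if_distrib[of carrier] if_distrib[of card] cong: if_cong)
  also have "\<dots> = (\<Prod>g\<in>carrier G \<inter> S. p ^ n)"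
    by (rule prod.inter_restrict[OF finite_G, symmetric])
  finally show ?thesis using assms by (simp add: Int_absorb1)
qed

text \<open>The power map is additive, so its nonempty fibres have equal size, and the solution set
  is the fibre over one. Counting the algebra by fibres and the image by
  \<open>A_frobenius_image\<close> gives the identity.\<close>

lemma card_unipotent:
  shows "card {x \<in> carrier A. x [^]\<^bsub>A\<^esub> (p ^ k) = \<one>\<^bsub>A\<^esub>} *
    (p ^ n) ^ card ((\<lambda>g. g [^]\<^bsub>G\<^esub> (p ^ k)) ` carrier G) = (p ^ n) ^ card (carrier G)"
proof -
  let ?\<phi> = "\<lambda>x. x [^]\<^bsub>A\<^esub> (p ^ k)"
  let ?K = "{x \<in> carrier A. ?\<phi> x = \<one>\<^bsub>A\<^esub>}"
  have add: "?\<phi> (x \<oplus>\<^bsub>A\<^esub> y) = ?\<phi> x \<oplus>\<^bsub>A\<^esub> ?\<phi> y" if "x \<in> carrier A" "y \<in> carrier A" for x y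
    using that by (rule A.frobenius_power[OF prime_p A_char[OF char_p]])
  have fibre: "card {x \<in> carrier A. ?\<phi> x = y} = card ?K" if "y \<in> ?\<phi> ` carrier A" for y
  proof -
    from that obtain x0 where x0: "x0 \<in> carrier A" "?\<phi> x0 = y" by auto
    \<comment> \<open>The power map sends \<open>c\<close> to \<open>y\<close> minus one, so
      translation by \<open>c\<close> carries the fibre over one to the fibre over
      \<open>y\<close>.\<close>
    define c where "c = x0 \<ominus>\<^bsub>A\<^esub> \<one>\<^bsub>A\<^esub>"
    have c: "c \<in> carrier A" "x0 = \<one>\<^bsub>A\<^esub> \<oplus>\<^bsub>A\<^esub> c"
      using x0 by (auto simp: c_def a_minus_def A.a_lcomm[of "\<one>\<^bsub>A\<^esub>"] A.r_neg)
    have y: "y = \<one>\<^bsub>A\<^esub> \<oplus>\<^bsub>A\<^esub> ?\<phi> c" using x0 c add[of "\<one>\<^bsub>A\<^esub>" c] by simp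
    have "bij_betw (\<lambda>x. x \<oplus>\<^bsub>A\<^esub> c) ?K {x \<in> carrier A. ?\<phi> x = y}"
    proof (rule bij_betwI[where g = "\<lambda>x. x \<ominus>\<^bsub>A\<^esub> c"])
      show "(\<lambda>x. x \<oplus>\<^bsub>A\<^esub> c) \<in> ?K \<rightarrow> {x \<in> carrier A. ?\<phi> x = y}"
        using c by (auto simp: add y)
      show "(\<lambda>x. x \<ominus>\<^bsub>A\<^esub> c) \<in> {x \<in> carrier A. ?\<phi> x = y} \<rightarrow> ?K"
      proof
        fix x assume x: "x \<in> {x \<in> carrier A. ?\<phi> x = y}"
        hence "?\<phi> (x \<ominus>\<^bsub>A\<^esub> c) \<oplus>\<^bsub>A\<^esub> ?\<phi> c = ?\<phi> (x \<ominus>\<^bsub>A\<^esub> c \<oplus>\<^bsub>A\<^esub> c)"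
          using c by (intro add[symmetric]) auto
        also have "\<dots> = \<one>\<^bsub>A\<^esub> \<oplus>\<^bsub>A\<^esub> ?\<phi> c"
          using x c by (simp add: a_minus_def A.a_assoc A.l_neg y)
        finally show "x \<ominus>\<^bsub>A\<^esub> c \<in> ?K" using x c by simp
      qed
    qed (use c in \<open>auto simp: a_minus_def A.a_assoc A.l_neg A.r_neg\<close>)
    thus ?thesis by (simp add: bij_betw_same_card)
  qed
  have "card (carrier A) = (\<Sum>y\<in>?\<phi> ` carrier A. card {x \<in> carrier A. ?\<phi> x = y})"
    using sum.image_gen[OF finite_A, of "\<lambda>_. 1::nat" ?\<phi>] by simp
  also have "\<dots> = (\<Sum>y\<in>?\<phi> ` carrier A. card ?K)"
    by (intro sum.cong refl fibre)
  finally have "card ?K * card (?\<phi> ` carrier A) = card (carrier A)" by simp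
  moreover have "card (carrier A) = (p ^ n) ^ card (carrier G)"
    using card_A_support[of "carrier G"] by simp
  moreover have "card (?\<phi> ` carrier A) = (p ^ n) ^ card ((\<lambda>g. g [^]\<^bsub>G\<^esub> (p ^ k)) ` carrier G)"
    unfolding A_frobenius_image[OF prime_p char_p frobenius_surj[OF finite_R card_R n_pos]]
    by (rule card_A_support) auto
  ultimately show ?thesis by simp
qed

text \<open>The last conjunct compares two counts of the solutions of x^(p^i) = 1. In a product of
  cyclic p-groups each factor contributes \<open>p ^ min i e\<close>, while
  \<open>card_unipotent\<close> reads the same number off \<open>G\<close>. Equating exponents of
  \<open>p\<close> leaves linear equations in the multiplicities.\<close>

theorem modular_units:
  assumes exp: "\<And>g. g \<in> carrier G \<Longrightarrow> g [^]\<^bsub>G\<^esub> (p ^ k) = \<one>\<^bsub>G\<^esub>"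
  shows "\<exists>es. set es \<subseteq> {1..k} \<and>
    units_of A \<cong> cyclic_product (map (\<lambda>e. p ^ e) es) \<times>\<times> integer_mod_group (p ^ n - 1) \<and>
    (\<forall>i\<le>k. (\<Sum>e\<leftarrow>es. min i e) + n * card ((\<lambda>g. g [^]\<^bsub>G\<^esub> (p ^ i)) ` carrier G) = n * card (carrier G))"
proof -
  interpret U: comm_group "units_of A" by (rule A.units_comm_group)
  define \<iota> where "\<iota> = (\<lambda>a. single a \<one>\<^bsub>G\<^esub>)"
  define V where "V = {x \<in> carrier A. x [^]\<^bsub>A\<^esub> (p ^ k) = \<one>\<^bsub>A\<^esub>}"
  define W where "W = \<iota> ` Units R"
  interpret \<iota>: ring_hom_cring R A \<iota>
    using single_ring_hom unfolding \<iota>_def by unfold_locales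
  have pk: "p ^ k > 0" using p_gt_1 by simp
  have scalar: "x = \<iota> (x \<one>\<^bsub>G\<^esub>)" if "x \<in> carrier A" "\<forall>g\<in>carrier G - {\<one>\<^bsub>G\<^esub>}. x g = \<zero>" for x
    using that unfolding \<iota>_def by (intro A_eqI single_closed A_closed) (auto simp: single_def)
  have \<iota>_inj: "a = b" if "\<iota> a = \<iota> b" for a b
    using fun_cong[OF that, of "\<one>\<^bsub>G\<^esub>"] by (simp add: \<iota>_def single_def)
  have V_unit: "V \<subseteq> Units A"
  proof
    fix x assume x: "x \<in> V"
    have "x \<otimes>\<^bsub>A\<^esub> x [^]\<^bsub>A\<^esub> (p ^ k - 1) = x [^]\<^bsub>A\<^esub> Suc (p ^ k - 1)"
      using x by (simp add: V_def A.m_comm)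
    also have "\<dots> = \<one>\<^bsub>A\<^esub>" using x pk by (simp add: V_def del: A.nat_pow_Suc)
    finally have "x \<otimes>\<^bsub>A\<^esub> x [^]\<^bsub>A\<^esub> (p ^ k - 1) \<in> Units A" by simp
    thus "x \<in> Units A" by (rule A.unit_factor) (use x in \<open>auto simp: V_def\<close>)
  qed
  have V_pow: "x [^]\<^bsub>units_of A\<^esub> (j::nat) = x [^]\<^bsub>A\<^esub> j" if "x \<in> Units A" for x j
    using that by (rule A.units_of_pow)
  have V: "subgroup V (units_of A)"
  proof (rule U.subgroupI)
    show "V \<subseteq> carrier (units_of A)" using V_unit by (simp add: units_of_carrier)
    have "\<one>\<^bsub>A\<^esub> \<in> V" by (simp add: V_def)
    thus "V \<noteq> {}" by blast
    show "x \<otimes>\<^bsub>units_of A\<^esub> y \<in> V" if "x \<in> V" "y \<in> V" for x y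
      using that by (simp add: V_def units_of_mult A.nat_pow_distrib)
    show "inv\<^bsub>units_of A\<^esub> x \<in> V" if x: "x \<in> V" for x
    proof -
      have xU: "x \<in> Units A" using x V_unit by blast
      hence xc: "x \<in> carrier (units_of A)" by (simp add: units_of_carrier)
      have "x [^]\<^bsub>units_of A\<^esub> (p ^ k) = \<one>\<^bsub>units_of A\<^esub>"
        unfolding V_pow[OF xU] using x by (simp add: V_def units_of_one)
      hence "inv\<^bsub>units_of A\<^esub> x [^]\<^bsub>units_of A\<^esub> (p ^ k) = \<one>\<^bsub>units_of A\<^esub>"
        unfolding U.nat_pow_inv[OF xc] by simp
      moreover have iU: "inv\<^bsub>units_of A\<^esub> x \<in> Units A"
        using U.inv_closed[OF xc] unfolding units_of_carrier .
      ultimately show ?thesis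
        using A.Units_closed[OF iU] unfolding V_pow[OF iU] V_def units_of_one by blast
    qed
  qed
  have \<iota>_Units: "\<iota> a \<in> Units A" if "a \<in> Units R" for a
  proof -
    have "\<iota> a \<otimes>\<^bsub>A\<^esub> \<iota> (inv a) = \<iota> (a \<otimes> inv a)"
      using that by (intro \<iota>.hom_mult[symmetric]) auto
    also have "\<dots> = \<one>\<^bsub>A\<^esub>" using that by simp
    finally have "\<iota> a \<otimes>\<^bsub>A\<^esub> \<iota> (inv a) \<in> Units A" by simp
    thus ?thesis by (rule A.unit_factor) (use that in auto)
  qed
  have \<iota>_hom: "\<iota> \<in> hom (units_of R) (units_of A)"
    by (rule homI) (auto simp: units_of_carrier units_of_mult \<iota>_Units Units_closed)
  interpret h: group_hom "units_of R" "units_of A" \<iota>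
    by (intro group_hom.intro group_hom_axioms.intro units_group A.units_group \<iota>_hom)
  have W: "subgroup W (units_of A)"
    using h.img_is_subgroup by (simp add: W_def units_of_carrier)
  have "\<iota> \<in> iso (units_of R) ((units_of A)\<lparr>carrier := W\<rparr>)"
    using \<iota>_hom \<iota>_inj by (auto simp: iso_def hom_def bij_betw_def inj_on_def W_def units_of_carrier)
  hence isoW: "integer_mod_group (p ^ n - 1) \<cong> (units_of A)\<lparr>carrier := W\<rparr>"
    using finite_units_cyclic[OF finite_R] card_R by (metis is_isoI iso_trans)
  \<comment> \<open>On scalars the power map is surjective on a finite set, hence injective, so one
    is the only scalar in \<open>V\<close>.\<close>
  have VW: "V \<inter> W = {\<one>\<^bsub>units_of A\<^esub>}"
  proof (intro equalityI subsetI)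
    fix x assume x: "x \<in> V \<inter> W"
    then obtain a where a: "a \<in> Units R" "x = \<iota> a" by (auto simp: W_def)
    have aR: "a \<in> carrier R" using a by auto
    have "\<iota> (a [^] (p ^ k)) = \<iota> \<one>"
      using x a aR by (simp add: V_def \<iota>.hom_pow)
    hence eq: "a [^] (p ^ k) = \<one> [^] (p ^ k)" using \<iota>_inj by simp
    have inj: "inj_on (\<lambda>a. a [^] (p ^ k)) (carrier R)"
      using frobenius_surj[OF finite_R card_R n_pos, of k] finite_R by (intro eq_card_imp_inj_on) auto
    have "a = \<one>" by (rule inj_onD[OF inj eq aR one_closed])
    thus "x \<in> {\<one>\<^bsub>units_of A\<^esub>}" using a by (simp add: units_of_one)
  next
    fix x assume "x \<in> {\<one>\<^bsub>units_of A\<^esub>}"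
    thus "x \<in> V \<inter> W" using subgroup.one_closed[OF V] subgroup.one_closed[OF W] by simp
  qed
  have gen: "\<exists>v\<in>V. \<exists>w\<in>W. u = v \<otimes>\<^bsub>units_of A\<^esub> w" if u: "u \<in> carrier (units_of A)" for u
  proof -
    have uU: "u \<in> Units A" using u by (simp add: units_of_carrier)
    have uA: "u \<in> carrier A" using uU by (rule A.Units_closed)
    \<comment> \<open>The \<open>p ^ k\<close>-th power of \<open>u\<close> is supported at the
      identity, so it is the scalar \<open>c\<close>. Dividing \<open>u\<close> by a
      \<open>p ^ k\<close>-th root \<open>d\<close> of \<open>c\<close> leaves an element of
      \<open>V\<close>.\<close>
    define c where "c = (u [^]\<^bsub>A\<^esub> (p ^ k)) \<one>\<^bsub>G\<^esub>"
    have "(\<lambda>g. g [^]\<^bsub>G\<^esub> (p ^ k)) ` carrier G = {\<one>\<^bsub>G\<^esub>}"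
      using exp by auto
    moreover have "u [^]\<^bsub>A\<^esub> (p ^ k) \<in> (\<lambda>x. x [^]\<^bsub>A\<^esub> (p ^ k)) ` carrier A" using uA by blast
    ultimately have uk: "u [^]\<^bsub>A\<^esub> (p ^ k) = \<iota> c"
      unfolding c_def A_frobenius_image[OF prime_p char_p frobenius_surj[OF finite_R card_R n_pos]]
      by (intro scalar) auto
    have c: "c \<in> carrier R" unfolding c_def using uA by (intro A_closed) auto
    have "c \<in> (\<lambda>a. a [^] (p ^ k)) ` carrier R"
      using c frobenius_surj[OF finite_R card_R n_pos, of k] by simp
    then obtain d where d: "d \<in> carrier R" "c = d [^] (p ^ k)" by blast
    have "\<zero>\<^bsub>A\<^esub> \<notin> Units A"
    proof
      assume z: "\<zero>\<^bsub>A\<^esub> \<in> Units A"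
      have "\<zero>\<^bsub>A\<^esub> = \<one>\<^bsub>A\<^esub>" using A.Units_r_inv[OF z] A.l_null[OF A.Units_inv_closed[OF z]] by simp
      hence "\<iota> \<zero> = \<iota> \<one>" by simp
      hence "\<zero> = \<one>" by (rule \<iota>_inj)
      thus False by simp
    qed
    moreover have "u [^]\<^bsub>A\<^esub> (p ^ k) \<in> Units A" using uU by (rule A.Units_pow_closed)
    ultimately have "c \<noteq> \<zero>" using uk by auto
    hence "d \<noteq> \<zero>" using d pk by (auto simp: nat_pow_zero)
    hence dU: "d \<in> Units R" using d by (simp add: field_Units)
    define v where "v = u \<otimes>\<^bsub>A\<^esub> \<iota> (inv d)"
    have inv_d: "\<iota> (inv d) \<otimes>\<^bsub>A\<^esub> \<iota> d = \<one>\<^bsub>A\<^esub>"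
      using dU d \<iota>.hom_mult[of "inv d" d] by simp
    have vA: "v \<in> carrier A" using uA dU by (simp add: v_def)
    have "v [^]\<^bsub>A\<^esub> (p ^ k) = \<iota> (d [^] (p ^ k)) \<otimes>\<^bsub>A\<^esub> \<iota> (inv d) [^]\<^bsub>A\<^esub> (p ^ k)"
      unfolding v_def using uA dU by (simp add: A.nat_pow_distrib uk d(2) del: \<iota>.hom_pow)
    also have "\<dots> = (\<iota> (inv d) \<otimes>\<^bsub>A\<^esub> \<iota> d) [^]\<^bsub>A\<^esub> (p ^ k)"
      using d dU by (simp add: \<iota>.hom_pow A.nat_pow_distrib A.m_comm)
    also have "\<dots> = \<one>\<^bsub>A\<^esub>" by (simp add: inv_d)
    finally have "v \<in> V" using vA by (simp add: V_def)
    moreover have "\<iota> d \<in> W" using dU by (simp add: W_def)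
    moreover have "u = v \<otimes>\<^bsub>A\<^esub> \<iota> d"
      unfolding v_def using uA dU d by (simp add: A.m_assoc inv_d)
    ultimately show ?thesis unfolding units_of_mult by blast
  qed
  have VW_iso: "(units_of A)\<lparr>carrier := V\<rparr> \<times>\<times> (units_of A)\<lparr>carrier := W\<rparr> \<cong> units_of A"
    by (rule U.DirProd_subgroups_iso[OF V W VW gen])
  let ?V = "(units_of A)\<lparr>carrier := V\<rparr>"
  have V_sub_pow: "x [^]\<^bsub>?V\<^esub> (j::nat) = x [^]\<^bsub>A\<^esub> j" if "x \<in> V" for x j
    using that V_unit V_pow by (metis U.nat_pow_consistent subsetD)
  have V_group: "comm_group ?V"
    using V U.m_comm subgroup.mem_carrier[OF V]
    by (intro group.group_comm_groupI U.subgroup_imp_group) auto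
  have "finite V" using finite_A by (simp add: V_def)
  have "\<exists>es. set es \<subseteq> {1..k} \<and> cyclic_product (map (\<lambda>e. p ^ e) es) \<cong> ?V"
  proof (rule comm_p_group_iso_cyclic_product[OF V_group _ prime_p])
    show "x [^]\<^bsub>?V\<^esub> (p ^ k) = \<one>\<^bsub>?V\<^esub>" if "x \<in> carrier ?V" for x
      using that V_sub_pow by (simp add: V_def units_of_one)
  qed (use \<open>finite V\<close> in simp)
  then obtain es where es: "set es \<subseteq> {1..k}" and isoV: "cyclic_product (map (\<lambda>e. p ^ e) es) \<cong> ?V"
    by blast
  have "cyclic_product (map (\<lambda>e. p ^ e) es) \<times>\<times> integer_mod_group (p ^ n - 1) \<cong> units_of A"
    using group.DirProd_iso_trans[OF group_cyclic_product isoV isoW] VW_iso by (rule iso_trans)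
  hence iso: "units_of A \<cong> cyclic_product (map (\<lambda>e. p ^ e) es) \<times>\<times> integer_mod_group (p ^ n - 1)"
    by (rule group.iso_sym[OF DirProd_group[OF group_cyclic_product group_integer_mod_group]])
  have "(\<Sum>e\<leftarrow>es. min i e) + n * card ((\<lambda>g. g [^]\<^bsub>G\<^esub> (p ^ i)) ` carrier G) = n * card (carrier G)"
    if i: "i \<le> k" for i
  proof -
    \<comment> \<open>Since \<open>i \<le> k\<close>, every solution in the whole algebra already
      lies in \<open>V\<close>, so \<open>card_unipotent\<close> counts the torsion of
      \<open>V\<close>.\<close>
    have "torsion ?V (p ^ i) = {x \<in> carrier A. x [^]\<^bsub>A\<^esub> (p ^ i) = \<one>\<^bsub>A\<^esub>}"
    proof (intro equalityI subsetI)
      fix x assume x: "x \<in> {x \<in> carrier A. x [^]\<^bsub>A\<^esub> (p ^ i) = \<one>\<^bsub>A\<^esub>}"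
      hence xA: "x \<in> carrier A" by simp
      have "p ^ k = p ^ i * p ^ (k - i)" using i by (simp add: power_add[symmetric])
      hence "x [^]\<^bsub>A\<^esub> (p ^ k) = (x [^]\<^bsub>A\<^esub> (p ^ i)) [^]\<^bsub>A\<^esub> (p ^ (k - i))"
        by (simp only: A.nat_pow_pow[OF xA])
      hence "x \<in> V" using x by (simp add: V_def)
      thus "x \<in> torsion ?V (p ^ i)" using x V_sub_pow by (simp add: torsion_def units_of_one)
    next
      fix x assume "x \<in> torsion ?V (p ^ i)"
      hence "x \<in> V" "x [^]\<^bsub>?V\<^esub> (p ^ i) = \<one>\<^bsub>A\<^esub>" by (auto simp: torsion_def units_of_one)
      thus "x \<in> {x \<in> carrier A. x [^]\<^bsub>A\<^esub> (p ^ i) = \<one>\<^bsub>A\<^esub>}"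
        using V_sub_pow[of x] by (simp add: V_def)
    qed
    moreover have "card (torsion ?V (p ^ i)) = (\<Prod>m\<leftarrow>map (\<lambda>e. p ^ e) es. gcd (p ^ i) m)"
      using card_torsion_iso[OF group_cyclic_product comm_group.axioms(2)[OF V_group] isoV] p_gt_1
      by (subst card_torsion_cyclic_product[symmetric]) auto
    moreover have "(\<Prod>m\<leftarrow>map (\<lambda>e. p ^ e) es. gcd (p ^ i) m) = p ^ (\<Sum>e\<leftarrow>es. min i e)"
    proof (induction es)
      case (Cons e es)
      have "gcd (p ^ i) (p ^ e) = p ^ min i e"
        by (cases "i \<le> e") (simp_all add: min_def le_imp_power_dvd gcd_nat.absorb1 gcd_nat.absorb2)
      thus ?case using Cons by (simp add: power_add)
    qed simp
    ultimately have "p ^ (\<Sum>e\<leftarrow>es. min i e) *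
        (p ^ n) ^ card ((\<lambda>g. g [^]\<^bsub>G\<^esub> (p ^ i)) ` carrier G) = (p ^ n) ^ card (carrier G)"
      using card_unipotent[of i] by simp
    hence "p ^ ((\<Sum>e\<leftarrow>es. min i e) + n * card ((\<lambda>g. g [^]\<^bsub>G\<^esub> (p ^ i)) ` carrier G)) = p ^ (n * card (carrier G))"
      by (simp add: power_add power_mult)
    thus ?thesis using p_gt_1 power_inject_exp by blast
  qed
  thus ?thesis using es iso by blast
qed

text \<open>Translating fixed points of power maps into invariant coefficient functions leaves
  conditions on \<open>ds\<close> that no longer mention multiplication in the algebra, only the
  action of powers on \<open>G\<close> and the size of the field.\<close>

theorem semisimple_units:
  assumes "N > 0" and exp: "\<And>g. g \<in> carrier G \<Longrightarrow> g [^]\<^bsub>G\<^esub> ((p ^ n) ^ N) = g"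
  shows "\<exists>ds. (\<forall>d\<in>set ds. d dvd N) \<and>
    units_of A \<cong> cyclic_product (map (\<lambda>d. (p ^ n) ^ d - 1) ds) \<and>
    (\<forall>e>0. (p ^ n) ^ (\<Sum>d\<leftarrow>ds. gcd d e) =
      card {f \<in> carrier G \<rightarrow>\<^sub>E carrier R. \<forall>g\<in>carrier G. f (g [^]\<^bsub>G\<^esub> ((p ^ n) ^ e)) = f g})"
proof -
  have expe: "g [^]\<^bsub>G\<^esub> ((p ^ n) ^ (N * e)) = g" if "g \<in> carrier G" for g e
  proof (induction e)
    case (Suc e)
    have "g [^]\<^bsub>G\<^esub> ((p ^ n) ^ (N * Suc e)) = (g [^]\<^bsub>G\<^esub> ((p ^ n) ^ (N * e))) [^]\<^bsub>G\<^esub> ((p ^ n) ^ N)"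
      using that by (simp add: G.nat_pow_pow power_add mult.commute)
    thus ?case using Suc exp that by simp
  qed (use that in simp)
  have inj: "inj_on (\<lambda>g. g [^]\<^bsub>G\<^esub> (p ^ (n * e))) (carrier G)" for e
  proof (rule inj_on_inverseI)
    fix g assume g: "g \<in> carrier G"
    \<comment> \<open>The inverse of the power map is again a power map: the two exponents multiply
      to \<open>(p ^ n) ^ (N * e)\<close>, which acts trivially on \<open>G\<close>. Positivity of
      \<open>N\<close> makes the truncated subtraction exact.\<close>
    have "(p ^ n) ^ (N * e) = p ^ (n * e) * (p ^ n) ^ (N * e - e)"
    proof -
      have "n * (N * e) = n * e + n * (N * e - e)"
        using assms(1) by (simp add: add_mult_distrib2[symmetric])
      thus ?thesis by (simp add: power_mult[symmetric] power_add[symmetric])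
    qed
    thus "(g [^]\<^bsub>G\<^esub> (p ^ (n * e))) [^]\<^bsub>G\<^esub> ((p ^ n) ^ (N * e - e)) = g"
      using expe[OF g, of e] g by (simp add: G.nat_pow_pow)
  qed
  have fixed_iff: "x [^]\<^bsub>A\<^esub> ((p ^ n) ^ e) = x \<longleftrightarrow> (\<forall>g\<in>carrier G. x (g [^]\<^bsub>G\<^esub> ((p ^ n) ^ e)) = x g)"
    if "x \<in> carrier A" for x e
    unfolding power_mult[symmetric]
    using pow_card_power[OF finite_R, of _ e] card_R
    by (intro A_frobenius_fixed_iff[OF prime_p char_p that _ inj]) (simp add: power_mult)
  have "x [^]\<^bsub>A\<^esub> ((p ^ n) ^ N) = x" if "x \<in> carrier A" for x
    using that exp by (simp add: fixed_iff)
  then obtain ds where "\<forall>d\<in>set ds. d dvd N"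
    "units_of A \<cong> cyclic_product (map (\<lambda>d. (p ^ n) ^ d - 1) ds)"
    "\<And>e. e > 0 \<Longrightarrow> card {x \<in> carrier A. x [^]\<^bsub>A\<^esub> ((p ^ n) ^ e) = x} = (p ^ n) ^ (\<Sum>d\<leftarrow>ds. gcd d e)"
    using reduced_algebra_units[OF field_axioms finite_R card_R assms(1) cring_A finite_A single_ring_hom] by blast
  moreover have "{x \<in> carrier A. x [^]\<^bsub>A\<^esub> ((p ^ n) ^ e) = x} =
      {f \<in> carrier G \<rightarrow>\<^sub>E carrier R. \<forall>g\<in>carrier G. f (g [^]\<^bsub>G\<^esub> ((p ^ n) ^ e)) = f g}" for e
    using fixed_iff unfolding carrier_A by blast
  ultimately show ?thesis by (intro exI[of _ ds]) auto
qed

end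

section \<open>The group \<open>C\<^bsub>16\<^esub> \<times> C\<^sub>2\<close>\<close>

text \<open>\<open>r\<close> chooses one point per orbit: it is constant along \<open>\<pi>\<close>,
  and its value is reached by iterating \<open>\<pi>\<close>. Hence \<open>r\<close> is idempotent,
  an invariant function is determined by its values on the chosen points, and arbitrary values there
  extend through \<open>r\<close>.\<close>

lemma card_invariant_functions:
  assumes "finite A"
    and step: "\<And>a. a \<in> A \<Longrightarrow> \<pi> a \<in> A \<and> r (\<pi> a) = r a"
    and orbit: "\<And>a. a \<in> A \<Longrightarrow> \<exists>k. r a = (\<pi> ^^ k) a"
  shows "card {f \<in> A \<rightarrow>\<^sub>E B. \<forall>a\<in>A. f (\<pi> a) = f a} = card B ^ card (r ` A)"
proof -
  have iter: "(\<pi> ^^ k) a \<in> A" if "a \<in> A" for a k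
    by (induction k) (use that step in auto)
  have rA: "r a \<in> A" if "a \<in> A" for a using orbit[OF that] iter[OF that] by auto
  have fr: "f (r a) = f a" if f: "\<forall>a\<in>A. f (\<pi> a) = f a" and a: "a \<in> A" for f :: "'a \<Rightarrow> 'b" and a
  proof -
    have "f ((\<pi> ^^ k) a) = f a" for k
      by (induction k) (use f iter[OF a] in auto)
    thus ?thesis using orbit[OF a] by auto
  qed
  have rr: "r (r a) = r a" if a: "a \<in> A" for a
  proof -
    have "r ((\<pi> ^^ k) a) = r a" for k
      by (induction k) (use step iter[OF a] in auto)
    thus ?thesis using orbit[OF a] by auto
  qed
  have "bij_betw (\<lambda>f. restrict f (r ` A)) {f \<in> A \<rightarrow>\<^sub>E B. \<forall>a\<in>A. f (\<pi> a) = f a} (r ` A \<rightarrow>\<^sub>E B)"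
  proof (rule bij_betwI[where g = "\<lambda>f. \<lambda>a\<in>A. f (r a)"])
    show "(\<lambda>f. restrict f (r ` A)) \<in> {f \<in> A \<rightarrow>\<^sub>E B. \<forall>a\<in>A. f (\<pi> a) = f a} \<rightarrow> r ` A \<rightarrow>\<^sub>E B"
      using rA by fastforce
    show "(\<lambda>f. \<lambda>a\<in>A. f (r a)) \<in> (r ` A \<rightarrow>\<^sub>E B) \<rightarrow> {f \<in> A \<rightarrow>\<^sub>E B. \<forall>a\<in>A. f (\<pi> a) = f a}"
      using step by fastforce
    show "(\<lambda>a\<in>A. restrict f (r ` A) (r a)) = f"
      if "f \<in> {f \<in> A \<rightarrow>\<^sub>E B. \<forall>a\<in>A. f (\<pi> a) = f a}" for f
      using that fr by (intro extensionalityI[of _ A]) (auto simp: PiE_iff)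
    show "restrict (\<lambda>a\<in>A. f (r a)) (r ` A) = f" if "f \<in> r ` A \<rightarrow>\<^sub>E B" for f
      using that rA rr by (intro extensionalityI[of _ "r ` A"]) (auto simp: PiE_iff)
  qed
  thus ?thesis
    using assms(1) by (simp add: bij_betw_same_card card_PiE)
qed

abbreviation C16xC2 :: "(int \<times> int) monoid" where
  "C16xC2 \<equiv> integer_mod_group 16 \<times>\<times> integer_mod_group 2"

lemma carrier_C16xC2: "carrier C16xC2 = {0..<16} \<times> {0..<2}"
  by (simp add: carrier_integer_mod_group)

lemma comm_group_C16xC2: "comm_group C16xC2"
  by (intro group.group_comm_groupI DirProd_group) (auto simp: add.commute)

lemma pow_C16xC2:
  assumes "x \<in> carrier C16xC2"
  shows "x [^]\<^bsub>C16xC2\<^esub> (m::nat) = ((int m * fst x) mod 16, (int m * snd x) mod 2)"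
proof (induction m)
  case (Suc m)
  thus ?case by (cases x) (simp add: mod_simps algebra_simps)
qed simp

text \<open>An odd power acts trivially on the factor of order 2, so only the first component moves.
  The multiplier is an integer residue so that the finitely many cases can be evaluated.\<close>

definition orbit_step :: "int \<Rightarrow> int \<times> int \<Rightarrow> int \<times> int" where
  "orbit_step u x = ((u * fst x) mod 16, snd x)"

text \<open>The powers up to \<open>u\<^sup>3\<close> suffice: every odd residue modulo \<open>16\<close> has order dividing \<open>4\<close>.\<close>

definition orbit_rep :: "int \<Rightarrow> int \<times> int \<Rightarrow> int \<times> int" where
  "orbit_rep u x = (min (min (fst x) ((u * fst x) mod 16))
    (min ((u * u * fst x) mod 16) ((u * u * u * fst x) mod 16)), snd x)"

text \<open>For odd \<open>u\<close> this is the number of orbits of multiplication by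
  \<open>u\<close>, counted through representatives to make it computable.\<close>

definition orbit_count :: "int \<Rightarrow> nat" where
  "orbit_count u = card (orbit_rep u ` ({0..<16} \<times> {0..<2}))"

text \<open>For odd \<open>u\<close> the fourth power is 1 modulo 16, so a step permutes the four
  candidates of the minimum cyclically. The check itself is by evaluation.\<close>

lemma orbit_rep_step:
  assumes "u \<in> {1, 3, 5, 7, 9, 11, 13, 15}" "x \<in> {0..<16} \<times> {0..<2}"
  shows "orbit_rep u (orbit_step u x) = orbit_rep u x"
proof -
  have "\<forall>u\<in>{1, 3, 5, 7, 9, 11, 13, 15}. \<forall>x\<in>{0..<16} \<times> {0..<2}. orbit_rep u (orbit_step u x) = orbit_rep u x"
    by code_simp
  thus ?thesis using assms by blast
qed

lemma orbit_rep_orbit: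
  assumes "x \<in> {0..<16} \<times> {0..<2}"
  shows "\<exists>k. orbit_rep u x = (orbit_step u ^^ k) x"
proof -
  have iter: "(orbit_step u ^^ k) x = ((u ^ k * fst x) mod 16, snd x)" for k
  proof (induction k)
    case 0
    then show ?case using assms by (auto simp: prod_eq_iff)
  next
    case (Suc k)
    thus ?case by (simp add: orbit_step_def mod_simps algebra_simps)
  qed
  have "fst x mod 16 = fst x" using assms by auto
  hence it: "(orbit_step u ^^ 0) x = (fst x, snd x)" "(orbit_step u ^^ 1) x = ((u * fst x) mod 16, snd x)"
    "(orbit_step u ^^ 2) x = ((u * u * fst x) mod 16, snd x)"
    "(orbit_step u ^^ 3) x = ((u * u * u * fst x) mod 16, snd x)"
    unfolding iter by (simp_all add: power2_eq_square power3_eq_cube)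
  have "min (min a b) (min c d) \<in> {a, b, c, d}" for a b c d :: int
    by (auto simp: min_def)
  hence "orbit_rep u x \<in> (\<lambda>m. (m, snd x)) ` {fst x, (u * fst x) mod 16, (u * u * fst x) mod 16, (u * u * u * fst x) mod 16}"
    unfolding orbit_rep_def by (rule imageI)
  thus ?thesis unfolding image_insert image_empty it[symmetric] by blast
qed

lemma orbit_count_values:
  "orbit_count 1 = 32" "orbit_count 3 = 14" "orbit_count 5 = 16" "orbit_count 7 = 18"
  "orbit_count 9 = 24" "orbit_count 11 = 14" "orbit_count 13 = 16" "orbit_count 15 = 18"
  by code_simp+

text \<open>The factor of order 2 vanishes at the first squaring, and the image of the cyclic factor
  of order 16 is halved each time.\<close>

lemma card_square_images:
  "card ((\<lambda>g. g [^]\<^bsub>C16xC2\<^esub> (2::nat)) ` carrier C16xC2) = 8"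
  "card ((\<lambda>g. g [^]\<^bsub>C16xC2\<^esub> (4::nat)) ` carrier C16xC2) = 4"
  "card ((\<lambda>g. g [^]\<^bsub>C16xC2\<^esub> (8::nat)) ` carrier C16xC2) = 2"
  "card ((\<lambda>g. g [^]\<^bsub>C16xC2\<^esub> (16::nat)) ` carrier C16xC2) = 1"
proof -
  have im: "(\<lambda>g. g [^]\<^bsub>C16xC2\<^esub> m) ` carrier C16xC2 =
      (\<lambda>x. ((int m * fst x) mod 16, (int m * snd x) mod 2)) ` ({0..<16} \<times> {0..<2})" for m :: nat
    unfolding carrier_C16xC2[symmetric] by (intro image_cong refl pow_C16xC2)
  have "card ((\<lambda>x. ((2 * fst x) mod 16, (2 * snd x) mod 2)) ` ({0..<16::int} \<times> {0..<2::int})) = 8"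
    "card ((\<lambda>x. ((4 * fst x) mod 16, (4 * snd x) mod 2)) ` ({0..<16::int} \<times> {0..<2::int})) = 4"
    "card ((\<lambda>x. ((8 * fst x) mod 16, (8 * snd x) mod 2)) ` ({0..<16::int} \<times> {0..<2::int})) = 2"
    "card ((\<lambda>x. ((16 * fst x) mod 16, (16 * snd x) mod 2)) ` ({0..<16::int} \<times> {0..<2::int})) = 1"
    by code_simp+
  thus "card ((\<lambda>g. g [^]\<^bsub>C16xC2\<^esub> (2::nat)) ` carrier C16xC2) = 8"
    "card ((\<lambda>g. g [^]\<^bsub>C16xC2\<^esub> (4::nat)) ` carrier C16xC2) = 4"
    "card ((\<lambda>g. g [^]\<^bsub>C16xC2\<^esub> (8::nat)) ` carrier C16xC2) = 2"
    "card ((\<lambda>g. g [^]\<^bsub>C16xC2\<^esub> (16::nat)) ` carrier C16xC2) = 1"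
    unfolding im by simp_all
qed

lemma odd_mod_16:
  assumes "odd m"
  shows "m mod 16 \<in> {1, 3, 5, 7, 9, 11, 13, 15 :: int}"
proof -
  have "m mod 16 \<in> {0..<16}" "odd (m mod 16)" using assms by (auto simp: dvd_mod_iff)
  moreover have "\<forall>v\<in>{0..<16::int}. odd v \<longrightarrow> v \<in> {1, 3, 5, 7, 9, 11, 13, 15}" by code_simp
  ultimately show ?thesis by blast
qed

text \<open>An odd exponent acts through its residue modulo 16 alone, so the fixed-point count of a
  power map reduces to a tabulated orbit number.\<close>

lemma card_invariant_C16xC2:
  assumes "odd m"
  shows "card {f \<in> carrier C16xC2 \<rightarrow>\<^sub>E B. \<forall>g\<in>carrier C16xC2. f (g [^]\<^bsub>C16xC2\<^esub> m) = f g} =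
    card B ^ orbit_count (int m mod 16)"
proof -
  define u where "u = int m mod 16"
  have u: "u \<in> {1, 3, 5, 7, 9, 11, 13, 15}"
    unfolding u_def using assms by (intro odd_mod_16) simp
  have pow: "g [^]\<^bsub>C16xC2\<^esub> m = orbit_step u g" if g: "g \<in> carrier C16xC2" for g
  proof -
    have "int m mod 2 = 1" using assms by (simp add: odd_iff_mod_2_eq_one[symmetric])
    hence "(int m * snd g) mod 2 = snd g mod 2"
      using mod_mult_left_eq[of "int m" 2 "snd g"] by simp
    also have "\<dots> = snd g" using g by (simp add: carrier_integer_mod_group mem_Times_iff)
    finally have "(int m * snd g) mod 2 = snd g" .
    thus ?thesis by (simp add: pow_C16xC2[OF g] orbit_step_def u_def mod_simps)
  qed
  have "{f \<in> carrier C16xC2 \<rightarrow>\<^sub>E B. \<forall>g\<in>carrier C16xC2. f (g [^]\<^bsub>C16xC2\<^esub> m) = f g} =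
      {f \<in> carrier C16xC2 \<rightarrow>\<^sub>E B. \<forall>g\<in>carrier C16xC2. f (orbit_step u g) = f g}"
    using pow by simp
  also have "card \<dots> = card B ^ card (orbit_rep u ` carrier C16xC2)"
  proof (rule card_invariant_functions)
    show "orbit_step u g \<in> carrier C16xC2 \<and> orbit_rep u (orbit_step u g) = orbit_rep u g"
      if "g \<in> carrier C16xC2" for g
      using that orbit_rep_step[OF u] unfolding carrier_C16xC2 by (auto simp: orbit_step_def)
    show "finite (carrier C16xC2)" by (simp add: carrier_integer_mod_group)
    show "\<exists>k. orbit_rep u g = (orbit_step u ^^ k) g" if "g \<in> carrier C16xC2" for g
      using that unfolding carrier_C16xC2 by (rule orbit_rep_orbit)
  qed
  finally show ?thesis by (simp only: orbit_count_def carrier_C16xC2 u_def)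
qed

section \<open>From multiplicities to the stated products\<close>

lemma sum_list_map_mset_cong:
  fixes f :: "'a \<Rightarrow> nat"
  assumes "mset xs = mset ys"
  shows "(\<Sum>x\<leftarrow>xs. f x) = (\<Sum>x\<leftarrow>ys. f x)"
  using assms by (metis mset_map sum_mset_sum_list)

lemma mset_eq_replicates3:
  assumes "set xs \<subseteq> {x, y, z}" "x \<noteq> y" "x \<noteq> z" "y \<noteq> z"
  shows "mset xs = mset (replicate (count_list xs x) x @ replicate (count_list xs y) y @ replicate (count_list xs z) z)"
  using assms
  by (intro multiset_eqI) (auto simp: count_mset count_list_0_iff)

lemma mset_eq_replicates4:
  assumes "set xs \<subseteq> {x, y, z, w}" "distinct [x, y, z, w]"
  shows "mset xs = mset (replicate (count_list xs x) x @ replicate (count_list xs y) y @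
    replicate (count_list xs z) z @ replicate (count_list xs w) w)"
  using assms
  by (intro multiset_eqI) (auto simp: count_mset count_list_0_iff)

text \<open>Peels one block of equal factors off the front of the list. Repeated use yields the
  right-nested products of the theorem.\<close>

lemma cyclic_power_append:
  assumes "cyclic_product ms \<cong> H"
  shows "cyclic_product (replicate k m @ ms) \<cong> cyclic_power m k \<times>\<times> H"
proof -
  have "cyclic_product (replicate k m @ ms) \<cong> cyclic_product (replicate k m) \<times>\<times> cyclic_product ms"
    by (rule group.iso_sym[OF DirProd_group[OF group_cyclic_product group_cyclic_product] cyclic_product_append])
  also have "\<dots> \<cong> cyclic_power m k \<times>\<times> H"
    unfolding cyclic_power_eq_cyclic_product
    by (rule group.DirProd_iso_trans[OF group_cyclic_product iso_refl assms])
  finally show ?thesis .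
qed

lemma cyclic_power_iso: "cyclic_product (replicate k m) \<cong> cyclic_power m k"
  unfolding cyclic_power_eq_cyclic_product by (rule iso_refl)

lemma finite_group_algebra_C16xC2:
  fixes F :: "('a, 'm) ring_scheme"
  assumes "Factorial_Ring.prime p" "n \<ge> 1" "field F" "finite (carrier F)" "card (carrier F) = p ^ n"
    "ring_characteristic F = p"
  shows "finite_group_algebra_over_finite_field F C16xC2 p n"
proof -
  interpret F: field F by fact
  interpret G: comm_group C16xC2 by (rule comm_group_C16xC2)
  have "add_pow F p \<one>\<^bsub>F\<^esub> = \<zero>\<^bsub>F\<^esub>"
    using F.add.pow_ord_eq_1[of "\<one>\<^bsub>F\<^esub>"] assms(6) by (simp add: ring_characteristic_def add_pow_def)
  moreover have "finite (carrier C16xC2)" by (simp add: carrier_integer_mod_group)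
  ultimately show ?thesis using assms by unfold_locales auto
qed

theorem theorem3p2:
  fixes F :: "('a, 'm) ring_scheme" and p n q :: nat
  assumes "Factorial_Ring.prime p" and "n \<ge> 1" and "q = p ^ n"
    and "field F" and "finite (carrier F)" and "card (carrier F) = q"
    and "ring_characteristic F = p"
  defines "U \<equiv> units_of (group_algebra F (integer_mod_group 16 \<times>\<times> integer_mod_group 2))"
  shows "(p = 2 \<longrightarrow>
      U \<cong> cyclic_power 16 n \<times>\<times> cyclic_power 8 n \<times>\<times> cyclic_power 4 (2 * n)
          \<times>\<times> cyclic_power 2 (20 * n) \<times>\<times> integer_mod_group (2 ^ n - 1)) \<and>
    (p \<noteq> 2 \<longrightarrow>
      ([int q = 1] (mod 16) \<longrightarrow>
        U \<cong> cyclic_power (p ^ n - 1) 32) \<and>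
      ([int q = - 1] (mod 16) \<longrightarrow>
        U \<cong> cyclic_power (p ^ n - 1) 4 \<times>\<times> cyclic_power (p ^ (2 * n) - 1) 14) \<and>
      ([int q = 3] (mod 16) \<or> [int q = - 5] (mod 16) \<longrightarrow>
        U \<cong> cyclic_power (p ^ n - 1) 4 \<times>\<times> cyclic_power (p ^ (2 * n) - 1) 6
            \<times>\<times> cyclic_power (p ^ (4 * n) - 1) 4) \<and>
      ([int q = - 3] (mod 16) \<or> [int q = 5] (mod 16) \<longrightarrow>
        U \<cong> cyclic_power (p ^ n - 1) 8 \<times>\<times> cyclic_power (p ^ (2 * n) - 1) 4
            \<times>\<times> cyclic_power (p ^ (4 * n) - 1) 4) \<and>
      ([int q = 7] (mod 16) \<longrightarrow>
        U \<cong> cyclic_power (p ^ n - 1) 4 \<times>\<times> cyclic_power (p ^ (2 * n) - 1) 14) \<and>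
      ([int q = - 7] (mod 16) \<longrightarrow>
        U \<cong> cyclic_power (p ^ n - 1) 16 \<times>\<times> cyclic_power (p ^ (2 * n) - 1) 8))"
proof -
  interpret finite_group_algebra_over_finite_field F C16xC2 p n
    using assms by (intro finite_group_algebra_C16xC2) auto
  have two: "U \<cong> cyclic_power 16 n \<times>\<times> cyclic_power 8 n \<times>\<times> cyclic_power 4 (2 * n)
          \<times>\<times> cyclic_power 2 (20 * n) \<times>\<times> integer_mod_group (2 ^ n - 1)" if p: "p = 2"
  proof -
    \<comment> \<open>The exponent of the group is 16, which fixes \<open>k = 4\<close> in
      \<open>modular_units\<close>.\<close>
    have exp: "g [^]\<^bsub>C16xC2\<^esub> (p ^ 4) = \<one>\<^bsub>C16xC2\<^esub>" if "g \<in> carrier C16xC2" for g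
      using pow_C16xC2[OF that, of 16] by (simp add: p)
    obtain es where es: "set es \<subseteq> {1..4}"
      and iso: "U \<cong> cyclic_product (map (\<lambda>e. 2 ^ e) es) \<times>\<times> integer_mod_group (2 ^ n - 1)"
      and sums: "\<And>i. i \<le> 4 \<Longrightarrow> (\<Sum>e\<leftarrow>es. min i e) +
        n * card ((\<lambda>g. g [^]\<^bsub>C16xC2\<^esub> ((2::nat) ^ i)) ` carrier C16xC2) = n * card (carrier C16xC2)"
      using modular_units[OF exp] unfolding U_def p by blast
    have "{1..4} = {4, 3, 2, 1::nat}" by auto
    with es have "set es \<subseteq> {4, 3, 2, 1}" by simp
    define c where "c = count_list es"
    have ms: "mset es = mset (replicate (c 4) 4 @ replicate (c 3) 3 @ replicate (c 2) 2 @ replicate (c 1) 1)"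
      unfolding c_def by (rule mset_eq_replicates4) (use \<open>set es \<subseteq> {4, 3, 2, 1}\<close> in auto)
    have sum: "(\<Sum>e\<leftarrow>es. min i e) = c 4 * min i 4 + c 3 * min i 3 + c 2 * min i 2 + c 1 * min i 1" for i
      by (subst sum_list_map_mset_cong[OF ms]) (simp add: sum_list_replicate)
    define im where "im i = card ((\<lambda>g. g [^]\<^bsub>C16xC2\<^esub> ((2::nat) ^ i)) ` carrier C16xC2)" for i
    have pows: "(2::nat) ^ 1 = 2" "(2::nat) ^ 2 = 4" "(2::nat) ^ 3 = 8" "(2::nat) ^ 4 = 16" by simp_all
    have im: "im 1 = 8" "im 2 = 4" "im 3 = 2" "im 4 = 1"
      unfolding im_def pows by (rule card_square_images)+
    have card: "card (carrier C16xC2) = 32" by (simp add: carrier_integer_mod_group)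
    \<comment> \<open>The four sums of minima equal 24n, 28n, 30n and 31n. The first, and then the
      successive differences 4n, 2n and n, count the factors of order at least 2, 4, 8 and
      16.\<close>
    have "c 4 + c 3 + c 2 + c 1 + n * 8 = n * 32" "c 4 * 2 + c 3 * 2 + c 2 * 2 + c 1 + n * 4 = n * 32"
      "c 4 * 3 + c 3 * 3 + c 2 * 2 + c 1 + n * 2 = n * 32" "c 4 * 4 + c 3 * 3 + c 2 * 2 + c 1 + n * 1 = n * 32"
      using sums[of 1] sums[of 2] sums[of 3] sums[of 4]
      unfolding sum im_def[symmetric] im card by simp_all
    hence c: "c 4 = n" "c 3 = n" "c 2 = 2 * n" "c 1 = 20 * n" by linarith+
    have "mset (map (\<lambda>e. 2 ^ e) es) = image_mset (\<lambda>e. 2 ^ e) (mset es)" by simp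
    also have "\<dots> = mset (replicate n 16 @ replicate n 8 @ replicate (2 * n) 4 @ replicate (20 * n) (2::nat))"
      unfolding ms c by simp
    finally have "cyclic_product (map (\<lambda>e. 2 ^ e) es) \<cong>
        cyclic_product (replicate n 16 @ replicate n 8 @ replicate (2 * n) 4 @ replicate (20 * n) 2)"
      by (rule cyclic_product_mset_cong)
    hence "cyclic_product (map (\<lambda>e. 2 ^ e) es) \<times>\<times> integer_mod_group (2 ^ n - 1) \<cong>
        cyclic_product (replicate n 16 @ replicate n 8 @ replicate (2 * n) 4 @ replicate (20 * n) 2)
        \<times>\<times> cyclic_product [2 ^ n - 1]"
      by (rule group.DirProd_iso_trans[OF group_cyclic_product])
        (rule group.iso_sym[OF group_cyclic_product cyclic_product_singleton])
    also have "\<dots> \<cong> cyclic_product ((replicate n 16 @ replicate n 8 @ replicate (2 * n) 4 @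
        replicate (20 * n) 2) @ [2 ^ n - 1])"
      by (rule cyclic_product_append)
    also have "\<dots> \<cong> cyclic_power 16 n \<times>\<times> cyclic_power 8 n \<times>\<times> cyclic_power 4 (2 * n)
          \<times>\<times> cyclic_power 2 (20 * n) \<times>\<times> integer_mod_group (2 ^ n - 1)"
      unfolding append_assoc by (intro cyclic_power_append cyclic_product_singleton)
    finally show ?thesis by (rule iso_trans[OF iso])
  qed
  \<comment> \<open>\<open>a\<close>, \<open>b\<close>, \<open>c\<close> count the field components
    of degree 1, 2, 4 over \<open>F\<close>. The equations are the fixed-point counts for e = 1, 2,
    4, since a component of degree d contributes \<open>gcd d e\<close>.\<close>
  have odd_case: "\<exists>a b c. U \<cong> cyclic_product (replicate a (p ^ n - 1) @ replicate b (p ^ (2 * n) - 1) @ replicate c (p ^ (4 * n) - 1))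
      \<and> a + b + c = orbit_count (int q mod 16) \<and> a + 2 * b + 2 * c = orbit_count ((int q * int q) mod 16)
      \<and> a + 2 * b + 4 * c = 32" if p: "p \<noteq> 2"
  proof -
    have "odd p" using p prime_p by (metis primes_dvd_imp_eq two_is_prime_nat)
    hence "odd q" using assms by simp
    have "int q mod 16 \<in> {1, 3, 5, 7, 9, 11, 13, 15}"
      using \<open>odd q\<close> by (intro odd_mod_16) simp
    \<comment> \<open>The group of units modulo 16 has exponent 4; this is the origin of
      \<open>N = 4\<close> and of the possible degrees 1, 2, 4.\<close>
    hence "(int q mod 16) ^ 4 mod 16 = 1" by auto
    hence q4: "int q ^ 4 mod 16 = 1" by (simp add: power_mod)
    have exp: "g [^]\<^bsub>C16xC2\<^esub> ((p ^ n) ^ 4) = g" if g: "g \<in> carrier C16xC2" for g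
    proof -
      have "int (q ^ 4) mod 2 = 1" using \<open>odd q\<close> by (simp add: odd_iff_mod_2_eq_one[symmetric])
      have "(int (q ^ 4) * fst g) mod 16 = ((int q ^ 4 mod 16) * fst g) mod 16" by (simp add: mod_mult_left_eq)
      hence 1: "(int (q ^ 4) * fst g) mod 16 = fst g" using g by (simp add: q4 carrier_integer_mod_group mem_Times_iff)
      have "(int (q ^ 4) * snd g) mod 2 = ((int (q ^ 4) mod 2) * snd g) mod 2" by (simp only: mod_mult_left_eq)
      hence 2: "(int (q ^ 4) * snd g) mod 2 = snd g"
        using g by (simp only: \<open>int (q ^ 4) mod 2 = 1\<close>) (auto simp: carrier_integer_mod_group mem_Times_iff)
      show ?thesis unfolding assms(3)[symmetric] pow_C16xC2[OF g] 1 2 by simp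
    qed
    obtain ds where ds: "\<forall>d\<in>set ds. d dvd 4"
      and iso: "U \<cong> cyclic_product (map (\<lambda>d. q ^ d - 1) ds)"
      and fixed: "\<And>e. e > 0 \<Longrightarrow> q ^ (\<Sum>d\<leftarrow>ds. gcd d e) =
        card {f \<in> carrier C16xC2 \<rightarrow>\<^sub>E carrier F. \<forall>g\<in>carrier C16xC2. f (g [^]\<^bsub>C16xC2\<^esub> (q ^ e)) = f g}"
      using semisimple_units[OF _ exp] unfolding U_def assms(3)[symmetric] by auto
    have "d \<in> {1, 2, 4}" if "d dvd 4" for d :: nat
    proof -
      have "d \<le> 4" using dvd_imp_le[OF that] by simp
      hence "d \<in> {0, 1, 2, 3, 4}" by auto
      thus ?thesis using that by auto
    qed
    hence "set ds \<subseteq> {1, 2, 4}" using ds by blast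
    define c where "c = count_list ds"
    have ms: "mset ds = mset (replicate (c 1) 1 @ replicate (c 2) 2 @ replicate (c 4) 4)"
      unfolding c_def by (rule mset_eq_replicates3) (use \<open>set ds \<subseteq> {1, 2, 4}\<close> in auto)
    have sum: "(\<Sum>d\<leftarrow>ds. gcd d e) = c 1 * gcd 1 e + c 2 * gcd 2 e + c 4 * gcd 4 e" for e
      by (subst sum_list_map_mset_cong[OF ms]) (simp add: sum_list_replicate)
    have "p > 1" using prime_p by (rule prime_gt_1_nat)
    hence "q > 1" unfolding assms(3) using assms(2) by (intro one_less_power) simp_all
    have orb: "c 1 * gcd 1 e + c 2 * gcd 2 e + c 4 * gcd 4 e = orbit_count (int (q ^ e) mod 16)" if "e > 0" for e
    proof -
      have "q ^ (\<Sum>d\<leftarrow>ds. gcd d e) = q ^ orbit_count (int (q ^ e) mod 16)"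
        using fixed[OF that] card_invariant_C16xC2[of "q ^ e" "carrier F"] \<open>odd q\<close> assms(6) by simp
      thus ?thesis using \<open>q > 1\<close> power_inject_exp sum by metis
    qed
    have "c 1 + c 2 + c 4 = orbit_count (int q mod 16)" using orb[of 1] by simp
    moreover have "c 1 + 2 * c 2 + 2 * c 4 = orbit_count ((int q * int q) mod 16)"
    proof -
      have "gcd 4 2 = (2::nat)" by (intro gcd_nat.absorb2) simp
      thus ?thesis using orb[of 2] by (simp add: power2_eq_square mult.commute)
    qed
    \<comment> \<open>At e = 4 every group element is its own orbit, so the equation says that the
      degrees of the components add up to the dimension 32.\<close>
    moreover have "c 1 + 2 * c 2 + 4 * c 4 = 32"
    proof -
      have "gcd 2 4 = (2::nat)" by (intro gcd_nat.absorb1) simp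
      thus ?thesis using orb[of 4] by (simp add: q4 orbit_count_values mult.commute)
    qed
    moreover have "mset (map (\<lambda>d. q ^ d - 1) ds) =
        mset (replicate (c 1) (p ^ n - 1) @ replicate (c 2) (p ^ (2 * n) - 1) @ replicate (c 4) (p ^ (4 * n) - 1))"
    proof -
      have "mset (map (\<lambda>d. q ^ d - 1) ds) = image_mset (\<lambda>d. q ^ d - 1) (mset ds)" by simp
      also have "\<dots> = mset (replicate (c 1) (q ^ 1 - 1) @ replicate (c 2) (q ^ 2 - 1) @ replicate (c 4) (q ^ 4 - 1))"
        unfolding ms by simp
      finally show ?thesis by (simp add: assms(3) power_mult[symmetric] mult.commute)
    qed
    ultimately show ?thesis using iso_trans[OF iso cyclic_product_mset_cong] by blast
  qed
  have power2: "cyclic_product (replicate a x @ replicate b y) \<cong> cyclic_power x a \<times>\<times> cyclic_power y b" for a b x y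
    by (intro cyclic_power_append cyclic_power_iso)
  have power3: "cyclic_product (replicate a x @ replicate b y @ replicate c z)
      \<cong> cyclic_power x a \<times>\<times> cyclic_power y b \<times>\<times> cyclic_power z c" for a b c x y z
    by (intro cyclic_power_append cyclic_power_iso)
  \<comment> \<open>The system has determinant 2, so its solution is unique. It therefore suffices
    to supply numbers for each residue and check the three equations.\<close>
  have U: "U \<cong> cyclic_product (replicate a (p ^ n - 1) @ replicate b (p ^ (2 * n) - 1) @ replicate c (p ^ (4 * n) - 1))"
    if np: "p \<noteq> 2" and u: "int q mod 16 = u" and abc: "a + b + c = orbit_count u" "a + 2 * b + 2 * c = orbit_count (u * u mod 16)"
      "a + 2 * b + 4 * c = 32" for u a b c
  proof -
    obtain a' b' c' where iso: "U \<cong> cyclic_product (replicate a' (p ^ n - 1) @ replicate b' (p ^ (2 * n) - 1) @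
        replicate c' (p ^ (4 * n) - 1))"
      and eq: "a' + b' + c' = orbit_count u" "a' + 2 * b' + 2 * c' = orbit_count ((int q * int q) mod 16)"
        "a' + 2 * b' + 4 * c' = 32"
      using odd_case[OF np] unfolding u by blast
    have "(int q * int q) mod 16 = u * u mod 16" unfolding u[symmetric] by (rule mod_mult_eq[symmetric])
    with eq(2) have "a' + 2 * b' + 2 * c' = orbit_count (u * u mod 16)" by (simp only:)
    with eq(1,3) abc have "a' = a" "b' = b" "c' = c" by linarith+
    thus ?thesis using iso by simp
  qed
  have m: "int q mod 16 = v mod 16" if "[int q = v] (mod 16)" for v using that by (simp add: cong_def)
  show ?thesis
  proof (intro conjI impI)
    assume "p \<noteq> 2"
    show "U \<cong> cyclic_power (p ^ n - 1) 32" if "[int q = 1] (mod 16)"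
      using U[of 1 32 0 0] m[OF that] \<open>p \<noteq> 2\<close> iso_trans[OF _ cyclic_power_iso]
      by (simp add: orbit_count_values)
    \<comment> \<open>The residue -1 enters as 15, and likewise -7 as 9, -5 as 11 and -3 as 13. A
      third multiplicity of 0 makes the block of degree-4 components an empty list.\<close>
    show "U \<cong> cyclic_power (p ^ n - 1) 4 \<times>\<times> cyclic_power (p ^ (2 * n) - 1) 14" if "[int q = - 1] (mod 16)"
      using U[of 15 4 14 0] m[OF that] \<open>p \<noteq> 2\<close> iso_trans[OF _ power2] by (simp add: orbit_count_values)
    show "U \<cong> cyclic_power (p ^ n - 1) 4 \<times>\<times> cyclic_power (p ^ (2 * n) - 1) 14" if "[int q = 7] (mod 16)"
      using U[of 7 4 14 0] m[OF that] \<open>p \<noteq> 2\<close> iso_trans[OF _ power2] by (simp add: orbit_count_values)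
    show "U \<cong> cyclic_power (p ^ n - 1) 16 \<times>\<times> cyclic_power (p ^ (2 * n) - 1) 8" if "[int q = - 7] (mod 16)"
      using U[of 9 16 8 0] m[OF that] \<open>p \<noteq> 2\<close> iso_trans[OF _ power2] by (simp add: orbit_count_values)
    show "U \<cong> cyclic_power (p ^ n - 1) 4 \<times>\<times> cyclic_power (p ^ (2 * n) - 1) 6 \<times>\<times> cyclic_power (p ^ (4 * n) - 1) 4"
      if "[int q = 3] (mod 16) \<or> [int q = - 5] (mod 16)"
    proof -
      have "int q mod 16 = 3 \<or> int q mod 16 = 11" using that m[of 3] m[of "- 5"] by auto
      hence "U \<cong> cyclic_product (replicate 4 (p ^ n - 1) @ replicate 6 (p ^ (2 * n) - 1) @ replicate 4 (p ^ (4 * n) - 1))"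
        using \<open>p \<noteq> 2\<close> U[of 3 4 6 4] U[of 11 4 6 4] by (auto simp: orbit_count_values)
      thus ?thesis by (rule iso_trans[OF _ power3])
    qed
    show "U \<cong> cyclic_power (p ^ n - 1) 8 \<times>\<times> cyclic_power (p ^ (2 * n) - 1) 4 \<times>\<times> cyclic_power (p ^ (4 * n) - 1) 4"
      if "[int q = - 3] (mod 16) \<or> [int q = 5] (mod 16)"
    proof -
      have "int q mod 16 = 13 \<or> int q mod 16 = 5" using that m[of "- 3"] m[of 5] by auto
      hence "U \<cong> cyclic_product (replicate 8 (p ^ n - 1) @ replicate 4 (p ^ (2 * n) - 1) @ replicate 4 (p ^ (4 * n) - 1))"
        using \<open>p \<noteq> 2\<close> U[of 13 8 4 4] U[of 5 8 4 4] by (auto simp: orbit_count_values)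
      thus ?thesis by (rule iso_trans[OF _ power3])
    qed
  qed (rule two)
qed

end
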